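(* Let $D=\{(a_0,a_1,a_2)\in\mathbb R^3\mid 0\leqslant a_0,\ a_1^2+a_2^2\leqslant a_0^2\}$. (i) The union of all free spectrahedra over $D$ covers the interior of $\mathcal C(D)^{\rm lrg}$; that is, for every $s\geqslant1$, every element of the interior of $\mathcal C_s(D)^{\rm lrg}$ lies in the level-$s$ cone of some free spectrahedron over $D$. Moreover, $\mathcal C(D)^{\rm sml}$ is the (levelwise) intersection of all free numerical ranges over $D$. (ii) There is a point in $\mathcal C(D)^{\rm lrg}$ (i.e. an element of $\mathcal C_s(D)^{\rm lrg}$ for some $s\geqslant1$) which is not contained in any free spectrahedron over $D$. (iii) There do not exist finitely many free spectrahedra over $D$ such that every free spectrahedron over $D$ is contained in one of them.
   Context: $\mathrm{Her}_s(\mathbb C)$ is the real vector space of Hermitian $s\times s$ matrices; $\geqslant0$ means positive semidefinite. A convex cone is proper if it is closed, has nonempty interior and contains no full line. An abstract operator system on $\mathbb C^3$ is a family $\mathcal C=(\mathcal C_s)_{s\geqslant1}$ of proper convex cones $\mathcal C_s\subseteq\mathrm{Her}_s(\mathbb C)^3$ such that $A=(A_0,A_1,A_2)\in\mathcal C_s$ and $V\in\mathrm{Mat}_{s,t}(\mathbb C)$ imply $V^*AV=(V^*A_0V,V^*A_1V,V^*A_2V)\in\mathcal C_t$. "Over $D$" means that the level-one cone $\mathcal C_1\subseteq\mathbb R^3$ equals $D$. Containment $\mathcal C\subseteq\mathcal D$ means $\mathcal C_s\subseteq\mathcal D_s$ for all $s\geqslant1$. The largest and smallest operator systems over $D$ are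 $\mathcal C_s(D)^{\rm lrg}=\{(A_0,A_1,A_2)\in\mathrm{Her}_s(\mathbb C)^3\mid\forall v\in\mathbb C^s:\ (v^*A_0v,v^*A_1v,v^*A_2v)\in D\}$ and $\mathcal C_s(D)^{\rm sml}=\{\sum_{j=1}^nP_j\otimes c_j\mid n\geqslant1,\ c_j\in D,\ P_j\in\mathrm{Her}_s(\mathbb C),\ P_j\geqslant0\}$, where $P\otimes c=(c_0P,c_1P,c_2P)$. A free spectrahedron is an abstract operator system of the form $\mathcal S(M_0,M_1,M_2)=(\mathcal S_s(M_0,M_1,M_2))_{s\geqslant1}$ with $\mathcal S_s(M_0,M_1,M_2)=\{(A_0,A_1,A_2)\in\mathrm{Her}_s(\mathbb C)^3\mid\sum_iA_i\otimes M_i\geqslant0\}$, for Hermitian matrices $M_0,M_1,M_2$ of a common finite size $r$ with $\sum_iu_iM_i=I_r$ for some interior point $u$ of the level-one cone. A free numerical range is a finitely generated abstract operator system, i.e. one that is the smallest abstract operator system containing some finite set of its elements; equivalently, it is generated by a single $M=(M_0,M_1,M_2)\in\mathrm{Her}_r(\mathbb C)^3$, and its level $s$ is $\{\sum_{j=1}^nV_j^*MV_j\mid n\geqslant1,\ V_j\in\mathrm{Mat}_{r,s}(\mathbb C)\}$. *)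

theory Defs
  imports
    "HOL-Analysis.L2_Norm"
    "HOL-Analysis.Abstract_Metric_Spaces"
    "Jordan_Normal_Form.Schur_Decomposition"
begin

section \<open>Triples of Hermitian matrices\<close>

type_synonym mat3 = "complex mat \<times> complex mat \<times> complex mat"

definition Her :: "nat \<Rightarrow> complex mat set" where
  "Her s = {A \<in> carrier_mat s s. mat_adjoint A = A}"

definition Her3 :: "nat \<Rightarrow> mat3 set" where
  "Her3 s = Her s \<times> Her s \<times> Her s"

text \<open>The order on \<^typ>\<open>complex\<close> is the partial one from \<open>Complex_Order\<close>, so \<open>0 \<le> z\<close>
  says that \<open>z\<close> is real and nonnegative.\<close>

definition psd :: "nat \<Rightarrow> complex mat \<Rightarrow> bool" where
  "psd s A \<longleftrightarrow> A \<in> Her s \<and> (\<forall>v \<in> carrier_vec s. 0 \<le> (A *\<^sub>v v) \<bullet>c v)"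

fun add3 :: "mat3 \<Rightarrow> mat3 \<Rightarrow> mat3" where
  "add3 (A0, A1, A2) (B0, B1, B2) = (A0 + B0, A1 + B1, A2 + B2)"

fun scale3 :: "real \<Rightarrow> mat3 \<Rightarrow> mat3" where
  "scale3 a (A0, A1, A2) =
     (complex_of_real a \<cdot>\<^sub>m A0, complex_of_real a \<cdot>\<^sub>m A1, complex_of_real a \<cdot>\<^sub>m A2)"

definition zero3 :: "nat \<Rightarrow> mat3" where
  "zero3 s = (0\<^sub>m s s, 0\<^sub>m s s, 0\<^sub>m s s)"

text \<open>The type \<^typ>\<open>complex mat\<close> is not a monoid under addition, so finite sums of triples
  of \<open>s \<times> s\<close> matrices are formed entrywise.\<close>

definition sum3 :: "nat \<Rightarrow> nat \<Rightarrow> (nat \<Rightarrow> mat3) \<Rightarrow> mat3" where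
  "sum3 s n X =
     (mat s s (\<lambda>ij. \<Sum>k<n. fst (X k) $$ ij),
      mat s s (\<lambda>ij. \<Sum>k<n. fst (snd (X k)) $$ ij),
      mat s s (\<lambda>ij. \<Sum>k<n. snd (snd (X k)) $$ ij))"

fun compress :: "complex mat \<Rightarrow> mat3 \<Rightarrow> mat3" where
  "compress V (A0, A1, A2) =
     (mat_adjoint V * A0 * V, mat_adjoint V * A1 * V, mat_adjoint V * A2 * V)"

text \<open>The Kronecker product, with \<open>(i, j)\<close> block equal to the \<open>(i, j)\<close> entry of \<open>A\<close> times \<open>B\<close>.\<close>

definition kronecker :: "complex mat \<Rightarrow> complex mat \<Rightarrow> complex mat" where
  "kronecker A B = mat (dim_row A * dim_row B) (dim_col A * dim_col B)
     (\<lambda>(i, j). A $$ (i div dim_row B, j div dim_col B) * B $$ (i mod dim_row B, j mod dim_col B))"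


section \<open>The topology on triples of Hermitian matrices\<close>

text \<open>The Frobenius distance; on \<^typ>\<open>complex \<times> complex \<times> complex\<close> the library's
  \<^const>\<open>dist\<close> is Euclidean.\<close>

fun entry3 :: "mat3 \<Rightarrow> nat \<times> nat \<Rightarrow> complex \<times> complex \<times> complex" where
  "entry3 (A0, A1, A2) ij = (A0 $$ ij, A1 $$ ij, A2 $$ ij)"

definition dist3 :: "nat \<Rightarrow> mat3 \<Rightarrow> mat3 \<Rightarrow> real" where
  "dist3 s A B = L2_set (\<lambda>ij. dist (entry3 A ij) (entry3 B ij)) ({..<s} \<times> {..<s})"

lemma Metric_space_Her3: "Metric_space (Her3 s) (dist3 s)"
proof
  fix A B :: mat3
  show "0 \<le> dist3 s A B" by (simp add: dist3_def)
  show "dist3 s A B = dist3 s B A" by (simp add: dist3_def dist_commute)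
next
  fix A B assume AB: "A \<in> Her3 s" "B \<in> Her3 s"
  obtain A0 A1 A2 B0 B1 B2 where eq: "A = (A0, A1, A2)" "B = (B0, B1, B2)"
    by (cases A, cases B)
  have dims: "A0 \<in> carrier_mat s s" "A1 \<in> carrier_mat s s" "A2 \<in> carrier_mat s s"
    "B0 \<in> carrier_mat s s" "B1 \<in> carrier_mat s s" "B2 \<in> carrier_mat s s"
    using AB by (auto simp: eq Her3_def Her_def)
  have "dist3 s A B = 0 \<longleftrightarrow> (\<forall>ij \<in> {..<s} \<times> {..<s}. entry3 A ij = entry3 B ij)"
    by (simp add: dist3_def L2_set_eq_0_iff)
  also have "\<dots> \<longleftrightarrow> A = B"
    using dims by (auto simp: eq mat_eq_iff)
  finally show "dist3 s A B = 0 \<longleftrightarrow> A = B" .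
next
  fix A B C assume "A \<in> Her3 s" "B \<in> Her3 s" "C \<in> Her3 s"
  have "dist3 s A C \<le> L2_set (\<lambda>ij. dist (entry3 A ij) (entry3 B ij) + dist (entry3 B ij) (entry3 C ij))
          ({..<s} \<times> {..<s})"
    unfolding dist3_def by (intro L2_set_mono dist_triangle) auto
  also have "\<dots> \<le> dist3 s A B + dist3 s B C"
    unfolding dist3_def by (rule L2_set_triangle_ineq)
  finally show "dist3 s A C \<le> dist3 s A B + dist3 s B C" .
qed

definition top3 :: "nat \<Rightarrow> mat3 topology" where
  "top3 s = Metric_space.mtopology (Her3 s) (dist3 s)"


section \<open>Abstract operator systems\<close>

definition proper_convex_cone :: "nat \<Rightarrow> mat3 set \<Rightarrow> bool" where
  "proper_convex_cone s K \<longleftrightarrow>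
     K \<subseteq> Her3 s \<and>
     (\<forall>A \<in> K. \<forall>B \<in> K. \<forall>a \<ge> 0. \<forall>b \<ge> 0. add3 (scale3 a A) (scale3 b B) \<in> K) \<and>
     closedin (top3 s) K \<and>
     (top3 s) interior_of K \<noteq> {} \<and>
     \<not> (\<exists>A \<in> Her3 s. \<exists>B \<in> Her3 s. B \<noteq> zero3 s \<and> (\<forall>t. add3 A (scale3 t B) \<in> K))"

text \<open>Families of cones are indexed by all of \<^typ>\<open>nat\<close>; level \<open>0\<close> carries no information
  and is never referred to.\<close>

definition op_system :: "(nat \<Rightarrow> mat3 set) \<Rightarrow> bool" where
  "op_system C \<longleftrightarrow>
     (\<forall>s \<ge> 1. proper_convex_cone s (C s)) \<and>
     (\<forall>s \<ge> 1. \<forall>t \<ge> 1. \<forall>A \<in> C s. \<forall>V \<in> carrier_mat s t. compress V A \<in> C t)"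

definition level_one :: "(nat \<Rightarrow> mat3 set) \<Rightarrow> (real \<times> real \<times> real) set" where
  "level_one C = {(a0, a1, a2).
     (mat 1 1 (\<lambda>_. complex_of_real a0), mat 1 1 (\<lambda>_. complex_of_real a1),
      mat 1 1 (\<lambda>_. complex_of_real a2)) \<in> C 1}"

definition sys_contained :: "(nat \<Rightarrow> mat3 set) \<Rightarrow> (nat \<Rightarrow> mat3 set) \<Rightarrow> bool" where
  "sys_contained C C' \<longleftrightarrow> (\<forall>s \<ge> 1. C s \<subseteq> C' s)"

text \<open>\<open>v\<^sup>* A v\<close> is real for Hermitian \<open>A\<close>, so \<^const>\<open>Re\<close> only changes the type.\<close>

definition largest_sys :: "(real \<times> real \<times> real) set \<Rightarrow> nat \<Rightarrow> mat3 set" where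
  "largest_sys D s = {(A0, A1, A2) \<in> Her3 s. \<forall>v \<in> carrier_vec s.
     (Re ((A0 *\<^sub>v v) \<bullet>c v), Re ((A1 *\<^sub>v v) \<bullet>c v), Re ((A2 *\<^sub>v v) \<bullet>c v)) \<in> D}"

fun tensor_point :: "complex mat \<Rightarrow> real \<times> real \<times> real \<Rightarrow> mat3" where
  "tensor_point P (c0, c1, c2) =
     (complex_of_real c0 \<cdot>\<^sub>m P, complex_of_real c1 \<cdot>\<^sub>m P, complex_of_real c2 \<cdot>\<^sub>m P)"

definition smallest_sys :: "(real \<times> real \<times> real) set \<Rightarrow> nat \<Rightarrow> mat3 set" where
  "smallest_sys D s = {sum3 s n (\<lambda>j. tensor_point (P j) (c j)) | n P c.
     1 \<le> n \<and> (\<forall>j < n. c j \<in> D \<and> psd s (P j))}"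


section \<open>Free spectrahedra and free numerical ranges\<close>

fun spectrahedron :: "nat \<Rightarrow> mat3 \<Rightarrow> nat \<Rightarrow> mat3 set" where
  "spectrahedron r (M0, M1, M2) s = {(A0, A1, A2) \<in> Her3 s.
     psd (s * r) (kronecker A0 M0 + kronecker A1 M1 + kronecker A2 M2)}"

definition free_spectrahedron :: "(nat \<Rightarrow> mat3 set) \<Rightarrow> bool" where
  "free_spectrahedron C \<longleftrightarrow>
     op_system C \<and>
     (\<exists>r \<ge> 1. \<exists>M0 M1 M2. (M0, M1, M2) \<in> Her3 r \<and>
        (\<forall>s \<ge> 1. C s = spectrahedron r (M0, M1, M2) s) \<and>
        (\<exists>(u0, u1, u2) \<in> interior (level_one C).
           complex_of_real u0 \<cdot>\<^sub>m M0 + complex_of_real u1 \<cdot>\<^sub>m M1 + complex_of_real u2 \<cdot>\<^sub>m M2 = 1\<^sub>m r))"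

text \<open>The generators may sit at different levels, so each one is paired with its level.\<close>

definition free_numerical_range :: "(nat \<Rightarrow> mat3 set) \<Rightarrow> bool" where
  "free_numerical_range C \<longleftrightarrow>
     op_system C \<and>
     (\<exists>G :: (nat \<times> mat3) set. finite G \<and>
        (\<forall>(s, A) \<in> G. 1 \<le> s \<and> A \<in> C s) \<and>
        (\<forall>C'. op_system C' \<and> (\<forall>(s, A) \<in> G. A \<in> C' s) \<longrightarrow> sys_contained C C'))"

end

theory Submission
  imports Defs "Jordan_Normal_Form.Spectral_Radius"
begin

text \<open>
  Write a triple \<open>A\<close> as the pair of \<open>A\<^sub>0\<close> and \<open>X = A\<^sub>1 - \<i> A\<^sub>2\<close>.  When \<open>A\<^sub>0\<close> is the identity, \<open>A\<close>
  lies in the largest system over the circular cone iff \<open>X\<close> has numerical radius at most 1, and in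
  the smallest one iff \<open>X\<close> is a contraction.  The proof compares the two through the truncated
  shifts: the nilpotent shift on \<open>\<complex>\<^sup>n\<^sup>+\<^sup>1\<close> is unitarily equivalent to all its rotations, and its
  numerical range is the disc of radius \<open>c\<^sub>n = cos (\<pi> / (n + 2))\<close>.  Divided by \<open>c\<^sub>n\<close> it yields a triple
  (\<open>shift_gen n\<close>) which defines a free spectrahedron and generates a free numerical range, both
  over the circular cone.  Since \<open>c\<^sub>n \<rightarrow> 1\<close>, the scaled shift is almost a contraction, and this makes
  the spectrahedra almost as large as possible and the numerical ranges almost as small.

  \<^item> Averaging over roots of unity shows that every \<open>A\<close> in the largest system satisfies the positivity
    condition of the unscaled shift (\<open>largest_sys_Toeplitz_positive\<close>).  For an interior point one
    may replace \<open>A\<^sub>0\<close> by \<open>c\<^sub>n A\<^sub>0\<close> when \<open>n\<close> is large, which absorbs the scaling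
    (\<open>interior_largest_sys_subset\<close>).

  \<^item> A point common to all these numerical ranges satisfies the contraction condition for \<open>c\<^sub>n X\<close>
    for every \<open>n\<close>, hence for \<open>X\<close>.  The contraction condition implies membership in the smallest
    system (\<open>spectrahedron_2_subset_smallest_sys\<close>): a Gram factorization writes \<open>A\<^sub>0 = F\<^sup>*F\<close> and
    \<open>X = F\<^sup>*UF\<close> with a unitary \<open>U\<close>, and the spectral decomposition of \<open>U\<close> splits \<open>A\<close> into summands
    \<open>P \<otimes> c\<close> with \<open>c\<close> on the boundary of the cone.

  \<^item> The \<open>2 \<times> 2\<close> triple \<open>shift3 2 2\<close>, for which \<open>A\<^sub>0\<close> is the identity and \<open>X\<close> is nilpotent of numerical
    radius 1 and norm 2, is in no free spectrahedron over the cone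
    (\<open>not_in_free_spectrahedron\<close>).  Otherwise the defining triple \<open>M\<close> would, after normalization, be a
    contraction \<open>T\<close> whose numerical range is the whole closed disc.  A contraction attains a boundary
    value of the disc in its numerical range only at an eigenvector, so each of the infinitely many
    points of the unit circle would be an eigenvalue of the finite matrix \<open>T\<close>.

  \<^item> If finitely many free spectrahedra over the cone absorbed all others, one of them would contain
    the shift spectrahedra for infinitely many \<open>n\<close>, hence the points \<open>shift3 2 (2 c\<^sub>n)\<close>, hence by
    closedness their limit \<open>shift3 2 2\<close> (\<open>no_finite_cofinal_family\<close>).
\<close>

section \<open>Sesquilinear forms of matrices\<close>

text \<open>Vectors are functions on \<open>\<nat>\<close> of which only the first \<open>s\<close> values count.  This makes it easy to form
  them blockwise and leaves no dimension conditions on them.\<close>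
definition sesq :: "nat \<Rightarrow> complex mat \<Rightarrow> (nat \<Rightarrow> complex) \<Rightarrow> (nat \<Rightarrow> complex) \<Rightarrow> complex" where
  "sesq s A f g = (\<Sum>i<s. \<Sum>j<s. A $$ (i, j) * f j * cnj (g i))"

lemma sprod_conv_sum: "dim_vec w = n \<Longrightarrow> v \<bullet>c w = (\<Sum>i<n. v $ i * cnj (w $ i))"
  by (auto simp: scalar_prod_def lessThan_atLeast0 intro!: sum.cong)

lemma mult_mat_vec_conv_sum:
  "i < dim_row A \<Longrightarrow> dim_col A = n \<Longrightarrow> dim_vec v = n \<Longrightarrow> (A *\<^sub>v v) $ i = (\<Sum>j<n. A $$ (i, j) * v $ j)"
  by (auto simp: scalar_prod_def lessThan_atLeast0 intro!: sum.cong)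

lemma mult_mat_conv_sum:
  "i < dim_row A \<Longrightarrow> dim_col A = n \<Longrightarrow> dim_row B = n \<Longrightarrow> j < dim_col B \<Longrightarrow>
    (A * B) $$ (i, j) = (\<Sum>k<n. A $$ (i, k) * B $$ (k, j))"
  by (auto simp: scalar_prod_def lessThan_atLeast0 intro!: sum.cong)

lemma adjoint_carrier [simp]: "A \<in> carrier_mat n m \<Longrightarrow> mat_adjoint A \<in> carrier_mat m n"
  by (auto simp: mat_adjoint_def)

lemma adjoint_dim [simp]: "dim_row (mat_adjoint A) = dim_col A" "dim_col (mat_adjoint A) = dim_row A"
  by (auto simp: mat_adjoint_def)

lemma adjoint_index [simp]:
  "i < dim_col A \<Longrightarrow> j < dim_row A \<Longrightarrow> mat_adjoint A $$ (i, j) = cnj (A $$ (j, i))"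
  by (simp add: mat_adjoint_def mat_of_rows_def)

lemma sesq_conv_sprod:
  assumes "A \<in> carrier_mat s s"
  shows "sesq s A f g = (A *\<^sub>v vec s f) \<bullet>c vec s g"
  using assms
  by (simp add: sesq_def sprod_conv_sum[of _ s] mult_mat_vec_conv_sum[of _ _ s] sum_distrib_right
      del: index_mult_mat_vec)

lemma sprod_conv_sesq:
  assumes "A \<in> carrier_mat s s" "v \<in> carrier_vec s" "w \<in> carrier_vec s"
  shows "(A *\<^sub>v v) \<bullet>c w = sesq s A (($) v) (($) w)"
  using assms by (simp add: sesq_conv_sprod) (metis (no_types, lifting) carrier_vecD eq_vecI dim_vec index_vec)

lemma Her_iff: "A \<in> Her s \<longleftrightarrow> A \<in> carrier_mat s s \<and> (\<forall>i<s. \<forall>j<s. cnj (A $$ (j, i)) = A $$ (i, j))"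
  by (auto simp: Her_def mat_eq_iff)

lemma HerD: "A \<in> Her s \<Longrightarrow> i < s \<Longrightarrow> j < s \<Longrightarrow> cnj (A $$ (j, i)) = A $$ (i, j)"
  by (auto simp: Her_iff)

lemma Her_carrier [simp, dest]: "A \<in> Her s \<Longrightarrow> A \<in> carrier_mat s s"
  by (auto simp: Her_def)

lemma sesq_Her_swap:
  assumes "A \<in> Her s"
  shows "sesq s A g f = cnj (sesq s A f g)"
proof -
  have "cnj (sesq s A f g) = (\<Sum>i<s. \<Sum>j<s. A $$ (j, i) * cnj (f j) * g i)"
    using HerD[OF assms] by (auto simp: sesq_def intro!: sum.cong)
  also have "\<dots> = sesq s A g f"
    unfolding sesq_def by (subst sum.swap) (auto simp: ac_simps)
  finally show ?thesis by simp
qed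

lemma sesq_Her_real: "A \<in> Her s \<Longrightarrow> sesq s A f f = complex_of_real (Re (sesq s A f f))"
  using sesq_Her_swap[of A s f f] by (simp add: complex_eq_iff)

lemma psd_iff:
  assumes "A \<in> Her s"
  shows "psd s A \<longleftrightarrow> (\<forall>f. 0 \<le> Re (sesq s A f f))"
proof
  assume *: "psd s A"
  show "\<forall>f. 0 \<le> Re (sesq s A f f)"
  proof
    fix f
    have "0 \<le> (A *\<^sub>v vec s f) \<bullet>c vec s f" using * by (auto simp: psd_def)
    then show "0 \<le> Re (sesq s A f f)" using assms by (simp add: sesq_conv_sprod less_eq_complex_def)
  qed
next
  assume *: "\<forall>f. 0 \<le> Re (sesq s A f f)"
  have "0 \<le> (A *\<^sub>v v) \<bullet>c v" if "v \<in> carrier_vec s" for v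
    using * sesq_Her_swap[OF assms, of "($) v" "($) v"]
    by (simp add: sprod_conv_sesq[OF Her_carrier[OF assms] that that] less_eq_complex_def complex_eq_iff)
  then show "psd s A" using assms by (simp add: psd_def)
qed

lemma sesq_add: "A \<in> carrier_mat s s \<Longrightarrow> B \<in> carrier_mat s s \<Longrightarrow>
  sesq s (A + B) f g = sesq s A f g + sesq s B f g"
  by (simp add: sesq_def sum.distrib algebra_simps)

lemma sesq_smult: "A \<in> carrier_mat s s \<Longrightarrow> sesq s (c \<cdot>\<^sub>m A) f g = c * sesq s A f g"
  by (simp add: sesq_def sum_distrib_left algebra_simps)

lemma sesq_cong: "(\<And>i. i < s \<Longrightarrow> f i = f' i) \<Longrightarrow> (\<And>i. i < s \<Longrightarrow> g i = g' i) \<Longrightarrow> sesq s A f g = sesq s A f' g'"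
  by (simp add: sesq_def)

lemma sesq_add_left: "sesq s A (\<lambda>i. f i + h i) g = sesq s A f g + sesq s A h g"
  by (simp add: sesq_def sum.distrib algebra_simps)
lemma sesq_add_right: "sesq s A f (\<lambda>i. g i + h i) = sesq s A f g + sesq s A f h"
  by (simp add: sesq_def sum.distrib algebra_simps)
lemma sesq_scale_left: "sesq s A (\<lambda>i. c * f i) g = c * sesq s A f g"
  by (simp add: sesq_def sum_distrib_left algebra_simps)
lemma sesq_scale_right: "sesq s A f (\<lambda>i. c * g i) = cnj c * sesq s A f g"
  by (simp add: sesq_def sum_distrib_left algebra_simps)

lemma sesq_sum_left: "sesq s A (\<lambda>i. \<Sum>k\<in>K. f k i) g = (\<Sum>k\<in>K. sesq s A (f k) g)"
  unfolding sesq_def sum_distrib_left sum_distrib_right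
  by (subst (2) sum.swap, rule sum.cong[OF refl], rule sum.swap)
lemma sesq_sum_right: "sesq s A f (\<lambda>i. \<Sum>k\<in>K. g k i) = (\<Sum>k\<in>K. sesq s A f (g k))"
  unfolding sesq_def cnj_sum sum_distrib_left sum_distrib_right
  by (subst (2) sum.swap, rule sum.cong[OF refl], rule sum.swap)

lemma sesq_unit: "i < s \<Longrightarrow> j < s \<Longrightarrow>
  sesq s A (\<lambda>k. if k = j then 1 else 0) (\<lambda>k. if k = i then 1 else 0) = A $$ (i, j)"
proof -
  assume "i < s" "j < s"
  have "sesq s A (\<lambda>k. if k = j then 1 else 0) (\<lambda>k. if k = i then 1 else 0) =
    (\<Sum>i'<s. \<Sum>j'<s. if j' = j then (if i' = i then A $$ (i', j') else 0) else 0)"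
    unfolding sesq_def by (intro sum.cong refl) auto
  then show ?thesis using \<open>i < s\<close> \<open>j < s\<close> by simp
qed

text \<open>Polarization over \<open>\<complex>\<close>.\<close>
lemma Her_eq_zero:
  assumes A: "A \<in> Her s" and z: "\<And>f. sesq s A f f = 0"
  shows "A = 0\<^sub>m s s"
proof -
  have p: "sesq s A f g = 0" for f g
  proof -
    have 1: "sesq s A f g + sesq s A g f = 0"
      using z[of "\<lambda>i. f i + g i"] z[of f] z[of g] by (simp add: sesq_add_left sesq_add_right)
    have 2: "\<i> * sesq s A f g - \<i> * sesq s A g f = 0"
      using z[of "\<lambda>i. \<i> * f i + g i"] z[of f] z[of g]
      by (simp add: sesq_add_left sesq_add_right sesq_scale_left sesq_scale_right)
    from 1 have "sesq s A g f = - sesq s A f g" by (simp add: eq_neg_iff_add_eq_0 add.commute)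
    with 2 show ?thesis by simp
  qed
  show ?thesis
  proof (rule eq_matI)
    fix i j assume "i < dim_row (0\<^sub>m s s :: complex mat)" "j < dim_col (0\<^sub>m s s :: complex mat)"
    then show "A $$ (i, j) = 0\<^sub>m s s $$ (i, j)"
      using sesq_unit[of i s j A] p by simp
  qed (use A in auto)
qed

section \<open>Linear pencils and free spectrahedra\<close>

lemma sum_lessThan_times: "(\<Sum>p<s * r. h p) = (\<Sum>i<s. \<Sum>k<r. h (i * r + k :: nat))"
  for h :: "nat \<Rightarrow> 'a :: comm_monoid_add"
proof -
  have "(\<Sum>p<s * r. h p) = (\<Sum>i<s. sum h {i * r..<i * r + r})"
    by (simp add: sum.nat_group)
  also have "\<dots> = (\<Sum>i<s. \<Sum>k<r. h (i * r + k))"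
  proof (rule sum.cong[OF refl])
    fix i
    show "sum h {i * r..<i * r + r} = (\<Sum>k<r. h (i * r + k))"
      using sum.shift_bounds_nat_ivl[of h 0 "i * r" r] by (simp add: lessThan_atLeast0 add.commute)
  qed
  finally show ?thesis .
qed

lemma sesq_kronecker:
  assumes A: "A \<in> carrier_mat s s" and M: "M \<in> carrier_mat r r"
  shows "sesq (s * r) (kronecker A M) F F =
    (\<Sum>k<r. \<Sum>l<r. M $$ (k, l) * sesq s A (\<lambda>j. F (j * r + l)) (\<lambda>i. F (i * r + k)))"
proof -
  have idx: "i * r + k < s * r" if "i < s" "k < r" for i k
  proof -
    have "i * r + k < Suc i * r" using that by simp
    also have "\<dots> \<le> s * r" using that by (intro mult_right_mono) auto
    finally show ?thesis .
  qed
  have "sesq (s * r) (kronecker A M) F F =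
    (\<Sum>i<s. \<Sum>k<r. \<Sum>j<s. \<Sum>l<r. M $$ (k, l) * (A $$ (i, j) * F (j * r + l) * cnj (F (i * r + k))))"
    unfolding sesq_def sum_lessThan_times
    using A M idx by (intro sum.cong refl) (simp add: kronecker_def ac_simps)
  also have "\<dots> = (\<Sum>k<r. \<Sum>i<s. \<Sum>l<r. \<Sum>j<s. M $$ (k, l) * (A $$ (i, j) * F (j * r + l) * cnj (F (i * r + k))))"
    by (subst sum.swap, rule sum.cong[OF refl], rule sum.cong[OF refl], rule sum.swap)
  also have "\<dots> = (\<Sum>k<r. \<Sum>l<r. \<Sum>i<s. \<Sum>j<s. M $$ (k, l) * (A $$ (i, j) * F (j * r + l) * cnj (F (i * r + k))))"
    by (intro sum.cong[OF refl] sum.swap)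
  finally show ?thesis
    by (simp add: sesq_def sum_distrib_left)
qed

lemma kronecker_Her: "A \<in> Her s \<Longrightarrow> M \<in> Her r \<Longrightarrow> kronecker A M \<in> Her (s * r)"
  unfolding Her_iff
proof (intro conjI allI impI)
  assume A: "A \<in> carrier_mat s s \<and> (\<forall>i<s. \<forall>j<s. cnj (A $$ (j, i)) = A $$ (i, j))"
    and M: "M \<in> carrier_mat r r \<and> (\<forall>i<r. \<forall>j<r. cnj (M $$ (j, i)) = M $$ (i, j))"
  show "kronecker A M \<in> carrier_mat (s * r) (s * r)" using A M by (auto simp: kronecker_def)
  fix p q assume pq: "p < s * r" "q < s * r"
  then have "r > 0" by (cases r) auto
  then have "p div r < s" "q div r < s" "p mod r < r" "q mod r < r"
    using pq by (auto simp: less_mult_imp_div_less)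
  then show "cnj (kronecker A M $$ (q, p)) = kronecker A M $$ (p, q)"
    using A M pq by (auto simp: kronecker_def)
qed

lemma Her_add: "A \<in> Her s \<Longrightarrow> B \<in> Her s \<Longrightarrow> A + B \<in> Her s"
  by (auto simp: Her_iff)

lemma Her_smult: "A \<in> Her s \<Longrightarrow> complex_of_real c \<cdot>\<^sub>m A \<in> Her s"
  by (auto simp: Her_iff)

text \<open>The value of the form of \<open>\<Sum>A\<^sub>i \<otimes> M\<^sub>i\<close> at the vector of \<open>\<complex>\<^sup>s \<otimes> \<complex>\<^sup>r\<close> with blocks \<open>w 0, \<dots>, w (r - 1)\<close> in
  \<open>\<complex>\<^sup>s\<close>.  Membership in a spectrahedron is decided on this form, so that the index arithmetic of Kronecker
  products can be avoided.\<close>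
fun pencil :: "nat \<Rightarrow> nat \<Rightarrow> mat3 \<Rightarrow> mat3 \<Rightarrow> (nat \<Rightarrow> nat \<Rightarrow> complex) \<Rightarrow> complex" where
  "pencil s r (A0, A1, A2) (M0, M1, M2) w = (\<Sum>k<r. \<Sum>l<r.
     M0 $$ (k, l) * sesq s A0 (w l) (w k) + M1 $$ (k, l) * sesq s A1 (w l) (w k) +
     M2 $$ (k, l) * sesq s A2 (w l) (w k))"

lemma kronecker_sum_Her:
  assumes A: "(A0, A1, A2) \<in> Her3 s" and M: "(M0, M1, M2) \<in> Her3 r"
  shows "kronecker A0 M0 + kronecker A1 M1 + kronecker A2 M2 \<in> Her (s * r)"
  using assms by (auto simp: Her3_def intro!: Her_add kronecker_Her)

lemma sesq_kronecker_sum: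
  assumes A: "(A0, A1, A2) \<in> Her3 s" and M: "(M0, M1, M2) \<in> Her3 r"
  shows "sesq (s * r) (kronecker A0 M0 + kronecker A1 M1 + kronecker A2 M2) F F =
    pencil s r (A0, A1, A2) (M0, M1, M2) (\<lambda>k i. F (i * r + k))"
proof -
  have H: "kronecker A0 M0 \<in> Her (s * r)" "kronecker A1 M1 \<in> Her (s * r)" "kronecker A2 M2 \<in> Her (s * r)"
    using A M by (auto simp: Her3_def intro!: kronecker_Her)
  then have C: "kronecker A0 M0 \<in> carrier_mat (s * r) (s * r)" "kronecker A1 M1 \<in> carrier_mat (s * r) (s * r)"
     "kronecker A2 M2 \<in> carrier_mat (s * r) (s * r)" by auto
  show ?thesis
    using A M C by (simp add: sesq_add add_carrier_mat[of _ "s*r" "s*r"] Her3_def sesq_kronecker sum.distrib)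
qed

lemma pencil_cong:
  "(\<And>k i. k < r \<Longrightarrow> i < s \<Longrightarrow> w k i = w' k i) \<Longrightarrow> pencil s r A M w = pencil s r A M w'"
proof -
  assume *: "\<And>k i. k < r \<Longrightarrow> i < s \<Longrightarrow> w k i = w' k i"
  then have "sesq s B (w l) (w k) = sesq s B (w' l) (w' k)" if "k < r" "l < r" for B k l
    using that by (intro sesq_cong) auto
  then show ?thesis by (cases A; cases M) (auto intro!: sum.cong)
qed

lemma spectrahedron_iff:
  assumes M: "M \<in> Her3 r"
  shows "A \<in> spectrahedron r M s \<longleftrightarrow> A \<in> Her3 s \<and> (\<forall>w. 0 \<le> Re (pencil s r A M w))"
proof -
  obtain A0 A1 A2 M0 M1 M2 where eq: "A = (A0, A1, A2)" "M = (M0, M1, M2)" by (cases A, cases M)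
  let ?K = "kronecker A0 M0 + kronecker A1 M1 + kronecker A2 M2"
  have "psd (s * r) ?K \<longleftrightarrow> (\<forall>w. 0 \<le> Re (pencil s r A M w))" if A: "A \<in> Her3 s"
  proof -
    note H = kronecker_sum_Her[OF A[unfolded eq] M[unfolded eq]]
    note Q = sesq_kronecker_sum[OF A[unfolded eq] M[unfolded eq]]
    have "0 \<le> Re (pencil s r A M w)" if "psd (s * r) ?K" for w
    proof -
      define F where "F = (\<lambda>p. w (p mod r) (p div r))"
      have "pencil s r A M w = pencil s r A M (\<lambda>k i. F (i * r + k))"
        by (rule pencil_cong) (auto simp: F_def)
      then show ?thesis
        using that unfolding psd_iff[OF H] Q eq by simp
    qed
    moreover have "psd (s * r) ?K" if "\<forall>w. 0 \<le> Re (pencil s r A M w)"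
      using that unfolding psd_iff[OF H] Q eq by simp
    ultimately show ?thesis by blast
  qed
  then show ?thesis by (auto simp: eq)
qed

lemma sesq_compress:
  assumes A: "A \<in> carrier_mat s s" and V: "V \<in> carrier_mat s t"
  shows "sesq t (mat_adjoint V * A * V) f g =
    sesq s A (\<lambda>i. \<Sum>j<t. V $$ (i, j) * f j) (\<lambda>i. \<Sum>j<t. V $$ (i, j) * g j)"
proof -
  have e: "(mat_adjoint V * A * V) $$ (p, q) =
      (\<Sum>j<s. \<Sum>i<s. cnj (V $$ (i, p)) * A $$ (i, j) * V $$ (j, q))" if "p < t" "q < t" for p q
  proof -
    have "(mat_adjoint V * A * V) $$ (p, q) = (\<Sum>j<s. (mat_adjoint V * A) $$ (p, j) * V $$ (j, q))"
      using A V that by (intro mult_mat_conv_sum) auto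
    also have "\<dots> = (\<Sum>j<s. (\<Sum>i<s. cnj (V $$ (i, p)) * A $$ (i, j)) * V $$ (j, q))"
      using A V that by (intro sum.cong refl arg_cong2[of _ _ _ _ "(*)"], subst mult_mat_conv_sum[of _ _ s]) auto
    finally show ?thesis by (simp add: sum_distrib_right)
  qed
  have "sesq t (mat_adjoint V * A * V) f g =
    (\<Sum>p<t. \<Sum>q<t. \<Sum>j<s. \<Sum>i<s. A $$ (i, j) * (V $$ (j, q) * f q) * (cnj (V $$ (i, p)) * cnj (g p)))"
    unfolding sesq_def using e by (intro sum.cong refl) (simp add: sum_distrib_right sum_distrib_left ac_simps)
  also have "\<dots> = (\<Sum>p<t. \<Sum>q<t. \<Sum>i<s. \<Sum>j<s. A $$ (i, j) * (V $$ (j, q) * f q) * (cnj (V $$ (i, p)) * cnj (g p)))"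
    by (intro sum.cong[OF refl] sum.swap)
  also have "\<dots> = (\<Sum>p<t. \<Sum>i<s. \<Sum>q<t. \<Sum>j<s. A $$ (i, j) * (V $$ (j, q) * f q) * (cnj (V $$ (i, p)) * cnj (g p)))"
    by (intro sum.cong[OF refl] sum.swap)
  also have "\<dots> = (\<Sum>p<t. \<Sum>i<s. \<Sum>j<s. \<Sum>q<t. A $$ (i, j) * (V $$ (j, q) * f q) * (cnj (V $$ (i, p)) * cnj (g p)))"
    by (intro sum.cong[OF refl] sum.swap)
  also have "\<dots> = (\<Sum>i<s. \<Sum>p<t. \<Sum>j<s. \<Sum>q<t. A $$ (i, j) * (V $$ (j, q) * f q) * (cnj (V $$ (i, p)) * cnj (g p)))"
    by (rule sum.swap)
  also have "\<dots> = (\<Sum>i<s. \<Sum>j<s. \<Sum>p<t. \<Sum>q<t. A $$ (i, j) * (V $$ (j, q) * f q) * (cnj (V $$ (i, p)) * cnj (g p)))"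
    by (intro sum.cong[OF refl] sum.swap)
  finally show ?thesis
    by (simp add: sesq_def sum_distrib_left sum_distrib_right)
qed

lemma compress_Her:
  assumes A: "A \<in> Her s" and V: "V \<in> carrier_mat s t"
  shows "mat_adjoint V * A * V \<in> Her t"
proof -
  have C: "mat_adjoint V * A * V \<in> carrier_mat t t"
    using A V adjoint_carrier[OF V] Her_carrier[OF A] by auto
  have "cnj ((mat_adjoint V * A * V) $$ (j, i)) = (mat_adjoint V * A * V) $$ (i, j)" if "i < t" "j < t" for i j
    by (simp only: sesq_unit[OF that, symmetric] sesq_unit[OF that(2) that(1), symmetric]
        sesq_compress[OF Her_carrier[OF A] V] sesq_Her_swap[OF A, symmetric])
  then show ?thesis using C by (auto simp: Her_iff)
qed

lemma compress_Her3: "A \<in> Her3 s \<Longrightarrow> V \<in> carrier_mat s t \<Longrightarrow> compress V A \<in> Her3 t"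
  by (cases A) (auto simp: Her3_def intro!: compress_Her)

lemma pencil_compress:
  assumes "A \<in> Her3 s" "V \<in> carrier_mat s t"
  shows "pencil t r (compress V A) M w = pencil s r A M (\<lambda>k i. \<Sum>j<t. V $$ (i, j) * w k j)"
  using assms by (cases A; cases M) (auto simp: Her3_def sesq_compress[of _ s V t])

lemma pencil_add: "A \<in> Her3 s \<Longrightarrow> B \<in> Her3 s \<Longrightarrow> pencil s r (add3 A B) M w = pencil s r A M w + pencil s r B M w"
  by (cases A; cases B; cases M) (auto simp: Her3_def sesq_add sum.distrib algebra_simps)

lemma pencil_scale: "A \<in> Her3 s \<Longrightarrow> pencil s r (scale3 a A) M w = of_real a * pencil s r A M w"
  by (cases A; cases M) (auto simp: Her3_def sesq_smult sum_distrib_left algebra_simps)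

lemma add3_Her3: "A \<in> Her3 s \<Longrightarrow> B \<in> Her3 s \<Longrightarrow> add3 A B \<in> Her3 s"
  by (cases A; cases B) (auto simp: Her3_def Her_add)
lemma scale3_Her3: "A \<in> Her3 s \<Longrightarrow> scale3 a A \<in> Her3 s"
  by (cases A) (auto simp: Her3_def Her_smult)

text \<open>The pencil treats \<open>A\<close> and \<open>M\<close> alike; consequently \<open>A\<close> lies in the spectrahedron of \<open>M\<close> iff \<open>M\<close>
  lies in the spectrahedron of \<open>A\<close>, which is the form in which duality is used below.\<close>
lemma pencil_swap:
  "pencil s r A M w = pencil r s M A (\<lambda>i k. w k i)"
proof -
  obtain A0 A1 A2 M0 M1 M2 where eq: "A = (A0, A1, A2)" "M = (M0, M1, M2)" by (cases A, cases M)
  define h where "h i j k l = (A0 $$ (i, j) * M0 $$ (k, l) + A1 $$ (i, j) * M1 $$ (k, l) + A2 $$ (i, j) * M2 $$ (k, l))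
    * w l j * cnj (w k i)" for i j k l
  have "pencil s r A M w = (\<Sum>k<r. \<Sum>l<r. \<Sum>i<s. \<Sum>j<s. h i j k l)"
    by (simp add: eq h_def sesq_def sum_distrib_left sum.distrib algebra_simps)
  also have "\<dots> = (\<Sum>k<r. \<Sum>i<s. \<Sum>l<r. \<Sum>j<s. h i j k l)"
    by (intro sum.cong[OF refl] sum.swap)
  also have "\<dots> = (\<Sum>i<s. \<Sum>k<r. \<Sum>l<r. \<Sum>j<s. h i j k l)" by (rule sum.swap)
  also have "\<dots> = (\<Sum>i<s. \<Sum>k<r. \<Sum>j<s. \<Sum>l<r. h i j k l)"
    by (intro sum.cong[OF refl] sum.swap)
  also have "\<dots> = (\<Sum>i<s. \<Sum>j<s. \<Sum>k<r. \<Sum>l<r. h i j k l)"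
    by (intro sum.cong[OF refl] sum.swap)
  also have "\<dots> = pencil r s M A (\<lambda>i k. w k i)"
    by (simp add: eq h_def sesq_def sum_distrib_left sum.distrib algebra_simps)
  finally show ?thesis .
qed

section \<open>Positive semidefinite matrices are sums of rank one matrices\<close>

lemma sesq_Cauchy_Schwarz:
  assumes A: "A \<in> Her s" and nn: "\<And>f. 0 \<le> Re (sesq s A f f)"
  shows "(cmod (sesq s A f g))\<^sup>2 \<le> Re (sesq s A f f) * Re (sesq s A g g)"
proof -
  define a b c where "a = Re (sesq s A f f)" and "b = Re (sesq s A g g)" and "c = sesq s A f g"
  have q: "0 \<le> a + x\<^sup>2 * (cmod c)\<^sup>2 * b - 2 * x * (cmod c)\<^sup>2" for x :: real
  proof -
    define t where "t = - of_real x * c"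
    have gf: "sesq s A g f = cnj c" unfolding c_def by (rule sesq_Her_swap[OF A])
    have bb: "sesq s A g g = of_real b" unfolding b_def by (rule sesq_Her_real[OF A])
    have "0 \<le> Re (sesq s A (\<lambda>i. f i + t * g i) (\<lambda>i. f i + t * g i))" by (rule nn)
    also have "\<dots> = Re (sesq s A f f + cnj t * c + t * cnj c + t * cnj t * of_real b)"
      by (simp add: sesq_add_left sesq_add_right sesq_scale_left sesq_scale_right gf bb c_def[symmetric] algebra_simps)
    also have "cnj t * c = - of_real (x * (cmod c)\<^sup>2)"
      unfolding t_def by (simp add: complex_norm_square mult.commute mult.left_commute del: of_real_power)
    also have "t * cnj c = - of_real (x * (cmod c)\<^sup>2)"
      unfolding t_def by (simp add: complex_norm_square mult.commute mult.left_commute del: of_real_power)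
    also have "t * cnj t = of_real (x\<^sup>2 * (cmod c)\<^sup>2)"
      unfolding t_def of_real_mult complex_norm_square by (simp add: power2_eq_square)
    finally show ?thesis by (simp add: a_def)
  qed
  have b0: "0 \<le> b" unfolding b_def by (rule nn)
  \<comment> \<open>The parabola in \<open>x\<close> is minimal at \<open>1 / b\<close>; for \<open>b = 0\<close> it is linear and must be constant.\<close>
  have "(cmod c)\<^sup>2 \<le> a * b"
  proof (cases "b = 0")
    case True
    have "(cmod c)\<^sup>2 = 0"
    proof (rule ccontr)
      assume "(cmod c)\<^sup>2 \<noteq> 0"
      then show False using q[of "(a + 1) / (2 * (cmod c)\<^sup>2)"] True by (simp add: field_simps)
    qed
    then show ?thesis using True by simp
  next
    case False
    then show ?thesis using q[of "1 / b"] b0 by (simp add: field_simps power2_eq_square)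
  qed
  then show ?thesis by (simp add: a_def b_def c_def)
qed

text \<open>Outer-product Cholesky elimination: subtracting the rank one matrix built from column \<open>m\<close> clears
  that row and column, and by Cauchy-Schwarz the remainder is still positive semidefinite.  If the
  diagonal entry is 0, Cauchy-Schwarz shows that the column vanishes already.\<close>
lemma psd_rank_one_decomposition_aux:
  assumes "m \<le> s" "psd s P" "\<And>i j. i < s \<Longrightarrow> j < s \<Longrightarrow> i < m \<or> j < m \<Longrightarrow> P $$ (i, j) = 0"
  shows "\<exists>w. \<forall>i<s. \<forall>j<s. P $$ (i, j) = (\<Sum>k\<in>{m..<s}. w k i * cnj (w k j))"
  using assms
proof (induction m arbitrary: P rule: inc_induct)
  case base
  then show ?case by auto
next
  case (step m)
  have H: "P \<in> Her s" using step.prems by (simp add: psd_def)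
  have nn: "0 \<le> Re (sesq s P f f)" for f using step.prems psd_iff[OF H] by blast
  define e where "e = (\<lambda>k. if k = m then 1 else 0 :: complex)"
  have col: "sesq s P e (\<lambda>k. if k = i then 1 else 0) = P $$ (i, m)" if "i < s" for i
    unfolding e_def by (rule sesq_unit) (use that step.hyps in auto)
  have ee: "sesq s P e e = P $$ (m, m)" using col[of m] step.hyps by (simp add: e_def)
  define d where "d = Re (P $$ (m, m))"
  have Pd: "P $$ (m, m) = of_real d" using sesq_Her_real[OF H, of e] by (simp add: ee d_def)
  have d0: "0 \<le> d" using nn[of e] by (simp add: ee d_def)
  define v where "v i = (if d = 0 then 0 else P $$ (i, m) / of_real (sqrt d))" for i
  have colz: "P $$ (i, m) = 0" if "d = 0" "i < s" for i
    using sesq_Cauchy_Schwarz[OF H nn, of e "\<lambda>k. if k = i then 1 else 0"] that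
    by (simp add: col ee d_def)
  define Q where "Q = mat s s (\<lambda>(i, j). P $$ (i, j) - v i * cnj (v j))"
  have QH: "Q \<in> Her s" using HerD[OF H] by (auto simp: Her_iff Q_def mult.commute)
  have "\<exists>w. \<forall>i<s. \<forall>j<s. Q $$ (i, j) = (\<Sum>k\<in>{Suc m..<s}. w k i * cnj (w k j))"
  proof (rule step.IH)
    show "psd s Q" unfolding psd_iff[OF QH]
    proof
      fix f
      have fe: "sesq s P f e = (\<Sum>j<s. cnj (P $$ (j, m)) * f j)"
      proof -
        have "sesq s P f e = (\<Sum>i<s. if i = m then \<Sum>j<s. P $$ (m, j) * f j else 0)"
          unfolding sesq_def by (intro sum.cong refl) (auto simp: e_def)
        also have "\<dots> = (\<Sum>j<s. P $$ (m, j) * f j)" using step.hyps by simp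
        also have "\<dots> = (\<Sum>j<s. cnj (P $$ (j, m)) * f j)"
          using HerD[OF H, of m] step.hyps by (intro sum.cong refl) simp
        finally show ?thesis .
      qed
      have "sesq s Q f f = sesq s P f f - (\<Sum>i<s. \<Sum>j<s. v i * cnj (v j) * f j * cnj (f i))"
        by (simp add: sesq_def Q_def algebra_simps sum_subtractf)
      also have "(\<Sum>i<s. \<Sum>j<s. v i * cnj (v j) * f j * cnj (f i)) =
          (\<Sum>i<s. v i * cnj (f i)) * cnj (\<Sum>i<s. v i * cnj (f i))"
        unfolding cnj_sum sum_product by (intro sum.cong refl) (simp add: ac_simps)
      also have "\<dots> = of_real ((cmod (\<Sum>i<s. v i * cnj (f i)))\<^sup>2)" by (rule complex_norm_square[symmetric])
      also have "cmod (\<Sum>i<s. v i * cnj (f i)) = (if d = 0 then 0 else cmod (sesq s P f e) / sqrt d)"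
      proof (cases "d = 0")
        case False
        then have "(\<Sum>i<s. v i * cnj (f i)) = cnj (sesq s P f e) / of_real (sqrt d)"
          by (simp add: v_def fe sum_divide_distrib)
        then show ?thesis using False d0 by (simp add: norm_divide)
      qed (simp add: v_def)
      finally have "Re (sesq s Q f f) = Re (sesq s P f f) - (if d = 0 then 0 else (cmod (sesq s P f e))\<^sup>2 / d)"
        using d0 by (auto simp: power_divide)
      then show "0 \<le> Re (sesq s Q f f)"
        using sesq_Cauchy_Schwarz[OF H nn, of f e] nn[of f] d0
        by (cases "d = 0") (simp_all add: ee Pd pos_divide_le_eq)
    qed
  next
    fix i j assume ij: "i < s" "j < s" "i < Suc m \<or> j < Suc m"
    have sq: "complex_of_real (sqrt d) * of_real (sqrt d) = of_real d"
      using d0 by (simp flip: of_real_mult)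
    have vm: "v m = of_real (sqrt d)" using Pd sq by (auto simp: v_def field_simps)
    have v0: "v i = 0" if "i < m" for i
      using that step.prems(2)[of i m] step.hyps by (auto simp: v_def)
    have A: "P $$ (i, m) = v i * of_real (sqrt d)" if "i < s" for i
      using colz[OF _ that] d0 by (auto simp: v_def)
    consider "i < m" | "j < m" | "i = m" | "j = m" using ij by linarith
    then show "Q $$ (i, j) = 0"
    proof cases
      case 3
      have "P $$ (m, j) = cnj (P $$ (j, m))" using HerD[OF H, of m j] 3 ij by simp
      then show ?thesis using ij 3 A[of j] vm by (simp add: Q_def)
    qed (use ij A[of i] vm v0 step.prems(2) in \<open>auto simp: Q_def\<close>)
  qed
  then obtain w where w: "\<forall>i<s. \<forall>j<s. Q $$ (i, j) = (\<Sum>k\<in>{Suc m..<s}. w k i * cnj (w k j))" by blast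
  show ?case
  proof (intro exI[of _ "w(m := v)"] allI impI)
    fix i j assume ij: "i < s" "j < s"
    have "P $$ (i, j) = v i * cnj (v j) + Q $$ (i, j)" using ij by (simp add: Q_def)
    also have "\<dots> = (\<Sum>k\<in>{m..<s}. (w(m := v)) k i * cnj ((w(m := v)) k j))"
      using step.hyps w ij by (subst sum.atLeast_Suc_lessThan) auto
    finally show "P $$ (i, j) = (\<Sum>k\<in>{m..<s}. (w(m := v)) k i * cnj ((w(m := v)) k j))" .
  qed
qed

lemma psd_rank_one_decomposition:
  assumes "psd s P"
  obtains w where "\<And>i j. i < s \<Longrightarrow> j < s \<Longrightarrow> P $$ (i, j) = (\<Sum>k<s. w k i * cnj (w k j))"
  using psd_rank_one_decomposition_aux[of 0 s P] assms by (auto simp: lessThan_atLeast0)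

section \<open>Closed and open sets of Hermitian triples\<close>

interpretation Her3: Metric_space "Her3 s" "dist3 s" for s by (rule Metric_space_Her3)

lemma dist_entry3_le: "i < s \<Longrightarrow> j < s \<Longrightarrow> dist (entry3 A (i, j)) (entry3 B (i, j)) \<le> dist3 s A B"
  unfolding dist3_def by (rule member_le_L2_set) auto

lemma closedin_top3I:
  assumes "K \<subseteq> Her3 s"
    and cl: "\<And>X A. (\<And>n. X n \<in> K) \<Longrightarrow> A \<in> Her3 s \<Longrightarrow>
      (\<And>i j. i < s \<Longrightarrow> j < s \<Longrightarrow> (\<lambda>n. entry3 (X n) (i, j)) \<longlonglongrightarrow> entry3 A (i, j)) \<Longrightarrow> A \<in> K"
  shows "closedin (top3 s) K"
  unfolding top3_def Her3.metric_closedin_iff_sequentially_closed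
proof (intro conjI allI impI)
  fix X A assume X: "range X \<subseteq> K \<and> limitin (Her3.mtopology s) X A sequentially"
  have XK: "X n \<in> K" for n using X by blast
  have lim: "(\<lambda>n. entry3 (X n) (i, j)) \<longlonglongrightarrow> entry3 A (i, j)" if "i < s" "j < s" for i j
  proof (rule tendstoI)
    fix e :: real assume "0 < e"
    then have "\<forall>\<^sub>F n in sequentially. X n \<in> Her3 s \<and> dist3 s (X n) A < e"
      using X by (simp add: Her3.limitin_metric)
    then show "\<forall>\<^sub>F n in sequentially. dist (entry3 (X n) (i, j)) (entry3 A (i, j)) < e"
      by eventually_elim (use dist_entry3_le[OF that] le_less_trans in blast)
  qed
  have "A \<in> Her3 s" using X by (simp add: Her3.limitin_metric)
  with XK show "A \<in> K" using lim by (rule cl)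
qed (rule assms)

lemma interior_top3_iff:
  assumes "K \<subseteq> Her3 s"
  shows "A \<in> (top3 s) interior_of K \<longleftrightarrow>
    A \<in> Her3 s \<and> (\<exists>e>0. \<forall>B \<in> Her3 s. dist3 s A B < e \<longrightarrow> B \<in> K)"
proof
  assume "A \<in> (top3 s) interior_of K"
  then obtain T where T: "openin (top3 s) T" "A \<in> T" "T \<subseteq> K" by (auto simp: interior_of_def)
  then obtain e where "e > 0" "Her3.mball s A e \<subseteq> T" 
    unfolding top3_def Her3.openin_mtopology by meson
  then show "A \<in> Her3 s \<and> (\<exists>e>0. \<forall>B \<in> Her3 s. dist3 s A B < e \<longrightarrow> B \<in> K)"
    using T assms by (auto simp: Her3.mball_def intro!: exI[of _ e])
next
  assume R: "A \<in> Her3 s \<and> (\<exists>e>0. \<forall>B \<in> Her3 s. dist3 s A B < e \<longrightarrow> B \<in> K)"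
  then obtain e where e: "e > 0" "\<forall>B \<in> Her3 s. dist3 s A B < e \<longrightarrow> B \<in> K" by blast
  then have "Her3.mball s A e \<subseteq> K" by (auto simp: Her3.mball_def)
  moreover have "openin (top3 s) (Her3.mball s A e)" by (simp add: top3_def)
  moreover have "A \<in> Her3.mball s A e" using e R by simp
  ultimately show "A \<in> (top3 s) interior_of K" by (auto simp: interior_of_def)
qed

lemma pencil_entry3:
  "pencil s r A (M0, M1, M2) w = (\<Sum>k<r. \<Sum>l<r.
     M0 $$ (k, l) * (\<Sum>i<s. \<Sum>j<s. fst (entry3 A (i, j)) * w l j * cnj (w k i)) +
     M1 $$ (k, l) * (\<Sum>i<s. \<Sum>j<s. fst (snd (entry3 A (i, j))) * w l j * cnj (w k i)) +
     M2 $$ (k, l) * (\<Sum>i<s. \<Sum>j<s. snd (snd (entry3 A (i, j))) * w l j * cnj (w k i)))"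
  by (cases A) (simp add: sesq_def)

lemma tendsto_pencil:
  assumes "\<And>i j. i < s \<Longrightarrow> j < s \<Longrightarrow> ((\<lambda>n. entry3 (X n) (i, j)) \<longlongrightarrow> entry3 A (i, j)) F"
  shows "((\<lambda>n. pencil s r (X n) M w) \<longlongrightarrow> pencil s r A M w) F"
proof (cases M)
  case (fields M0 M1 M2)
  show ?thesis unfolding fields pencil_entry3
    by (intro tendsto_sum tendsto_add tendsto_mult tendsto_const tendsto_fst tendsto_snd assms) simp_all
qed

section \<open>Systems of closed convex cones\<close>

text \<open>An abstract operator system without the requirements that the cones have interior points and
  contain no line.  The conditions kept here pass to intersections, whereas having interior points
  does not; under mild assumptions on level one both requirements are recovered at all levels.\<close>
definition cone_system :: "(nat \<Rightarrow> mat3 set) \<Rightarrow> bool" where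
  "cone_system C \<longleftrightarrow>
     (\<forall>s \<ge> 1. C s \<subseteq> Her3 s \<and>
       (\<forall>A \<in> C s. \<forall>B \<in> C s. \<forall>a \<ge> 0. \<forall>b \<ge> 0. add3 (scale3 a A) (scale3 b B) \<in> C s) \<and>
       closedin (top3 s) (C s)) \<and>
     (\<forall>s \<ge> 1. \<forall>t \<ge> 1. \<forall>A \<in> C s. \<forall>V \<in> carrier_mat s t. compress V A \<in> C t)"

lemma op_system_imp_cone_system: "op_system C \<Longrightarrow> cone_system C"
  unfolding op_system_def cone_system_def proper_convex_cone_def by meson

lemma cone_system_spectrahedron:
  assumes M: "M \<in> Her3 r"
  shows "cone_system (spectrahedron r M)"
  unfolding cone_system_def
proof (intro conjI allI impI ballI)
  fix s :: nat
  note iff = spectrahedron_iff[OF M]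
  show sub: "spectrahedron r M s \<subseteq> Her3 s" using iff by blast
  show "add3 (scale3 a A) (scale3 b B) \<in> spectrahedron r M s"
    if "A \<in> spectrahedron r M s" "B \<in> spectrahedron r M s" "0 \<le> a" "0 \<le> b" for A B a b
    using that by (auto simp: iff pencil_add[of _ s] pencil_scale[of _ s] add3_Her3 scale3_Her3)
  show "closedin (top3 s) (spectrahedron r M s)"
  proof (rule closedin_top3I[OF sub])
    fix X A assume X: "\<And>n. X n \<in> spectrahedron r M s" and A: "A \<in> Her3 s"
      and lim: "\<And>i j. i < s \<Longrightarrow> j < s \<Longrightarrow> (\<lambda>n. entry3 (X n) (i, j)) \<longlonglongrightarrow> entry3 A (i, j)"
    have "0 \<le> Re (pencil s r A M w)" for w
      using X by (intro tendsto_lowerbound[OF tendsto_Re[OF tendsto_pencil[OF lim]]]) (auto simp: iff)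
    then show "A \<in> spectrahedron r M s" using A by (simp add: iff)
  qed
  fix t A and V :: "complex mat" assume "A \<in> spectrahedron r M s" "V \<in> carrier_mat s t"
  then show "compress V A \<in> spectrahedron r M t"
    using compress_Her3[of A s V t] pencil_compress[of A s V t] by (simp add: iff)
qed

lemma cone_system_Inter:
  assumes "F \<noteq> {}" "\<And>C. C \<in> F \<Longrightarrow> cone_system C"
  shows "cone_system (\<lambda>s. \<Inter>C\<in>F. C s)"
  unfolding cone_system_def
proof (intro conjI allI impI ballI)
  fix s :: nat assume s: "1 \<le> s"
  have sub: "C s \<subseteq> Her3 s" and cl: "closedin (top3 s) (C s)" 
    and comb: "\<And>A B a b. A \<in> C s \<Longrightarrow> B \<in> C s \<Longrightarrow> 0 \<le> a \<Longrightarrow> 0 \<le> b \<Longrightarrow> add3 (scale3 a A) (scale3 b B) \<in> C s"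
    and comp: "\<And>A V t. 1 \<le> t \<Longrightarrow> A \<in> C s \<Longrightarrow> V \<in> carrier_mat s t \<Longrightarrow> compress V A \<in> C t"
    if "C \<in> F" for C
    using assms(2)[OF that] s unfolding cone_system_def by metis+
  show "(\<Inter>C\<in>F. C s) \<subseteq> Her3 s"
    using assms(1) sub by blast
  show "add3 (scale3 a A) (scale3 b B) \<in> (\<Inter>C\<in>F. C s)"
    if "A \<in> (\<Inter>C\<in>F. C s)" "B \<in> (\<Inter>C\<in>F. C s)" "0 \<le> a" "0 \<le> b" for A B a b
    using that by (intro INT_I comb) auto
  show "closedin (top3 s) (\<Inter>C\<in>F. C s)"
    using assms(1) cl by (intro closedin_INT) auto
  fix t A and V :: "complex mat" assume "1 \<le> t" "A \<in> (\<Inter>C\<in>F. C s)" "V \<in> carrier_mat s t"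
  then show "compress V A \<in> (\<Inter>C\<in>F. C t)"
    by (intro INT_I comp) auto
qed

context
  fixes C assumes C: "cone_system C"
begin

lemma cone_system_Her3: "1 \<le> s \<Longrightarrow> A \<in> C s \<Longrightarrow> A \<in> Her3 s"
  using C unfolding cone_system_def by (meson subsetD)

lemma cone_system_combine:
  "1 \<le> s \<Longrightarrow> A \<in> C s \<Longrightarrow> B \<in> C s \<Longrightarrow> 0 \<le> a \<Longrightarrow> 0 \<le> b \<Longrightarrow> add3 (scale3 a A) (scale3 b B) \<in> C s"
  using C unfolding cone_system_def by (meson subsetD)

lemma cone_system_compress:
  "1 \<le> s \<Longrightarrow> 1 \<le> t \<Longrightarrow> A \<in> C s \<Longrightarrow> V \<in> carrier_mat s t \<Longrightarrow> compress V A \<in> C t"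
  using C unfolding cone_system_def by (meson subsetD)

lemma cone_system_sum3:
  assumes s: "1 \<le> s" and "1 \<le> n" and "\<And>k. k < n \<Longrightarrow> X k \<in> C s"
  shows "sum3 s n X \<in> C s"
  using assms(2,3)
proof (induction n rule: nat_induct_at_least)
  case base
  have "X 0 \<in> C s" using base by simp
  moreover from this have "X 0 \<in> Her3 s" using cone_system_Her3 s by blast
  then have "sum3 s 1 X = X 0"
    by (cases "X 0") (auto simp: sum3_def Her3_def dest!: Her_carrier intro!: eq_matI)
  ultimately show ?case by simp
next
  case (Suc n)
  have "sum3 s n X \<in> C s" using Suc by simp
  moreover have "X n \<in> C s" using Suc by simp
  ultimately have "add3 (scale3 1 (sum3 s n X)) (scale3 1 (X n)) \<in> C s"
    using s by (intro cone_system_combine) auto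
  moreover have "X n \<in> Her3 s" using \<open>X n \<in> C s\<close> cone_system_Her3 s by blast
  then have "add3 (scale3 1 (sum3 s n X)) (scale3 1 (X n)) = sum3 s (Suc n) X"
    by (cases "X n") (auto simp: sum3_def Her3_def add.commute dest!: Her_carrier intro!: eq_matI)
  ultimately show ?case by simp
qed

end

definition point3 :: "real \<times> real \<times> real \<Rightarrow> mat3" where
  "point3 a = (mat 1 1 (\<lambda>_. complex_of_real (fst a)), mat 1 1 (\<lambda>_. complex_of_real (fst (snd a))),
     mat 1 1 (\<lambda>_. complex_of_real (snd (snd a))))"

lemma level_one_iff: "a \<in> level_one C \<longleftrightarrow> point3 a \<in> C 1"
  by (cases a) (simp add: level_one_def point3_def)

lemma point3_Her3: "point3 a \<in> Her3 1"
  by (simp add: point3_def Her3_def Her_iff)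

text \<open>The compression of a triple to a single vector, as a point of \<open>\<real>\<^sup>3\<close>.\<close>
definition quad3 :: "nat \<Rightarrow> mat3 \<Rightarrow> (nat \<Rightarrow> complex) \<Rightarrow> real \<times> real \<times> real" where
  "quad3 s A f = (Re (sesq s (fst A) f f), Re (sesq s (fst (snd A)) f f), Re (sesq s (snd (snd A)) f f))"

lemma compress_column:
  assumes A: "A \<in> Her3 s"
  shows "compress (mat s 1 (\<lambda>(i, _). f i)) A = point3 (quad3 s A f)"
proof -
  have "mat_adjoint (mat s 1 (\<lambda>(i, _). f i)) * B * mat s 1 (\<lambda>(i, _). f i) =
      mat 1 1 (\<lambda>_. complex_of_real (Re (sesq s B f f)))" (is "?L = ?R") if B: "B \<in> Her s" for B
  proof (rule eq_matI)
    fix i j assume "i < dim_row ?R" "j < dim_col ?R"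
    then have ij: "i = 0" "j = 0" by auto
    let ?e = "\<lambda>k. if k = 0 then 1 else 0 :: complex"
    have "?L $$ (0, 0) = sesq 1 ?L ?e ?e"
      by (rule sesq_unit[symmetric]) auto
    also have "\<dots> = sesq s B (\<lambda>i. \<Sum>j<1. mat s 1 (\<lambda>(i, _). f i) $$ (i, j) * ?e j)
        (\<lambda>i. \<Sum>j<1. mat s 1 (\<lambda>(i, _). f i) $$ (i, j) * ?e j)"
      by (rule sesq_compress) (use B in auto)
    also have "\<dots> = sesq s B f f"
      by (rule sesq_cong) auto
    finally have "?L $$ (0, 0) = sesq s B f f" .
    then show "?L $$ (i, j) = ?R $$ (i, j)" using sesq_Her_real[OF B, of f] ij by simp
  qed (use B in auto)
  then show ?thesis using A by (cases A) (simp add: Her3_def point3_def quad3_def)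
qed

lemma compress_row_point3:
  "compress (mat 1 s (\<lambda>(_, j). cnj (w j))) (point3 c) = tensor_point (mat s s (\<lambda>(i, j). w i * cnj (w j))) c"
proof -
  have "mat_adjoint (mat 1 s (\<lambda>(_, j). cnj (w j))) * mat 1 1 (\<lambda>_. complex_of_real a) * mat 1 s (\<lambda>(_, j). cnj (w j))
     = complex_of_real a \<cdot>\<^sub>m mat s s (\<lambda>(i, j). w i * cnj (w j))" for a
    by (rule eq_matI) (auto simp: scalar_prod_def)
  then show ?thesis by (cases c) (simp add: point3_def)
qed

lemma cone_system_quad3:
  assumes C: "cone_system C" and s: "1 \<le> s" and A: "A \<in> C s"
  shows "quad3 s A f \<in> level_one C"
  using cone_system_compress[OF C s _ A, of 1 "mat s 1 (\<lambda>(i, _). f i)"]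
    compress_column[OF cone_system_Her3[OF C s A], of f] by (simp add: level_one_iff)

text \<open>For \<open>P = w w\<^sup>*\<close> the triple \<open>P \<otimes> c\<close> is the compression of the level-one point \<open>c\<close> by the row \<open>w\<^sup>*\<close>;
  a general \<open>P\<close> is a sum of such rank one matrices.\<close>
lemma cone_system_tensor_point:
  assumes C: "cone_system C" and s: "1 \<le> s" and c: "c \<in> level_one C" and P: "psd s P"
  shows "tensor_point P c \<in> C s"
proof -
  obtain w where w: "\<And>i j. i < s \<Longrightarrow> j < s \<Longrightarrow> P $$ (i, j) = (\<Sum>k<s. w k i * cnj (w k j))"
    using psd_rank_one_decomposition[OF P] by blast
  have PC: "P \<in> carrier_mat s s" using P by (auto simp: psd_def)
  have "sum3 s s (\<lambda>k. tensor_point (mat s s (\<lambda>(i, j). w k i * cnj (w k j))) c) \<in> C s"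
    using s c by (intro cone_system_sum3[OF C s s])
      (auto simp: level_one_iff compress_row_point3[symmetric] intro!: cone_system_compress[OF C, of 1])
  moreover have "sum3 s s (\<lambda>k. tensor_point (mat s s (\<lambda>(i, j). w k i * cnj (w k j))) c) = tensor_point P c"
    using PC w by (cases c) (auto simp: sum3_def sum_distrib_left intro!: eq_matI)
  ultimately show ?thesis by simp
qed

lemma smallest_sys_subset:
  assumes C: "cone_system C" and s: "1 \<le> s" and D: "D \<subseteq> level_one C"
  shows "smallest_sys D s \<subseteq> C s"
proof
  fix A assume "A \<in> smallest_sys D s"
  then obtain n P c where A: "A = sum3 s n (\<lambda>j. tensor_point (P j) (c j))" "1 \<le> n"
      "\<forall>j<n. c j \<in> D \<and> psd s (P j)"
    by (auto simp: smallest_sys_def)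
  show "A \<in> C s" unfolding A(1)
    using A(2,3) D by (intro cone_system_sum3[OF C s] cone_system_tensor_point[OF C s]) auto
qed

lemma quad3_eq_zero:
  assumes B: "B \<in> Her3 s" and "\<And>f. quad3 s B f = (0, 0, 0)"
  shows "B = zero3 s"
proof -
  have "X = 0\<^sub>m s s" if "X \<in> Her s" "\<And>f. Re (sesq s X f f) = 0" for X
    using that sesq_Her_real[of X s] by (intro Her_eq_zero) auto
  then show ?thesis using assms by (cases B) (auto simp: Her3_def quad3_def zero3_def)
qed

lemma quad3_add_scale:
  assumes "A \<in> Her3 s" "B \<in> Her3 s"
  shows "quad3 s (add3 A (scale3 t B)) f = quad3 s A f + t *\<^sub>R quad3 s B f"
  using assms by (cases A; cases B) (auto simp: quad3_def Her3_def sesq_add[of _ s] sesq_smult[of _ s])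

text \<open>Lines need to be excluded at level one only: a line at level \<open>s\<close> in direction \<open>B \<noteq> 0\<close> is compressed
  by a vector \<open>f\<close> with \<open>quad3 s B f \<noteq> 0\<close> to a line at level one.\<close>
lemma op_systemI:
  assumes C: "cone_system C"
    and int: "\<And>s. 1 \<le> s \<Longrightarrow> (top3 s) interior_of (C s) \<noteq> {}"
    and pointed: "\<And>a b. (\<And>t. a + t *\<^sub>R b \<in> level_one C) \<Longrightarrow> b = 0"
  shows "op_system C"
proof -
  have "\<not> (\<exists>A\<in>Her3 s. \<exists>B\<in>Her3 s. B \<noteq> zero3 s \<and> (\<forall>t. add3 A (scale3 t B) \<in> C s))" if s: "1 \<le> s" for s
  proof safe
    fix A B assume A: "A \<in> Her3 s" and B: "B \<in> Her3 s" "B \<noteq> zero3 s" and t: "\<forall>t. add3 A (scale3 t B) \<in> C s"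
    have "quad3 s B f = 0" for f
      using cone_system_quad3[OF C s t[rule_format], of _ f]
      by (intro pointed[of "quad3 s A f"]) (simp add: quad3_add_scale[OF A B(1)])
    then show False using quad3_eq_zero[OF B(1)] B(2) by (simp add: zero_prod_def)
  qed
  then show ?thesis
    using C int unfolding op_system_def cone_system_def proper_convex_cone_def by meson
qed

section \<open>Unitary matrices\<close>

definition unitary :: "nat \<Rightarrow> complex mat \<Rightarrow> bool" where
  "unitary k U \<longleftrightarrow> U \<in> carrier_mat k k \<and> mat_adjoint U * U = 1\<^sub>m k"

lemma adjoint_mult:
  fixes A B :: "complex mat"
  assumes A: "A \<in> carrier_mat n m" and B: "B \<in> carrier_mat m p"
  shows "mat_adjoint (A * B) = mat_adjoint B * mat_adjoint A"
proof (rule eq_matI)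
  show "dim_row (mat_adjoint (A * B)) = dim_row (mat_adjoint B * mat_adjoint A)"
    "dim_col (mat_adjoint (A * B)) = dim_col (mat_adjoint B * mat_adjoint A)" using A B by auto
  fix i j assume "i < dim_row (mat_adjoint B * mat_adjoint A)" "j < dim_col (mat_adjoint B * mat_adjoint A)"
  then have ij: "i < p" "j < n" using A B by auto
  have "mat_adjoint (A * B) $$ (i, j) = cnj (\<Sum>k<m. A $$ (j, k) * B $$ (k, i))"
    using A B ij by (simp add: mult_mat_conv_sum[of _ _ m] del: index_mult_mat(1))
  also have "\<dots> = (\<Sum>k<m. mat_adjoint B $$ (i, k) * mat_adjoint A $$ (k, j))"
    using A B ij by (simp add: mult.commute)
  also have "\<dots> = (mat_adjoint B * mat_adjoint A) $$ (i, j)"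
    using A B ij by (intro mult_mat_conv_sum[symmetric]) auto
  finally show "mat_adjoint (A * B) $$ (i, j) = (mat_adjoint B * mat_adjoint A) $$ (i, j)" .
qed

lemma adjoint_adjoint: "mat_adjoint (mat_adjoint A) = (A :: complex mat)"
  by (rule eq_matI) auto

lemma gram_entry:
  assumes "F \<in> carrier_mat k s" "a < s" "b < s"
  shows "(mat_adjoint F * F) $$ (a, b) = (\<Sum>i<k. cnj (F $$ (i, a)) * F $$ (i, b))"
  using assms by (subst mult_mat_conv_sum[of _ _ k]) auto

lemma unitaryI:
  assumes U: "U \<in> carrier_mat k k"
    and "\<And>a b. a < k \<Longrightarrow> b < k \<Longrightarrow> (\<Sum>i<k. cnj (U $$ (i, a)) * U $$ (i, b)) = (if a = b then 1 else 0)"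
  shows "unitary k U"
  unfolding unitary_def
proof
  show "mat_adjoint U * U = 1\<^sub>m k"
  proof (rule eq_matI)
    fix i j assume "i < dim_row (1\<^sub>m k :: complex mat)" "j < dim_col (1\<^sub>m k :: complex mat)"
    then show "(mat_adjoint U * U) $$ (i, j) = 1\<^sub>m k $$ (i, j)"
      using gram_entry[OF U] assms(2) by (simp del: index_mult_mat(1))
  qed (use U in auto)
qed (rule U)

lemma unitary_carrier: "unitary k U \<Longrightarrow> U \<in> carrier_mat k k" by (simp add: unitary_def)

lemma unitary_left: "unitary k U \<Longrightarrow> mat_adjoint U * U = 1\<^sub>m k" by (simp add: unitary_def)

lemma unitary_right: "unitary k U \<Longrightarrow> U * mat_adjoint U = 1\<^sub>m k"
  unfolding unitary_def by (auto intro: mat_mult_left_right_inverse[of "mat_adjoint U" k U])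

lemma unitary_adjoint: "unitary k U \<Longrightarrow> unitary k (mat_adjoint U)"
  using unitary_right[of k U] by (simp add: unitary_def adjoint_adjoint)

lemma unitary_gram:
  assumes U: "unitary k U" and F: "F \<in> carrier_mat k s"
  shows "mat_adjoint (U * F) * (U * F) = mat_adjoint F * F"
proof -
  have UC: "U \<in> carrier_mat k k" using U by (rule unitary_carrier)
  note C = UC F adjoint_carrier[OF UC] adjoint_carrier[OF F]
  have "mat_adjoint (U * F) * (U * F) = (mat_adjoint F * mat_adjoint U) * (U * F)"
    by (simp add: adjoint_mult[OF UC F])
  also have "\<dots> = mat_adjoint F * (mat_adjoint U * (U * F))"
    using C by (intro assoc_mult_mat[of _ s k _ k _ s]) auto
  also have "mat_adjoint U * (U * F) = (mat_adjoint U * U) * F"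
    using C by (intro assoc_mult_mat[of _ k k _ k _ s, symmetric]) auto
  also have "\<dots> = F" using U F by (simp add: unitary_left)
  finally show ?thesis .
qed

lemma unitary_mult: "unitary k U \<Longrightarrow> unitary k V \<Longrightarrow> unitary k (U * V)"
  using unitary_gram[of k U V k] by (auto simp: unitary_def)

lemma unitary_one: "unitary k (1\<^sub>m k)"
  by (rule unitaryI) (auto simp: if_distrib cong: if_cong)

text \<open>Two families of vectors with the same Gram matrix differ by a unitary.  The unitary is built up
  one column at a time: if the first \<open>m\<close> columns agree already, the next one is corrected by a complex
  Householder reflection \<open>1 - d d\<^sup>* / z\<close> along the difference \<open>d\<close> of the two columns.  The equal inner
  products make \<open>d\<close> orthogonal to the first \<open>m\<close> columns, which therefore stay fixed.\<close>
lemma isometry_extends_to_unitary: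
  assumes F: "F \<in> carrier_mat k s" and G: "G \<in> carrier_mat k s"
    and gram: "mat_adjoint F * F = mat_adjoint G * G"
  obtains U where "unitary k U" "U * F = G"
proof -
  have "\<exists>U. unitary k U \<and> (\<forall>j<m. \<forall>i<k. (U * F) $$ (i, j) = G $$ (i, j))" if "m \<le> s" for m
    using that
  proof (induction m)
    case 0
    show ?case using unitary_one by auto
  next
    case (Suc m)
    then obtain U where U: "unitary k U" and eq: "\<And>i j. j < m \<Longrightarrow> i < k \<Longrightarrow> (U * F) $$ (i, j) = G $$ (i, j)"
      by auto
    have UC: "U \<in> carrier_mat k k" using U by (rule unitary_carrier)
    define H where "H = U * F"
    have H: "H \<in> carrier_mat k s" using UC F by (auto simp: H_def)
    have HG: "(\<Sum>i<k. cnj (H $$ (i, a)) * H $$ (i, b)) = (\<Sum>i<k. cnj (G $$ (i, a)) * G $$ (i, b))"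
      if "a < s" "b < s" for a b
      using gram_entry[OF H that] gram_entry[OF G that] unitary_gram[OF U F] gram
      by (simp add: H_def del: index_mult_mat(1))
    have m: "m < s" using Suc by simp
    define d where "d i = H $$ (i, m) - G $$ (i, m)" for i
    define z where "z = (\<Sum>i<k. cnj (d i) * H $$ (i, m))"
    define n where "n = (\<Sum>i<k. cnj (d i) * d i)"
    show ?case
    proof (cases "n = 0")
      case True
      have "n = of_real (\<Sum>i<k. (cmod (d i))\<^sup>2)"
        unfolding n_def of_real_sum complex_norm_square by (simp add: mult.commute)
      then have "(\<Sum>i<k. (cmod (d i))\<^sup>2) = 0" using True by (simp del: of_real_sum)
      then have "\<forall>i<k. d i = 0" by (simp add: sum_nonneg_eq_0_iff)
      then show ?thesis using U eq by (auto simp: d_def H_def less_Suc_eq)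
    next
      case False
      \<comment> \<open>The two columns have the same norm; this is what makes \<open>V\<close> below unitary.\<close>
      have zn: "z + cnj z = n"
      proof -
        have "z + cnj z - n = (\<Sum>i<k. cnj (d i) * H $$ (i, m) + d i * cnj (H $$ (i, m)) - cnj (d i) * d i)"
          by (simp add: z_def n_def sum.distrib sum_subtractf)
        also have "\<dots> = (\<Sum>i<k. cnj (H $$ (i, m)) * H $$ (i, m)) - (\<Sum>i<k. cnj (G $$ (i, m)) * G $$ (i, m))"
          unfolding sum_subtractf[symmetric] by (intro sum.cong refl) (simp add: d_def algebra_simps)
        also have "\<dots> = 0" using HG[OF m m] by simp
        finally show ?thesis by simp
      qed
      then have z0: "z \<noteq> 0" using False by auto
      define V where "V = mat k k (\<lambda>(i, j). (if i = j then 1 else 0) - d i * cnj (d j) / z)"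
      have VC: "V \<in> carrier_mat k k" by (simp add: V_def)
      have VU: "unitary k V"
      proof (rule unitaryI[OF VC])
        fix a b assume ab: "a < k" "b < k"
        have "(\<Sum>i<k. cnj (V $$ (i, a)) * V $$ (i, b)) =
            (\<Sum>i<k. (if i = a then (if a = b then 1 else 0) else 0)
              - (if i = a then d a * cnj (d b) / z else 0)
              - (if i = b then d a * cnj (d b) / cnj z else 0)
              + cnj (d i) * d i * (d a * cnj (d b) / (z * cnj z)))"
          using ab by (intro sum.cong refl) (auto simp: V_def divide_inverse algebra_simps)
        also have "\<dots> = (if a = b then 1 else 0) - d a * cnj (d b) / z - d a * cnj (d b) / cnj z
            + n * (d a * cnj (d b) / (z * cnj z))"
          using ab by (simp add: sum.distrib sum_subtractf n_def sum_distrib_right sum_divide_distrib)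
        also have "\<dots> = (if a = b then 1 else 0)"
          unfolding zn[symmetric] using z0 by (simp add: field_simps)
        finally show "(\<Sum>i<k. cnj (V $$ (i, a)) * V $$ (i, b)) = (if a = b then 1 else 0)" .
      qed
      have VH: "(V * H) $$ (i, j) = H $$ (i, j) - d i * (\<Sum>l<k. cnj (d l) * H $$ (l, j)) / z"
        if "i < k" "j < s" for i j
      proof -
        have "(V * H) $$ (i, j) = (\<Sum>l<k. V $$ (i, l) * H $$ (l, j))"
          using H VC that by (intro mult_mat_conv_sum) auto
        also have "\<dots> = (\<Sum>l<k. (if l = i then H $$ (i, j) else 0) - d i * (cnj (d l) * H $$ (l, j)) / z)"
          using that by (intro sum.cong refl) (auto simp: V_def algebra_simps)
        also have "\<dots> = H $$ (i, j) - d i * (\<Sum>l<k. cnj (d l) * H $$ (l, j)) / z"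
          using that by (simp add: sum_subtractf sum_distrib_left sum_divide_distrib)
        finally show ?thesis .
      qed
      have "(V * H) $$ (i, j) = G $$ (i, j)" if "i < k" "j < Suc m" for i j
      proof (cases "j = m")
        case True
        then show ?thesis using VH[OF \<open>i < k\<close> m] z0 unfolding z_def[symmetric] by (simp add: d_def)
      next
        case False
        then have j: "j < m" using that by simp
        have Hj: "H $$ (l, j) = G $$ (l, j)" if "l < k" for l using eq[OF j that] by (simp add: H_def)
        have "(\<Sum>l<k. cnj (d l) * H $$ (l, j)) =
            (\<Sum>l<k. cnj (H $$ (l, m)) * H $$ (l, j)) - (\<Sum>l<k. cnj (G $$ (l, m)) * G $$ (l, j))"
          unfolding sum_subtractf[symmetric] by (intro sum.cong refl) (simp add: d_def Hj algebra_simps)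
        also have "\<dots> = 0" using HG[OF m, of j] j m by simp
        finally show ?thesis using VH[of i j] Hj j m that by simp
      qed
      moreover have "V * H = (V * U) * F" unfolding H_def
        using assoc_mult_mat[OF VC UC F] by simp
      ultimately show ?thesis using unitary_mult[OF VU U] by (intro exI[of _ "V * U"]) auto
    qed
  qed
  from this[OF order_refl] obtain U where U: "unitary k U" "\<forall>j<s. \<forall>i<k. (U * F) $$ (i, j) = G $$ (i, j)"
    by blast
  moreover have "U * F = G"
    using U(2) F G unitary_carrier[OF U(1)] by (intro eq_matI) auto
  ultimately show ?thesis using that by blast
qed

definition diagonal :: "nat \<Rightarrow> (nat \<Rightarrow> complex) \<Rightarrow> complex mat" where
  "diagonal k e = mat k k (\<lambda>(i, j). if i = j then e j else 0)"

lemma diagonal_carrier [simp]: "diagonal k e \<in> carrier_mat k k" by (simp add: diagonal_def)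

lemma sandwich_diagonal_entry:
  assumes Z: "Z \<in> carrier_mat k s" and "a < s" "b < s"
  shows "(mat_adjoint Z * diagonal k e * Z) $$ (a, b) = (\<Sum>j<k. e j * (cnj (Z $$ (j, a)) * Z $$ (j, b)))"
proof -
  have "(mat_adjoint Z * diagonal k e * Z) $$ (a, b) = (\<Sum>j<k. (mat_adjoint Z * diagonal k e) $$ (a, j) * Z $$ (j, b))"
    using assms by (intro mult_mat_conv_sum) (auto simp: diagonal_def)
  also have "\<dots> = (\<Sum>j<k. e j * (cnj (Z $$ (j, a)) * Z $$ (j, b)))"
  proof (intro sum.cong refl)
    fix j assume j: "j \<in> {..<k}"
    have "(mat_adjoint Z * diagonal k e) $$ (a, j) = (\<Sum>l<k. mat_adjoint Z $$ (a, l) * diagonal k e $$ (l, j))"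
      using assms j by (intro mult_mat_conv_sum) (auto simp: diagonal_def)
    also have "\<dots> = (\<Sum>l<k. if l = j then cnj (Z $$ (j, a)) * e j else 0)"
      using assms j by (intro sum.cong refl) (auto simp: diagonal_def)
    also have "\<dots> = cnj (Z $$ (j, a)) * e j" using j by simp
    finally show "(mat_adjoint Z * diagonal k e) $$ (a, j) * Z $$ (j, b) = e j * (cnj (Z $$ (j, a)) * Z $$ (j, b))"
      by (simp add: ac_simps)
  qed
  finally show ?thesis .
qed

text \<open>Deflation: rotate a unit eigenvector to the last basis vector.  The last column of the rotated
  matrix is then a unimodular multiple of that basis vector, and since the other columns are orthogonal
  to it the rest of the last row vanishes as well, so a smaller unitary block splits off.\<close>
lemma unitary_diagonalizable:
  assumes "unitary k U"
  shows "\<exists>B e. unitary k B \<and> (\<forall>j<k. cmod (e j) = 1) \<and> U = mat_adjoint B * diagonal k e * B"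
  using assms
proof (induction k arbitrary: U)
  case 0
  have "U = mat_adjoint (1\<^sub>m 0) * diagonal 0 (\<lambda>_. 1) * 1\<^sub>m 0"
    using unitary_carrier[OF 0] by (intro eq_matI) (auto simp: diagonal_def)
  then show ?case using unitary_one[of 0] by blast
next
  case (Suc k)
  let ?n = "Suc k"
  have UC: "U \<in> carrier_mat ?n ?n" using Suc.prems by (rule unitary_carrier)
  obtain l where "eigenvalue U l"
    using spectrum_non_empty[OF UC] by (auto simp: spectrum_def)
  then obtain v where v: "v \<in> carrier_vec ?n" "v \<noteq> 0\<^sub>v ?n" "U *\<^sub>v v = l \<cdot>\<^sub>v v"
    using UC by (auto simp: eigenvalue_def eigenvector_def)
  define nv where "nv = (\<Sum>i<?n. (cmod (v $ i))\<^sup>2)"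
  have nv: "nv > 0"
  proof -
    obtain i where "i < ?n" "v $ i \<noteq> 0" using v(1,2) by (metis carrier_vecD eq_vecI index_zero_vec)
    then show ?thesis unfolding nv_def by (intro sum_pos2[of _ i]) auto
  qed
  define u where "u = (1 / of_real (sqrt nv)) \<cdot>\<^sub>v v"
  have u: "u \<in> carrier_vec ?n" "U *\<^sub>v u = l \<cdot>\<^sub>v u"
    using v UC by (auto simp: u_def mult_mat_vec[OF UC v(1)] smult_smult_assoc mult.commute)
  have sq: "(complex_of_real (cmod z))\<^sup>2 = z * cnj z" for z
    by (metis complex_norm_square of_real_power)
  have un: "(\<Sum>i<?n. cnj (u $ i) * u $ i) = 1"
  proof -
    have "(\<Sum>i<?n. cnj (u $ i) * u $ i) = (\<Sum>i<?n. of_real ((cmod (v $ i))\<^sup>2 / nv))"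
      using v(1) nv by (intro sum.cong refl)
         (simp add: u_def sq field_simps flip: of_real_mult)
    also have "\<dots> = of_real (nv / nv)"
      unfolding nv_def of_real_sum[symmetric] sum_divide_distrib ..
    finally show ?thesis using nv by simp
  qed
  define E where "E = mat ?n 1 (\<lambda>(i, _). if i = k then 1 else 0 :: complex)"
  define R where "R = mat ?n 1 (\<lambda>(i, _). u $ i)"
  have EC: "E \<in> carrier_mat ?n 1" and RC: "R \<in> carrier_mat ?n 1" by (auto simp: E_def R_def)
  have "mat_adjoint E * E = mat_adjoint R * R"
  proof (rule eq_matI)
    fix i j assume "i < dim_row (mat_adjoint R * R)" "j < dim_col (mat_adjoint R * R)"
    then have "i = 0" "j = 0" using RC by auto
    moreover have "(\<Sum>i<?n. cnj (E $$ (i, 0)) * E $$ (i, 0)) = (\<Sum>i<?n. if i = k then 1 else 0)"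
      by (intro sum.cong refl) (auto simp: E_def)
    moreover have "(\<Sum>i<?n. cnj (R $$ (i, 0)) * R $$ (i, 0)) = 1"
      using un by (simp add: R_def)
    ultimately show "(mat_adjoint E * E) $$ (i, j) = (mat_adjoint R * R) $$ (i, j)"
      by (simp add: gram_entry[OF EC] gram_entry[OF RC] del: index_mult_mat(1) sum.lessThan_Suc)
  qed (use EC RC in auto)
  then obtain W where W: "unitary ?n W" "W * E = R"
    using isometry_extends_to_unitary[OF EC RC] by blast
  have WC: "W \<in> carrier_mat ?n ?n" using W(1) by (rule unitary_carrier)
  note WaC = adjoint_carrier[OF WC]
  define T where "T = mat_adjoint W * (U * W)"
  have UWC: "U * W \<in> carrier_mat ?n ?n" using UC WC by auto
  have TU: "unitary ?n T"
    unfolding T_def by (intro unitary_mult unitary_adjoint W Suc.prems)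
  have TC: "T \<in> carrier_mat ?n ?n" using TU by (rule unitary_carrier)
  have UR: "U * R = l \<cdot>\<^sub>m R"
  proof (rule eq_matI)
    fix i j assume "i < dim_row (l \<cdot>\<^sub>m R)" "j < dim_col (l \<cdot>\<^sub>m R)"
    then have ij: "i < ?n" "j = 0" using RC by auto
    have "(U * R) $$ (i, 0) = (\<Sum>j<?n. U $$ (i, j) * u $ j)"
      using UC RC ij by (subst mult_mat_conv_sum[of _ _ ?n]) (auto simp: R_def)
    also have "\<dots> = (U *\<^sub>v u) $ i"
      using UC u ij by (subst mult_mat_vec_conv_sum[of _ _ ?n]) auto
    also have "\<dots> = l * u $ i" using u ij by simp
    finally show "(U * R) $$ (i, j) = (l \<cdot>\<^sub>m R) $$ (i, j)" using ij RC by (simp add: R_def)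
  qed (use UC RC in auto)
  have TE: "T * E = l \<cdot>\<^sub>m E"
  proof -
    have "T * E = mat_adjoint W * (U * W * E)" unfolding T_def by (rule assoc_mult_mat[OF WaC UWC EC])
    also have "U * W * E = U * (W * E)" by (rule assoc_mult_mat[OF UC WC EC])
    also have "\<dots> = l \<cdot>\<^sub>m (W * E)" using UR W(2) by simp
    also have "\<dots> = W * (l \<cdot>\<^sub>m E)" using mult_smult_distrib[OF WC EC] by simp
    also have "mat_adjoint W * (W * (l \<cdot>\<^sub>m E)) = mat_adjoint W * W * (l \<cdot>\<^sub>m E)"
      using EC by (intro assoc_mult_mat[OF WaC WC, symmetric]) auto
    also have "\<dots> = l \<cdot>\<^sub>m E" using unitary_left[OF W(1)] EC by (simp add: left_mult_one_mat[of _ ?n 1])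
    finally show ?thesis .
  qed
  have Tk: "T $$ (i, k) = (if i = k then l else 0)" if "i < ?n" for i
  proof -
    have "(T * E) $$ (i, 0) = (\<Sum>j<?n. T $$ (i, j) * E $$ (j, 0))"
      using TC EC that by (intro mult_mat_conv_sum) auto
    also have "\<dots> = (\<Sum>j<?n. if j = k then T $$ (i, k) else 0)"
      by (intro sum.cong refl) (auto simp: E_def)
    also have "\<dots> = T $$ (i, k)" by simp
    finally show ?thesis using TE EC that by (auto simp: E_def)
  qed
  have gramT: "(\<Sum>i<?n. cnj (T $$ (i, a)) * T $$ (i, b)) = (if a = b then 1 else 0)" if "a < ?n" "b < ?n" for a b
    using gram_entry[OF TC that] unitary_left[OF TU] that by simp
  have l1: "cnj l * l = 1" using gramT[of k k] Tk by simp
  have l1': "cmod l = 1"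
  proof -
    have "complex_of_real ((cmod l)\<^sup>2) = 1" unfolding complex_norm_square using l1 by (simp add: mult.commute)
    then have "(cmod l)\<^sup>2 = 1" using of_real_eq_1_iff by blast
    then show ?thesis using norm_ge_zero[of l] by (auto simp: power2_eq_1_iff simp del: norm_ge_zero)
  qed
  have rowk: "T $$ (k, j) = 0" if "j < k" for j
    using gramT[of k j] Tk that l1 by (auto)
  define T' where "T' = mat k k (\<lambda>(i, j). T $$ (i, j))"
  have "unitary k T'"
  proof (rule unitaryI)
    fix a b assume ab: "a < k" "b < k"
    then show "(\<Sum>i<k. cnj (T' $$ (i, a)) * T' $$ (i, b)) = (if a = b then 1 else 0)"
      using gramT[of a b] rowk by (simp add: T'_def)
  qed (simp add: T'_def)
  from Suc.IH[OF this] obtain B e where B: "unitary k B" and e: "\<forall>j<k. cmod (e j) = 1"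
    and T': "T' = mat_adjoint B * diagonal k e * B" by blast
  have BC: "B \<in> carrier_mat k k" using B by (rule unitary_carrier)
  define B' where "B' = mat ?n ?n (\<lambda>(i, j). if i < k \<and> j < k then B $$ (i, j) else if i = j then 1 else 0)"
  have B'C: "B' \<in> carrier_mat ?n ?n" by (simp add: B'_def)
  have B'U: "unitary ?n B'"
  proof (rule unitaryI[OF B'C])
    fix a b assume "a < ?n" "b < ?n"
    then show "(\<Sum>i<?n. cnj (B' $$ (i, a)) * B' $$ (i, b)) = (if a = b then 1 else 0)"
      using gram_entry[OF BC, of a b] unitary_left[OF B] by (auto simp: B'_def less_Suc_eq)
  qed
  define e' where "e' = e(k := l)"
  have TB: "T = mat_adjoint B' * diagonal ?n e' * B'"
  proof (rule eq_matI)
    fix i j assume "i < dim_row (mat_adjoint B' * diagonal ?n e' * B')" "j < dim_col (mat_adjoint B' * diagonal ?n e' * B')"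
    then have ij: "i < ?n" "j < ?n" using B'C by auto
    have *: "T $$ (i, j) = (\<Sum>p<k. e p * (cnj (B $$ (p, i)) * B $$ (p, j)))" if "i < k" "j < k"
    proof -
      have "T $$ (i, j) = T' $$ (i, j)" using that by (simp add: T'_def)
      also have "\<dots> = (\<Sum>p<k. e p * (cnj (B $$ (p, i)) * B $$ (p, j)))"
        unfolding T' by (rule sandwich_diagonal_entry[OF BC that])
      finally show ?thesis .
    qed
    show "T $$ (i, j) = (mat_adjoint B' * diagonal ?n e' * B') $$ (i, j)"
      unfolding sandwich_diagonal_entry[OF B'C ij]
      using ij * Tk rowk by (auto simp: B'_def e'_def less_Suc_eq)
  qed (use TC B'C in auto)
  define Z where "Z = B' * mat_adjoint W"
  have "U = mat_adjoint Z * diagonal ?n e' * Z"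
  proof -
    note B'aC = adjoint_carrier[OF B'C]
    have "mat_adjoint Z = W * mat_adjoint B'"
      unfolding Z_def using adjoint_mult[OF B'C WaC] by (simp add: adjoint_adjoint)
    then have "mat_adjoint Z * diagonal ?n e' * Z = W * (mat_adjoint B' * diagonal ?n e' * B') * mat_adjoint W"
      unfolding Z_def using WC WaC B'C B'aC
      by (simp add: assoc_mult_mat[of _ ?n ?n _ ?n _ ?n] mult_carrier_mat[of _ ?n ?n _ ?n])
    also have "\<dots> = W * T * mat_adjoint W" by (simp only: TB)
    also have "\<dots> = (W * mat_adjoint W) * U * (W * mat_adjoint W)"
      unfolding T_def using WC WaC UC
      by (simp add: assoc_mult_mat[of _ ?n ?n _ ?n _ ?n] mult_carrier_mat[of _ ?n ?n _ ?n])
    also have "\<dots> = U" using unitary_right[OF W(1)] UC by simp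
    finally show ?thesis by simp
  qed
  moreover have "unitary ?n Z" unfolding Z_def by (intro unitary_mult B'U unitary_adjoint W)
  moreover have "\<forall>j<?n. cmod (e' j) = 1" using e l1' by (auto simp: e'_def less_Suc_eq)
  ultimately show ?case by blast
qed

section \<open>The numerical radius of the truncated shift\<close>

text \<open>The numerical radius of the nilpotent shift on \<open>\<complex>\<^sup>n\<^sup>+\<^sup>1\<close>, that is, the largest eigenvalue of its real
  part.  The corresponding eigenvector has the positive entries \<open>shift_eigvec n 1, \<dots>, shift_eigvec n (n + 1)\<close>;
  the values 0 at the indices 0 and \<open>n + 2\<close> serve as boundary conditions of the recurrence.\<close>
definition shift_radius :: "nat \<Rightarrow> real" where
  "shift_radius n = cos (pi / real (n + 2))"

definition shift_eigvec :: "nat \<Rightarrow> nat \<Rightarrow> real" where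
  "shift_eigvec n k = sin (real k * pi / real (n + 2))"

lemma shift_eigvec_0 [simp]: "shift_eigvec n 0 = 0" by (simp add: shift_eigvec_def)
lemma shift_eigvec_end [simp]: "shift_eigvec n (Suc (Suc n)) = 0"
proof -
  have "real (Suc (Suc n)) * pi / real (n + 2) = pi" by (simp add: field_simps)
  then show ?thesis by (simp add: shift_eigvec_def)
qed

lemma shift_eigvec_pos: "k \<le> n \<Longrightarrow> 0 < shift_eigvec n (Suc k)"
proof -
  assume "k \<le> n"
  then have "real (Suc k) * pi < real (n + 2) * pi" by (intro mult_strict_right_mono) auto
  then have "real (Suc k) * pi / real (n + 2) < pi" by (subst divide_less_eq) (simp add: mult.commute)
  moreover have "0 < real (Suc k) * pi / real (n + 2)" by simp
  ultimately show ?thesis unfolding shift_eigvec_def by (intro sin_gt_zero)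
qed

lemma shift_eigvec_rec: "shift_eigvec n (Suc (Suc k)) + shift_eigvec n k = 2 * shift_radius n * shift_eigvec n (Suc k)"
proof -
  define h where "h = pi / real (n + 2)"
  define x where "x = real (Suc k) * h"
  have "shift_eigvec n (Suc (Suc k)) = sin (x + h)" "shift_eigvec n k = sin (x - h)" "shift_eigvec n (Suc k) = sin x"
    by (simp_all add: shift_eigvec_def x_def h_def add_divide_distrib algebra_simps)
  moreover have "shift_radius n = cos h" by (simp add: shift_radius_def h_def)
  ultimately show ?thesis by (simp add: sin_add sin_diff)
qed

lemma shift_radius_pos: "1 \<le> n \<Longrightarrow> 0 < shift_radius n"
proof -
  assume "1 \<le> n"
  then have "pi / real (n + 2) < pi / 2" by (intro divide_strict_left_mono) auto
  then show ?thesis unfolding shift_radius_def by (intro cos_gt_zero) auto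
qed

lemma shift_radius_le_1: "shift_radius n \<le> 1" by (simp add: shift_radius_def)

lemma shift_radius_tendsto: "shift_radius \<longlonglongrightarrow> 1"
proof -
  have "(\<lambda>n. pi / real (n + 2)) \<longlonglongrightarrow> 0"
    using LIMSEQ_ignore_initial_segment[OF lim_const_over_n[of pi], of 2] by simp
  then have "(\<lambda>n. cos (pi / real (n + 2))) \<longlonglongrightarrow> cos 0" by (intro tendsto_cos)
  then show ?thesis by (simp add: shift_radius_def[abs_def])
qed

lemma shift_radius_1: "shift_radius 1 = 1 / 2"
  by (simp add: shift_radius_def cos_60)

text \<open>Schur's test with the positive eigenvector \<open>q\<close>, indexed like \<open>x\<close>: the weighted inequality between arithmetic and
  geometric means bounds \<open>2 \<bar>x\<^sub>k\<^sub>+\<^sub>1 x\<^sub>k\<bar>\<close> by \<open>(q\<^sub>k\<^sub>+\<^sub>1 / q\<^sub>k) \<bar>x\<^sub>k\<bar>\<^sup>2 + (q\<^sub>k / q\<^sub>k\<^sub>+\<^sub>1) \<bar>x\<^sub>k\<^sub>+\<^sub>1\<bar>\<^sup>2\<close>, and by the recurrence the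
  coefficients of each \<open>\<bar>x\<^sub>k\<bar>\<^sup>2\<close> add up to twice the radius.\<close>
lemma shift_norm_bound:
  fixes x :: "nat \<Rightarrow> complex"
  shows "cmod (\<Sum>k<n. x (Suc k) * cnj (x k)) \<le> shift_radius n * (\<Sum>k<Suc n. (cmod (x k))\<^sup>2)"
proof -
  define q where "q = shift_eigvec n"
  have qpos: "0 < q (Suc k)" if "k \<le> n" for k using shift_eigvec_pos that by (simp add: q_def)
  have "cmod (\<Sum>k<n. x (Suc k) * cnj (x k)) \<le> (\<Sum>k<n. cmod (x (Suc k)) * cmod (x k))"
    by (rule order_trans[OF norm_sum]) (simp add: norm_mult)
  also have "\<dots> \<le> (\<Sum>k<n. (q (Suc (Suc k)) / q (Suc k) * (cmod (x k))\<^sup>2 + q (Suc k) / q (Suc (Suc k)) * (cmod (x (Suc k)))\<^sup>2) / 2)"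
  proof (rule sum_mono)
    fix k assume "k \<in> {..<n}"
    then have p: "0 < q (Suc k)" "0 < q (Suc (Suc k))" using qpos[of k] qpos[of "Suc k"] by auto
    have "0 \<le> (q (Suc (Suc k)) * cmod (x k) - q (Suc k) * cmod (x (Suc k)))\<^sup>2 / (q (Suc k) * q (Suc (Suc k)))"
      using p by simp
    also have "\<dots> = q (Suc (Suc k)) / q (Suc k) * (cmod (x k))\<^sup>2 + q (Suc k) / q (Suc (Suc k)) * (cmod (x (Suc k)))\<^sup>2
        - 2 * (cmod (x (Suc k)) * cmod (x k))"
      using p by (simp add: field_simps power2_eq_square)
    finally show "cmod (x (Suc k)) * cmod (x k) \<le>
        (q (Suc (Suc k)) / q (Suc k) * (cmod (x k))\<^sup>2 + q (Suc k) / q (Suc (Suc k)) * (cmod (x (Suc k)))\<^sup>2) / 2"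
      by simp
  qed
  also have "\<dots> = ((\<Sum>k<n. q (Suc (Suc k)) / q (Suc k) * (cmod (x k))\<^sup>2) + (\<Sum>k<n. q (Suc k) / q (Suc (Suc k)) * (cmod (x (Suc k)))\<^sup>2)) / 2"
    by (simp add: sum.distrib sum_divide_distrib add_divide_distrib)
  also have "(\<Sum>k<n. q (Suc (Suc k)) / q (Suc k) * (cmod (x k))\<^sup>2) = (\<Sum>k<Suc n. q (Suc (Suc k)) / q (Suc k) * (cmod (x k))\<^sup>2)"
    by (simp add: q_def)
  also have "(\<Sum>k<n. q (Suc k) / q (Suc (Suc k)) * (cmod (x (Suc k)))\<^sup>2) = (\<Sum>k<Suc n. q k / q (Suc k) * (cmod (x k))\<^sup>2)"
    unfolding sum.lessThan_Suc_shift by (simp add: q_def)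
  also have "((\<Sum>k<Suc n. q (Suc (Suc k)) / q (Suc k) * (cmod (x k))\<^sup>2) + (\<Sum>k<Suc n. q k / q (Suc k) * (cmod (x k))\<^sup>2)) / 2
      = (\<Sum>k<Suc n. shift_radius n * (cmod (x k))\<^sup>2)"
    unfolding sum.distrib[symmetric] sum_divide_distrib
  proof (intro sum.cong refl)
    fix k assume "k \<in> {..<Suc n}"
    then have p: "0 < q (Suc k)" using qpos by auto
    have "q (Suc (Suc k)) / q (Suc k) * (cmod (x k))\<^sup>2 + q k / q (Suc k) * (cmod (x k))\<^sup>2
        = (q (Suc (Suc k)) + q k) / q (Suc k) * (cmod (x k))\<^sup>2" by (simp add: add_divide_distrib distrib_right)
    also have "\<dots> = 2 * shift_radius n * (cmod (x k))\<^sup>2"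
      using p shift_eigvec_rec[of n k] by (simp add: q_def)
    finally show "(q (Suc (Suc k)) / q (Suc k) * (cmod (x k))\<^sup>2 + q k / q (Suc k) * (cmod (x k))\<^sup>2) / 2
        = shift_radius n * (cmod (x k))\<^sup>2" by simp
  qed
  finally show ?thesis by (simp only: sum_distrib_left)
qed

text \<open>Rotating the eigenvector by powers of \<open>z\<close> shows that the numerical range of the shift contains
  every point of the circle.\<close>
lemma shift_norm_attained:
  fixes z :: complex and n :: nat
  assumes "cmod z = 1"
  defines "x \<equiv> \<lambda>k. of_real (shift_eigvec n (Suc k)) * z ^ k"
  shows "(\<Sum>k<n. x (Suc k) * cnj (x k)) = z * of_real (shift_radius n * (\<Sum>k<Suc n. (cmod (x k))\<^sup>2))"
    "0 < (\<Sum>k<Suc n. (cmod (x k))\<^sup>2)"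
proof -
  define q where "q = shift_eigvec n"
  have zz: "z ^ k * cnj (z ^ k) = 1" for k
    using assms(1) by (simp add: complex_norm_square[symmetric] norm_power del: of_real_power complex_cnj_power)
  have nx: "(cmod (x k))\<^sup>2 = (q (Suc k))\<^sup>2" for k
    using assms(1) by (simp add: x_def q_def norm_mult norm_power)
  have "q (Suc 0) > 0" using shift_eigvec_pos[of 0 n] by (simp add: q_def)
  then show "0 < (\<Sum>k<Suc n. (cmod (x k))\<^sup>2)"
    unfolding nx by (intro sum_pos2[of _ 0]) auto
  have s: "(\<Sum>k<n. q (Suc (Suc k)) * q (Suc k)) = shift_radius n * (\<Sum>k<Suc n. (q (Suc k))\<^sup>2)"
  proof -
    have "2 * shift_radius n * (\<Sum>k<Suc n. (q (Suc k))\<^sup>2) = (\<Sum>k<Suc n. q (Suc k) * (q (Suc (Suc k)) + q k))"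
      unfolding sum_distrib_left using shift_eigvec_rec[of n]
      by (intro sum.cong refl) (simp add: q_def power2_eq_square)
    also have "\<dots> = (\<Sum>k<Suc n. q (Suc (Suc k)) * q (Suc k)) + (\<Sum>k<Suc n. q (Suc k) * q k)"
      unfolding sum.distrib[symmetric] by (intro sum.cong refl) (simp add: algebra_simps)
    also have "(\<Sum>k<Suc n. q (Suc (Suc k)) * q (Suc k)) = (\<Sum>k<n. q (Suc (Suc k)) * q (Suc k))" by (simp add: q_def)
    also have "(\<Sum>k<Suc n. q (Suc k) * q k) = (\<Sum>k<n. q (Suc (Suc k)) * q (Suc k))"
      unfolding sum.lessThan_Suc_shift by (simp add: q_def)
    finally show ?thesis by simp
  qed
  have "(\<Sum>k<n. x (Suc k) * cnj (x k)) = (\<Sum>k<n. z * of_real (q (Suc (Suc k)) * q (Suc k)))"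
  proof (intro sum.cong refl)
    fix k
    have "x (Suc k) * cnj (x k) = z * of_real (q (Suc (Suc k)) * q (Suc k)) * (z ^ k * cnj (z ^ k))"
      by (simp add: x_def q_def)
    then show "x (Suc k) * cnj (x k) = z * of_real (q (Suc (Suc k)) * q (Suc k))" unfolding zz by simp
  qed
  also have "\<dots> = z * of_real (\<Sum>k<n. q (Suc (Suc k)) * q (Suc k))"
    by (simp add: sum_distrib_left)
  finally show "(\<Sum>k<n. x (Suc k) * cnj (x k)) = z * of_real (shift_radius n * (\<Sum>k<Suc n. (cmod (x k))\<^sup>2))"
    unfolding s nx .
qed

lemma roots_of_unity_orthogonal:
  assumes k: "k < L" "k' < L"
  shows "(\<Sum>l<L. cis (2 * pi * real l / real L) ^ k * cnj (cis (2 * pi * real l / real L) ^ k')) = (if k = k' then of_nat L else 0)"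
proof -
  define x where "x = cis (2 * pi * (real k - real k') / real L)"
  have "(\<Sum>l<L. cis (2 * pi * real l / real L) ^ k * cnj (cis (2 * pi * real l / real L) ^ k')) = (\<Sum>l<L. x ^ l)"
    by (intro sum.cong refl) (simp add: x_def Complex.DeMoivre cis_cnj cis_mult field_simps)
  also have "\<dots> = (if k = k' then of_nat L else 0)"
  proof (cases "k = k'")
    case True
    then show ?thesis by (simp add: x_def)
  next
    case False
    have "x ^ L = cis (2 * pi * of_int (int k - int k'))"
      using k by (simp add: x_def Complex.DeMoivre)
    also have "\<dots> = 1" by (rule cis_multiple_2pi) simp
    finally have xL: "x ^ L = 1" .
    have "x \<noteq> 1"
    proof
      assume "x = 1"
      then have "cos (2 * pi * (real k - real k') / real L) = 1" by (simp add: x_def complex_eq_iff)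
      then obtain m :: int where m: "2 * pi * (real k - real k') / real L = of_int m * 2 * pi"
        by (auto simp: cos_one_2pi_int)
      then have "(2 * pi) * ((real k - real k') / real L) = (2 * pi) * of_int m" by simp
      then have "(real k - real k') / real L = of_int m" by (subst (asm) mult_left_cancel) auto
      then have "real k - real k' = of_int m * real L" using k by (simp add: field_simps)
      then have e: "int k - int k' = m * int L" by (metis of_int_diff of_int_eq_iff of_int_mult of_int_of_nat_eq)
      have "\<bar>int k - int k'\<bar> < int L" using k by auto
      then have "m = 0" unfolding e by (auto simp: abs_mult) (metis abs_ge_zero int_one_le_iff_zero_less le_less mult_le_cancel_right1 not_le zero_less_abs_iff of_nat_0_le_iff)
      then show False using e False by simp
    qed
    then show ?thesis using geometric_sum[of x L] xL False by simp
  qed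
  finally show ?thesis .
qed

section \<open>The triple of the weighted shift\<close>

text \<open>The identity together with the real and imaginary parts of \<open>t\<close> times a nilpotent shift on \<open>\<complex>\<^sup>N\<close>.\<close>
definition shift3 :: "nat \<Rightarrow> real \<Rightarrow> mat3" where
  "shift3 N t = (1\<^sub>m N,
    mat N N (\<lambda>(k, l). if l = Suc k then of_real t / 2 else if k = Suc l then of_real t / 2 else 0),
    mat N N (\<lambda>(k, l). if l = Suc k then - \<i> * of_real t / 2 else if k = Suc l then \<i> * of_real t / 2 else 0))"

lemma shift3_Her3: "shift3 N t \<in> Her3 N"
  by (auto simp: shift3_def Her3_def Her_iff)

text \<open>The form of \<open>A\<^sub>1 - \<i> A\<^sub>2\<close>.\<close>
definition twist :: "nat \<Rightarrow> mat3 \<Rightarrow> (nat \<Rightarrow> complex) \<Rightarrow> (nat \<Rightarrow> complex) \<Rightarrow> complex" where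
  "twist s A f g = sesq s (fst (snd A)) f g - \<i> * sesq s (snd (snd A)) f g"

lemma sum_superdiagonal:
  "(\<Sum>k<Suc n. \<Sum>l<Suc n. if l = Suc k then h k l else 0) = (\<Sum>k<n. h k (Suc k))"
  for h :: "nat \<Rightarrow> nat \<Rightarrow> 'a :: comm_monoid_add"
  by (simp del: sum.lessThan_Suc add: sum.delta) (simp add: less_Suc_eq)

lemma pencil_shift3:
  assumes A: "A \<in> Her3 s"
  shows "Re (pencil s (Suc n) A (shift3 (Suc n) t) w) =
    Re (\<Sum>k<Suc n. sesq s (fst A) (w k) (w k)) + t * Re (\<Sum>k<n. twist s A (w (Suc k)) (w k))"
proof -
  obtain A0 A1 A2 where eq: "A = (A0, A1, A2)" by (cases A)
  have H: "A1 \<in> Her s" "A2 \<in> Her s" using A by (auto simp: eq Her3_def)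
  define up where "up k l = of_real t / 2 * twist s A (w l) (w k)" for k l
  define low where "low k l = of_real t / 2 * cnj (twist s A (w k) (w l))" for k l
  have "pencil s (Suc n) A (shift3 (Suc n) t) w = (\<Sum>k<Suc n. \<Sum>l<Suc n.
      (if l = k then sesq s A0 (w k) (w k) else 0) + (if l = Suc k then up k l else 0) + (if k = Suc l then low k l else 0))"
    unfolding eq shift3_def pencil.simps
  proof (intro sum.cong refl, goal_cases)
    case (1 k l)
    have cj: "cnj (twist s A (w k) (w l)) = sesq s A1 (w l) (w k) + \<i> * sesq s A2 (w l) (w k)"
      using sesq_Her_swap[OF H(1), of "w l" "w k"] sesq_Her_swap[OF H(2), of "w l" "w k"]
      by (simp add: twist_def eq)
    have low: "low k l = of_real t / 2 * (sesq s A1 (w l) (w k) + \<i> * sesq s A2 (w l) (w k))"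
      unfolding low_def cj ..
    show ?case using 1 low by (auto simp: up_def twist_def eq algebra_simps)
  qed
  also have "\<dots> = (\<Sum>k<Suc n. \<Sum>l<Suc n. if l = k then sesq s A0 (w k) (w k) else 0)
      + (\<Sum>k<Suc n. \<Sum>l<Suc n. if l = Suc k then up k l else 0)
      + (\<Sum>k<Suc n. \<Sum>l<Suc n. if k = Suc l then low k l else 0)"
    by (simp only: sum.distrib)
  also have "(\<Sum>k<Suc n. \<Sum>l<Suc n. if l = k then sesq s A0 (w k) (w k) else 0) = (\<Sum>k<Suc n. sesq s A0 (w k) (w k))"
    by (intro sum.cong refl) (simp del: sum.lessThan_Suc)
  also have "(\<Sum>k<Suc n. \<Sum>l<Suc n. if l = Suc k then up k l else 0) = (\<Sum>k<n. up k (Suc k))"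
    by (rule sum_superdiagonal)
  also have "(\<Sum>k<Suc n. \<Sum>l<Suc n. if k = Suc l then low k l else 0) = (\<Sum>l<n. low (Suc l) l)"
    by (subst sum.swap) (rule sum_superdiagonal)
  finally show ?thesis
    by (simp add: eq up_def low_def sum_distrib_left[symmetric] del: sum.lessThan_Suc)
       (simp add: Re_sum sum_distrib_left sum_divide_distrib)
qed

lemma twist_shift3: "twist (Suc n) (shift3 (Suc n) t) f g = of_real t * (\<Sum>k<n. f k * cnj (g (Suc k)))"
proof -
  have "twist (Suc n) (shift3 (Suc n) t) f g =
    (\<Sum>k<Suc n. \<Sum>l<Suc n. if k = Suc l then of_real t * (f l * cnj (g k)) else 0)"
    unfolding twist_def sesq_def shift3_def fst_conv snd_conv sum_distrib_left sum_subtractf[symmetric]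
    by (intro sum.cong refl) (auto simp: algebra_simps)
  also have "\<dots> = (\<Sum>k<n. of_real t * (f k * cnj (g (Suc k))))"
    by (subst sum.swap) (rule sum_superdiagonal)
  finally show ?thesis by (simp add: sum_distrib_left)
qed

lemma sesq_one: "sesq s (1\<^sub>m s) f g = (\<Sum>i<s. f i * cnj (g i))"
proof -
  have "sesq s (1\<^sub>m s) f g = (\<Sum>i<s. \<Sum>j<s. if j = i then f i * cnj (g i) else 0)"
    unfolding sesq_def by (intro sum.cong refl) auto
  then show ?thesis by simp
qed

section \<open>The circular cone and the largest system over it\<close>

definition lorentz_cone :: "(real \<times> real \<times> real) set" where
  "lorentz_cone = {(a0, a1, a2). 0 \<le> a0 \<and> a1\<^sup>2 + a2\<^sup>2 \<le> a0\<^sup>2}"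

text \<open>The sign of the imaginary part is chosen so that \<open>planar\<close> of a compressed triple is the value of
  \<open>twist\<close>.\<close>
definition planar :: "real \<times> real \<times> real \<Rightarrow> complex" where
  "planar a = Complex (fst (snd a)) (- snd (snd a))"

lemma planar_eq: "planar (a0, a1, a2) = of_real a1 - \<i> * of_real a2"
  by (simp add: planar_def complex_eq_iff)

lemma planar_diff_scale: "planar (a - e *\<^sub>R b) = planar a - of_real e * planar b"
  by (simp add: planar_def complex_eq_iff)

lemma lorentz_cone_iff: "a \<in> lorentz_cone \<longleftrightarrow> cmod (planar a) \<le> fst a"
proof -
  obtain a0 a1 a2 where a: "a = (a0, a1, a2)" by (cases a)
  have "a1\<^sup>2 + a2\<^sup>2 \<le> a0\<^sup>2 \<longleftrightarrow> sqrt (a1\<^sup>2 + a2\<^sup>2) \<le> a0" if "0 \<le> a0"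
    using that real_sqrt_le_iff[of "a1\<^sup>2 + a2\<^sup>2" "a0\<^sup>2"] by simp
  moreover have "0 \<le> a0" if "sqrt (a1\<^sup>2 + a2\<^sup>2) \<le> a0"
    using that real_sqrt_ge_zero[of "a1\<^sup>2 + a2\<^sup>2"] by (meson order_trans sum_power2_ge_zero)
  ultimately show ?thesis by (auto simp: a lorentz_cone_def planar_def cmod_def)
qed

lemma unit_aligned: "\<exists>z. cmod z = 1 \<and> z * w = of_real (cmod w)"
proof (cases "w = 0")
  case True
  then show ?thesis by (intro exI[of _ 1]) simp
next
  case False
  then show ?thesis
    by (intro exI[of _ "cnj w / of_real (cmod w)"])
       (simp add: norm_divide field_simps complex_norm_square[symmetric] power2_eq_square flip: of_real_mult)
qed

lemma unit_opposed: "\<exists>z. cmod z = 1 \<and> Re (z * w) = - cmod w"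
proof -
  obtain z where "cmod z = 1" "z * w = of_real (cmod w)" using unit_aligned by blast
  then show ?thesis by (intro exI[of _ "- z"]) simp
qed

lemma lorentz_cone_dual:
  "a \<in> lorentz_cone \<longleftrightarrow> (\<forall>z. cmod z = 1 \<longrightarrow> 0 \<le> fst a + Re (z * planar a))"
proof
  assume "a \<in> lorentz_cone"
  then have 1: "cmod (planar a) \<le> fst a" by (simp add: lorentz_cone_iff)
  show "\<forall>z. cmod z = 1 \<longrightarrow> 0 \<le> fst a + Re (z * planar a)"
  proof (intro allI impI)
    fix z :: complex assume "cmod z = 1"
    then have "\<bar>Re (z * planar a)\<bar> \<le> cmod (planar a)" using abs_Re_le_cmod[of "z * planar a"] by (simp add: norm_mult)
    then show "0 \<le> fst a + Re (z * planar a)" using 1 by linarith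
  qed
next
  assume *: "\<forall>z. cmod z = 1 \<longrightarrow> 0 \<le> fst a + Re (z * planar a)"
  obtain z where "cmod z = 1" "Re (z * planar a) = - cmod (planar a)" using unit_opposed by blast
  then show "a \<in> lorentz_cone" using * by (fastforce simp: lorentz_cone_iff)
qed

lemma planar_quad3:
  assumes "A \<in> Her3 s"
  shows "planar (quad3 s A f) = twist s A f f"
proof -
  obtain A0 A1 A2 where A: "A = (A0, A1, A2)" "A1 \<in> Her s" "A2 \<in> Her s"
    using assms by (cases A) (auto simp: Her3_def)
  show ?thesis
    using sesq_Her_real[OF A(2), of f] sesq_Her_real[OF A(3), of f]
    by (simp add: A(1) quad3_def planar_eq twist_def)
qed

lemma quad3_in_lorentz_cone:
  assumes "A \<in> Her3 s"
  shows "quad3 s A f \<in> lorentz_cone \<longleftrightarrow> cmod (twist s A f f) \<le> Re (sesq s (fst A) f f)"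
  using planar_quad3[OF assms, of f] by (simp add: lorentz_cone_iff) (simp add: quad3_def)

lemma largest_sys_quad3: "A \<in> largest_sys D s \<longleftrightarrow> A \<in> Her3 s \<and> (\<forall>f. quad3 s A f \<in> D)"
proof -
  have "(\<forall>v \<in> carrier_vec s. (Re ((A0 *\<^sub>v v) \<bullet>c v), Re ((A1 *\<^sub>v v) \<bullet>c v), Re ((A2 *\<^sub>v v) \<bullet>c v)) \<in> D)
      \<longleftrightarrow> (\<forall>f. quad3 s (A0, A1, A2) f \<in> D)" (is "?l \<longleftrightarrow> ?r") if "(A0, A1, A2) \<in> Her3 s" for A0 A1 A2
  proof -
    have C: "A0 \<in> carrier_mat s s" "A1 \<in> carrier_mat s s" "A2 \<in> carrier_mat s s"
      using that by (auto simp: Her3_def)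
    have "?r" if ?l
    proof
      fix f
      show "quad3 s (A0, A1, A2) f \<in> D"
        using bspec[OF that, of "vec s f"] C by (simp add: quad3_def sesq_conv_sprod)
    qed
    moreover have "?l" if ?r
    proof
      fix v :: "complex vec" assume v: "v \<in> carrier_vec s"
      show "(Re ((A0 *\<^sub>v v) \<bullet>c v), Re ((A1 *\<^sub>v v) \<bullet>c v), Re ((A2 *\<^sub>v v) \<bullet>c v)) \<in> D"
        using that[rule_format, of "($) v"]
        by (simp add: quad3_def sprod_conv_sesq[OF C(1) v v] sprod_conv_sesq[OF C(2) v v] sprod_conv_sesq[OF C(3) v v])
    qed
    ultimately show ?thesis by blast
  qed
  then show ?thesis by (cases A) (auto simp: largest_sys_def)
qed

lemma largest_sys_iff:
  "A \<in> largest_sys lorentz_cone s \<longleftrightarrow>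
    A \<in> Her3 s \<and> (\<forall>f. cmod (twist s A f f) \<le> Re (sesq s (fst A) f f))"
  using largest_sys_quad3 quad3_in_lorentz_cone by blast

lemma pencil_point3:
  "Re (pencil s 1 A (point3 c) w) = fst c * fst (quad3 s A (w 0)) + fst (snd c) * fst (snd (quad3 s A (w 0))) +
    snd (snd c) * snd (snd (quad3 s A (w 0)))"
  by (cases A; cases c) (simp add: point3_def quad3_def)

text \<open>The circular cone is the intersection of its supporting half-spaces, and a half-space condition on
  all compressions is a spectrahedron with \<open>r = 1\<close>.\<close>
lemma largest_sys_eq_Inter:
  "largest_sys lorentz_cone s =
    (\<Inter>C \<in> {spectrahedron 1 (point3 (1, Re z, Im z)) | z. cmod z = 1}. C s)" (is "_ = ?R")
proof -
  have mem: "A \<in> largest_sys lorentz_cone s \<longleftrightarrow> (\<forall>z. cmod z = 1 \<longrightarrow> A \<in> spectrahedron 1 (point3 (1, Re z, Im z)) s)" for A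
  proof -
    have "(\<forall>f. quad3 s A f \<in> lorentz_cone) \<longleftrightarrow> (\<forall>z. cmod z = 1 \<longrightarrow> (\<forall>w. 0 \<le> Re (pencil s 1 A (point3 (1, Re z, Im z)) w)))"
      (is "?L \<longleftrightarrow> ?Q")
    proof
      assume ?L
      then show ?Q unfolding pencil_point3 lorentz_cone_dual planar_def by (force simp: algebra_simps)
    next
      assume q: ?Q
      show ?L
      proof
        fix f
        show "quad3 s A f \<in> lorentz_cone" unfolding lorentz_cone_dual
        proof (intro allI impI)
          fix z :: complex assume "cmod z = 1"
          then have "0 \<le> Re (pencil s 1 A (point3 (1, Re z, Im z)) (\<lambda>_. f))" using q by blast
          then show "0 \<le> fst (quad3 s A f) + Re (z * planar (quad3 s A f))"
            unfolding pencil_point3 planar_def by simp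
        qed
      qed
    qed
    moreover have "\<exists>z. cmod z = 1" by (rule exI[of _ 1]) simp
    ultimately show ?thesis
      unfolding largest_sys_quad3 spectrahedron_iff[OF point3_Her3] by blast
  qed
  show ?thesis unfolding set_eq_iff INT_iff mem by blast
qed

lemma cone_system_largest_sys: "cone_system (largest_sys lorentz_cone)"
proof -
  have "cone_system (\<lambda>s. \<Inter>C \<in> {spectrahedron 1 (point3 (1, Re z, Im z)) | z. cmod z = 1}. C s)"
    using cone_system_spectrahedron[OF point3_Her3] norm_one by (intro cone_system_Inter) blast+
  then show ?thesis by (simp only: largest_sys_eq_Inter[symmetric])
qed

lemma sesq_point3: "sesq 1 (fst (point3 a)) f g = of_real (fst a) * (f 0 * cnj (g 0))"
  by (simp add: sesq_def point3_def)

lemma twist_point3: "twist 1 (point3 a) f g = planar a * (f 0 * cnj (g 0))"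
  by (cases a) (simp add: twist_def sesq_def point3_def planar_eq algebra_simps)

lemma level_one_largest_sys: "level_one (largest_sys lorentz_cone) = lorentz_cone"
proof -
  have "(\<forall>f. cmod (twist 1 (point3 a) f f) \<le> Re (sesq 1 (fst (point3 a)) f f)) \<longleftrightarrow> cmod (planar a) \<le> fst a"
    (is "?L \<longleftrightarrow> ?R") for a
  proof
    assume ?L
    from this[rule_format, of "\<lambda>_. 1"] show ?R unfolding sesq_point3 twist_point3 by simp
  next
    assume r: ?R
    show ?L
    proof
      fix f :: "nat \<Rightarrow> complex"
      have "f 0 * cnj (f 0) = of_real ((cmod (f 0))\<^sup>2)" by (rule complex_norm_square[symmetric])
      then have "Re (sesq 1 (fst (point3 a)) f f) = fst a * (cmod (f 0))\<^sup>2"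
         "cmod (twist 1 (point3 a) f f) = cmod (planar a) * (cmod (f 0))\<^sup>2"
        unfolding sesq_point3 twist_point3 by (simp_all add: norm_mult norm_power)
      then show "cmod (twist 1 (point3 a) f f) \<le> Re (sesq 1 (fst (point3 a)) f f)"
        using r by (simp add: mult_right_mono)
    qed
  qed
  then show ?thesis
    by (auto simp: level_one_iff largest_sys_iff point3_Her3 lorentz_cone_iff simp del: One_nat_def)
qed

text \<open>The unscaled shift is a compression of a cyclic shift, which is diagonal in the Fourier basis, and on each
  diagonal entry positivity is the condition defining the largest system.  In coordinates: evaluate
  that condition at \<open>\<Sum>\<zeta>\<^sup>k w\<^sub>k\<close> for all \<open>(n + 2)\<close>-th roots of unity \<open>\<zeta>\<close> and average.  Roots of order \<open>n + 2\<close>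
  suffice because the exponents that occur, after a shift by one, lie between 0 and \<open>n + 1\<close>.\<close>
lemma largest_sys_Toeplitz_positive:
  assumes A: "A \<in> largest_sys lorentz_cone s"
  shows "0 \<le> Re (\<Sum>k<Suc n. sesq s (fst A) (w k) (w k)) + Re (\<Sum>k<n. twist s A (w (Suc k)) (w k))"
proof -
  define L where "L = n + 2"
  define \<zeta> where "\<zeta> l = cis (2 * pi * real l / real L)" for l
  define f where "f l i = (\<Sum>k<Suc n. \<zeta> l ^ k * w k i)" for l i
  have tw_sum_left: "twist s A (\<lambda>i. \<Sum>k\<in>K. u k i) g = (\<Sum>k\<in>K. twist s A (u k) g)" for u g and K :: "nat set"
    by (simp add: twist_def sesq_sum_left sum_subtractf sum_distrib_left)
  have tw_sum_right: "twist s A g (\<lambda>i. \<Sum>k\<in>K. u k i) = (\<Sum>k\<in>K. twist s A g (u k))" for u g and K :: "nat set"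
    by (simp add: twist_def sesq_sum_right sum_subtractf sum_distrib_left)
  have tw_scale: "twist s A (\<lambda>i. a * u i) (\<lambda>i. b * v i) = a * cnj b * twist s A u v" for a b u v
    by (simp add: twist_def sesq_scale_left sesq_scale_right algebra_simps)
  have sf: "sesq s (fst A) (f l) (f l) = (\<Sum>k<Suc n. \<Sum>k'<Suc n. \<zeta> l ^ k * cnj (\<zeta> l ^ k') * sesq s (fst A) (w k) (w k'))" for l
    unfolding f_def sesq_sum_left sesq_sum_right sesq_scale_left sesq_scale_right sum_distrib_left
    by (simp only: mult.assoc)
  have tf: "cnj (\<zeta> l) * twist s A (f l) (f l) =
      (\<Sum>k<Suc n. \<Sum>k'<Suc n. \<zeta> l ^ k * cnj (\<zeta> l ^ Suc k') * twist s A (w k) (w k'))" for l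
    unfolding f_def tw_sum_left tw_sum_right sum_distrib_left tw_scale
    by (intro sum.cong refl) (simp add: ac_simps)
  have orth: "(\<Sum>l<L. \<zeta> l ^ k * cnj (\<zeta> l ^ k')) = (if k = k' then of_nat L else 0)" if "k < L" "k' < L" for k k'
    using roots_of_unity_orthogonal[OF that] by (simp add: \<zeta>_def)
  have S: "(\<Sum>l<L. sesq s (fst A) (f l) (f l)) = of_nat L * (\<Sum>k<Suc n. sesq s (fst A) (w k) (w k))"
  proof -
    have "(\<Sum>l<L. sesq s (fst A) (f l) (f l)) =
        (\<Sum>k<Suc n. \<Sum>k'<Suc n. \<Sum>l<L. \<zeta> l ^ k * cnj (\<zeta> l ^ k') * sesq s (fst A) (w k) (w k'))"
      unfolding sf by (subst sum.swap, rule sum.cong[OF refl], rule sum.swap)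
    also have "\<dots> = (\<Sum>k<Suc n. \<Sum>k'<Suc n. if k' = k then of_nat L * sesq s (fst A) (w k) (w k) else 0)"
      unfolding sum_distrib_right[symmetric]
      by (intro sum.cong refl, subst orth) (auto simp: L_def)
    also have "\<dots> = (\<Sum>k<Suc n. of_nat L * sesq s (fst A) (w k) (w k))"
      by (intro sum.cong refl) (simp del: sum.lessThan_Suc)
    finally show ?thesis by (simp only: sum_distrib_left)
  qed
  have T: "(\<Sum>l<L. cnj (\<zeta> l) * twist s A (f l) (f l)) = of_nat L * (\<Sum>k<n. twist s A (w (Suc k)) (w k))"
  proof -
    have "(\<Sum>l<L. cnj (\<zeta> l) * twist s A (f l) (f l)) =
        (\<Sum>k<Suc n. \<Sum>k'<Suc n. \<Sum>l<L. \<zeta> l ^ k * cnj (\<zeta> l ^ Suc k') * twist s A (w k) (w k'))"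
      unfolding tf by (subst sum.swap, rule sum.cong[OF refl], rule sum.swap)
    also have "\<dots> = (\<Sum>k<Suc n. \<Sum>k'<Suc n. if k = Suc k' then of_nat L * twist s A (w k) (w k') else 0)"
      unfolding sum_distrib_right[symmetric]
      by (intro sum.cong refl, subst orth) (auto simp: L_def)
    also have "\<dots> = (\<Sum>k<n. of_nat L * twist s A (w (Suc k)) (w k))"
      by (subst sum.swap) (rule sum_superdiagonal)
    finally show ?thesis by (simp only: sum_distrib_left)
  qed
  have "0 \<le> Re (sesq s (fst A) (f l) (f l)) + Re (cnj (\<zeta> l) * twist s A (f l) (f l))" for l
  proof -
    have "\<bar>Re (cnj (\<zeta> l) * twist s A (f l) (f l))\<bar> \<le> cmod (twist s A (f l) (f l))"
      using abs_Re_le_cmod[of "cnj (\<zeta> l) * twist s A (f l) (f l)"] by (simp add: norm_mult \<zeta>_def)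
    moreover have "cmod (twist s A (f l) (f l)) \<le> Re (sesq s (fst A) (f l) (f l))"
      using A by (simp add: largest_sys_iff)
    ultimately show ?thesis by linarith
  qed
  then have "0 \<le> (\<Sum>l<L. Re (sesq s (fst A) (f l) (f l)) + Re (cnj (\<zeta> l) * twist s A (f l) (f l)))"
    by (intro sum_nonneg) auto
  also have "\<dots> = Re (\<Sum>l<L. sesq s (fst A) (f l) (f l)) + Re (\<Sum>l<L. cnj (\<zeta> l) * twist s A (f l) (f l))"
    by (simp only: Re_sum sum.distrib)
  also have "\<dots> = real L * (Re (\<Sum>k<Suc n. sesq s (fst A) (w k) (w k)) + Re (\<Sum>k<n. twist s A (w (Suc k)) (w k)))"
    unfolding S T by (simp add: distrib_left del: sum.lessThan_Suc)
  finally show ?thesis by (simp add: zero_le_mult_iff L_def del: sum.lessThan_Suc)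
qed

section \<open>Spectrahedra of shifts\<close>

lemma spectrahedron_shift3_iff:
  "A \<in> spectrahedron (Suc n) (shift3 (Suc n) t) s \<longleftrightarrow> A \<in> Her3 s \<and>
    (\<forall>w. 0 \<le> Re (\<Sum>k<Suc n. sesq s (fst A) (w k) (w k)) + t * Re (\<Sum>k<n. twist s A (w (Suc k)) (w k)))"
  unfolding spectrahedron_iff[OF shift3_Her3]
  by (rule conj_cong[OF refl]) (simp only: pencil_shift3)

lemma spectrahedron_2_shift3_iff:
  "A \<in> spectrahedron 2 (shift3 2 t) s \<longleftrightarrow> A \<in> Her3 s \<and>
    (\<forall>f g. 0 \<le> Re (sesq s (fst A) f f) + Re (sesq s (fst A) g g) + t * Re (twist s A g f))"
proof -
  have *: "A \<in> spectrahedron 2 (shift3 2 t) s \<longleftrightarrow> A \<in> Her3 s \<and>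
    (\<forall>w. 0 \<le> Re (sesq s (fst A) (w 0) (w 0)) + Re (sesq s (fst A) (w (1::nat)) (w 1)) + t * Re (twist s A (w 1) (w 0)))"
    using spectrahedron_shift3_iff[of A 1 t s] unfolding numeral_2_eq_2 One_nat_def by simp
  have "(\<forall>w. P (w 0) (w (1::nat))) \<longleftrightarrow> (\<forall>f g. P f g)" for P :: "(nat \<Rightarrow> complex) \<Rightarrow> (nat \<Rightarrow> complex) \<Rightarrow> bool"
  proof safe
    fix f g assume "\<forall>w. P (w 0) (w (1::nat))"
    from this[rule_format, of "\<lambda>k. if k = 0 then f else g"] show "P f g" by simp
  qed blast
  from this[of "\<lambda>f g. 0 \<le> Re (sesq s (fst A) f f) + Re (sesq s (fst A) g g) + t * Re (twist s A g f)"]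
  show ?thesis using * by simp
qed

lemma spectrahedron_swap:
  assumes "A \<in> Her3 s" "M \<in> Her3 r"
  shows "A \<in> spectrahedron r M s \<longleftrightarrow> M \<in> spectrahedron s A r"
proof -
  have "(\<forall>w. 0 \<le> Re (pencil s r A M w)) \<longleftrightarrow> (\<forall>w. 0 \<le> Re (pencil r s M A w))"
    using pencil_swap[of s r A M] pencil_swap[of r s M A] by metis
  then show ?thesis using assms by (simp add: spectrahedron_iff)
qed

text \<open>At level one the pencil is \<open>a\<^sub>0 \<parallel>x\<parallel>\<^sup>2 + t Re (\<alpha> \<langle>S x, x\<rangle>)\<close> with \<open>\<alpha> = planar a\<close> and the shift \<open>S\<close>, so
  everything is determined by the numerical range of \<open>S\<close>.\<close>
lemma level_one_shift3:
  assumes t: "0 \<le> t"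
  shows "level_one (spectrahedron (Suc n) (shift3 (Suc n) t)) = {a. t * shift_radius n * cmod (planar a) \<le> fst a}"
proof -
  have "point3 a \<in> spectrahedron (Suc n) (shift3 (Suc n) t) 1 \<longleftrightarrow> t * shift_radius n * cmod (planar a) \<le> fst a" for a
  proof -
    define S where "S x = (\<Sum>k<Suc n. (cmod (x k))\<^sup>2)" for x :: "nat \<Rightarrow> complex"
    define T where "T x = (\<Sum>k<n. x (Suc k) * cnj (x k))" for x :: "nat \<Rightarrow> complex"
    have q: "Re (\<Sum>k<Suc n. sesq 1 (fst (point3 a)) (w k) (w k)) + t * Re (\<Sum>k<n. twist 1 (point3 a) (w (Suc k)) (w k))
        = fst a * S (\<lambda>k. w k 0) + t * Re (planar a * T (\<lambda>k. w k 0))" for w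
      unfolding S_def T_def sesq_point3 twist_point3 Re_sum sum_distrib_left complex_norm_square[symmetric]
      by simp
    have "(\<forall>w. 0 \<le> fst a * S (\<lambda>k. w k (0::nat)) + t * Re (planar a * T (\<lambda>k. w k 0))) \<longleftrightarrow> t * shift_radius n * cmod (planar a) \<le> fst a"
      (is "?L \<longleftrightarrow> ?R")
    proof
      assume l: ?L
      obtain z where z: "cmod z = 1" "Re (z * planar a) = - cmod (planar a)" using unit_opposed by blast
      define x where "x = (\<lambda>k. of_real (shift_eigvec n (Suc k)) * z ^ k)"
      have x: "T x = z * of_real (shift_radius n * S x)" "0 < S x"
        unfolding x_def S_def T_def by (rule shift_norm_attained[OF z(1)])+
      have "planar a * T x = of_real (shift_radius n * S x) * (z * planar a)" unfolding x(1) by (simp only: ac_simps)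
      then have "Re (planar a * T x) = shift_radius n * S x * Re (z * planar a)"
        by (simp only: Re_complex_of_real Im_complex_of_real times_complex.sel(1)[of "complex_of_real _"] mult_zero_left diff_zero)
      then have Re: "Re (planar a * T x) = - (shift_radius n * S x * cmod (planar a))" unfolding z(2) by simp
      have "0 \<le> fst a * S x + t * Re (planar a * T x)" using l[rule_format, of "\<lambda>k _. x k"] .
      then have "0 \<le> (fst a - t * shift_radius n * cmod (planar a)) * S x" unfolding Re by (simp add: algebra_simps)
      then show ?R using x(2) by (simp add: zero_le_mult_iff)
    next
      assume r: ?R
      show ?L
      proof
        fix w :: "nat \<Rightarrow> nat \<Rightarrow> complex"
        define x where "x = (\<lambda>k. w k 0)"
        have "\<bar>Re (planar a * T x)\<bar> \<le> cmod (planar a) * cmod (T x)" using abs_Re_le_cmod[of "planar a * T x"] by (simp add: norm_mult)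
        also have "\<dots> \<le> cmod (planar a) * (shift_radius n * S x)"
          using shift_norm_bound[where x = x and n = n] unfolding T_def S_def by (intro mult_left_mono) auto
        finally have "t * \<bar>Re (planar a * T x)\<bar> \<le> t * (cmod (planar a) * (shift_radius n * S x))" using t by (rule mult_left_mono)
        moreover have "0 \<le> (fst a - t * shift_radius n * cmod (planar a)) * S x"
          using r unfolding S_def by (intro mult_nonneg_nonneg sum_nonneg) (simp_all del: sum.lessThan_Suc)
        moreover have "- (t * \<bar>Re (planar a * T x)\<bar>) \<le> t * Re (planar a * T x)"
          using t by (metis abs_ge_minus_self abs_minus_cancel minus_le_iff mult_left_mono mult_minus_right)
        ultimately show "0 \<le> fst a * S (\<lambda>k. w k 0) + t * Re (planar a * T (\<lambda>k. w k 0))"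
          unfolding x_def[symmetric] by (simp add: algebra_simps)
      qed
    qed
    then show ?thesis unfolding spectrahedron_shift3_iff q using point3_Her3 by blast
  qed
  then show ?thesis by (auto simp: level_one_iff)
qed

section \<open>The smallest system as a spectrahedron\<close>

lemma psd_rank_one: "psd s (mat s s (\<lambda>(i, j). cnj (v i) * v j))"
proof -
  have H: "mat s s (\<lambda>(i, j). cnj (v i) * v j) \<in> Her s" by (auto simp: Her_iff)
  have "sesq s (mat s s (\<lambda>(i, j). cnj (v i) * v j)) f f = (\<Sum>j<s. v j * f j) * cnj (\<Sum>i<s. v i * f i)" for f
  proof -
    have "sesq s (mat s s (\<lambda>(i, j). cnj (v i) * v j)) f f = (\<Sum>i<s. \<Sum>j<s. (v j * f j) * cnj (v i * f i))"
      unfolding sesq_def by (intro sum.cong refl) simp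
    also have "\<dots> = (\<Sum>j<s. v j * f j) * cnj (\<Sum>i<s. v i * f i)"
      unfolding cnj_sum sum_product by (rule sum.swap)
    finally show ?thesis .
  qed
  then have "sesq s (mat s s (\<lambda>(i, j). cnj (v i) * v j)) f f = of_real ((cmod (\<Sum>j<s. v j * f j))\<^sup>2)" for f
    unfolding complex_norm_square .
  then show ?thesis unfolding psd_iff[OF H] by simp
qed

text \<open>Membership on the left means that the block matrix with diagonal blocks \<open>A\<^sub>0\<close> and corner
  \<open>X = A\<^sub>1 - \<i> A\<^sub>2\<close> is positive semidefinite.  Factor it as the Gram matrix of two families \<open>F\<close> and \<open>G\<close>, so
  that \<open>F\<^sup>*F = A\<^sub>0 = G\<^sup>*G\<close> and \<open>F\<^sup>*G = X\<close>.  Equality of the Gram matrices gives a unitary with \<open>G = U F\<close>,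
  and diagonalizing \<open>U\<close> turns \<open>F\<^sup>*F\<close> and \<open>F\<^sup>*U F\<close> into \<open>\<Sum>P\<^sub>j\<close> and \<open>\<Sum>e\<^sub>j P\<^sub>j\<close> with \<open>\<bar>e\<^sub>j\<bar> = 1\<close>.\<close>
lemma spectrahedron_2_subset_smallest_sys:
  assumes s: "1 \<le> s"
  shows "spectrahedron 2 (shift3 2 2) s \<subseteq> smallest_sys lorentz_cone s"
proof
  fix A assume A: "A \<in> spectrahedron 2 (shift3 2 2) s"
  obtain A0 A1 A2 where eq: "A = (A0, A1, A2)" by (cases A)
  obtain M0 M1 M2 where M: "shift3 2 2 = (M0, M1, M2)" by (cases "shift3 2 2")
  have Mdim: "dim_row M0 = 2" "dim_col M0 = 2" "dim_row M1 = 2" "dim_col M1 = 2" "dim_row M2 = 2" "dim_col M2 = 2"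
    and M0: "M0 $$ (0, 0) = 1" "M0 $$ (1, 1) = 1" "M0 $$ (0, 1) = 0"
    and M1: "M1 $$ (0, 0) = 0" "M1 $$ (1, 1) = 0" "M1 $$ (0, 1) = 1"
    and M2: "M2 $$ (0, 0) = 0" "M2 $$ (1, 1) = 0" "M2 $$ (0, 1) = - \<i>"
    using M by (auto simp: shift3_def)
  have H: "A0 \<in> Her s" "A1 \<in> Her s" "A2 \<in> Her s" and P: "psd (s * 2) (kronecker A0 M0 + kronecker A1 M1 + kronecker A2 M2)"
    using A unfolding eq M by (auto simp: Her3_def)
  then have Adim: "A0 \<in> carrier_mat s s" "A1 \<in> carrier_mat s s" "A2 \<in> carrier_mat s s" by auto
  obtain w where w: "\<And>i j. i < s * 2 \<Longrightarrow> j < s * 2 \<Longrightarrow>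
      (kronecker A0 M0 + kronecker A1 M1 + kronecker A2 M2) $$ (i, j) = (\<Sum>k<s * 2. w k i * cnj (w k j))"
    using psd_rank_one_decomposition[OF P] by blast
  have kron: "(kronecker A0 M0 + kronecker A1 M1 + kronecker A2 M2) $$ (2 * a + p, 2 * b + q) =
      A0 $$ (a, b) * M0 $$ (p, q) + A1 $$ (a, b) * M1 $$ (p, q) + A2 $$ (a, b) * M2 $$ (p, q)"
    if "a < s" "b < s" "p < 2" "q < 2" for a b p q
    using that Adim Mdim by (auto simp: kronecker_def)
  define N where "N = s * 2"
  \<comment> \<open>In the Kronecker product with a \<open>2 \<times> 2\<close> matrix the two blocks are interleaved: the even columns
    of the factor form \<open>F\<close>, the odd ones \<open>G\<close>.\<close>
  define F where "F = mat N s (\<lambda>(k, j). cnj (w k (2 * j)))"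
  define G where "G = mat N s (\<lambda>(k, j). cnj (w k (2 * j + 1)))"
  have FC: "F \<in> carrier_mat N s" and GC: "G \<in> carrier_mat N s" by (auto simp: F_def G_def)
  have FF: "(mat_adjoint F * F) $$ (a, b) = A0 $$ (a, b)" if "a < s" "b < s" for a b
    using that w[of "2 * a" "2 * b"] kron[of a b 0 0] M0 M1 M2 unfolding gram_entry[OF FC that]
    by (simp add: F_def N_def)
  have GG: "(mat_adjoint G * G) $$ (a, b) = A0 $$ (a, b)" if "a < s" "b < s" for a b
    using that w[of "2 * a + 1" "2 * b + 1"] kron[of a b 1 1] M0 M1 M2 unfolding gram_entry[OF GC that]
    by (simp add: G_def N_def)
  have FG: "(mat_adjoint F * G) $$ (a, b) = A1 $$ (a, b) - \<i> * A2 $$ (a, b)" if "a < s" "b < s" for a b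
  proof -
    have "(mat_adjoint F * G) $$ (a, b) = (\<Sum>k<N. w k (2 * a) * cnj (w k (2 * b + 1)))"
      using that FC GC by (subst mult_mat_conv_sum[of _ _ N]) (auto simp: F_def G_def)
    also have "\<dots> = (kronecker A0 M0 + kronecker A1 M1 + kronecker A2 M2) $$ (2 * a + 0, 2 * b + 1)"
      using w[of "2 * a" "2 * b + 1"] that by (simp add: N_def)
    also have "\<dots> = A1 $$ (a, b) - \<i> * A2 $$ (a, b)"
      using that M0 M1 M2 by (subst kron) auto
    finally show ?thesis .
  qed
  have "mat_adjoint F * F = mat_adjoint G * G"
    using FF GG FC GC by (intro eq_matI) (auto simp del: index_mult_mat(1))
  then obtain U where U: "unitary N U" "U * F = G"
    using isometry_extends_to_unitary[OF FC GC] by blast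
  obtain B e where B: "unitary N B" and e: "\<And>j. j < N \<Longrightarrow> cmod (e j) = 1"
    and UB: "U = mat_adjoint B * diagonal N e * B" using unitary_diagonalizable[OF U(1)] by blast
  have BC: "B \<in> carrier_mat N N" using B by (rule unitary_carrier)
  define Z where "Z = B * F"
  have ZC: "Z \<in> carrier_mat N s" using BC FC by (auto simp: Z_def)
  have gZ: "mat_adjoint Z * Z = mat_adjoint F * F" unfolding Z_def by (rule unitary_gram[OF B FC])
  have ZZ: "(\<Sum>j<N. cnj (Z $$ (j, a)) * Z $$ (j, b)) = A0 $$ (a, b)" if "a < s" "b < s" for a b
    unfolding gram_entry[OF ZC that, symmetric] gZ by (rule FF[OF that])
  have "mat_adjoint F * G = mat_adjoint Z * diagonal N e * Z"
  proof -
    note aC = adjoint_carrier[OF FC] adjoint_carrier[OF BC]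
    have "mat_adjoint F * G = mat_adjoint F * (mat_adjoint B * diagonal N e * B * F)"
      unfolding U(2)[symmetric] UB ..
    also have "\<dots> = (mat_adjoint F * mat_adjoint B) * diagonal N e * (B * F)"
      using aC FC BC by (simp add: assoc_mult_mat[of _ N N _ N _ N] assoc_mult_mat[of _ N N _ N _ s]
          assoc_mult_mat[of _ s N _ N _ s] assoc_mult_mat[of _ s N _ N _ N] mult_carrier_mat[of _ N N _ N]
          mult_carrier_mat[of _ N N _ s])
    also have "\<dots> = mat_adjoint Z * diagonal N e * Z" unfolding Z_def adjoint_mult[OF BC FC] ..
    finally show ?thesis .
  qed
  then have ZEZ: "A1 $$ (a, b) - \<i> * A2 $$ (a, b) = (\<Sum>j<N. e j * (cnj (Z $$ (j, a)) * Z $$ (j, b)))"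
    if "a < s" "b < s" for a b
    using FG[OF that] sandwich_diagonal_entry[OF ZC that] by simp
  have ZEZ': "A1 $$ (a, b) + \<i> * A2 $$ (a, b) = (\<Sum>j<N. cnj (e j) * (cnj (Z $$ (j, a)) * Z $$ (j, b)))"
    if "a < s" "b < s" for a b
  proof -
    have "A1 $$ (a, b) + \<i> * A2 $$ (a, b) = cnj (A1 $$ (b, a) - \<i> * A2 $$ (b, a))"
      using HerD[OF H(2) that] HerD[OF H(3) that] by simp
    then show ?thesis unfolding ZEZ[OF that(2,1)] by (simp add: ac_simps)
  qed
  have A1: "A1 $$ (a, b) = (\<Sum>j<N. of_real (Re (e j)) * (cnj (Z $$ (j, a)) * Z $$ (j, b)))" if "a < s" "b < s" for a b
  proof -
    have "2 * A1 $$ (a, b) = (A1 $$ (a, b) - \<i> * A2 $$ (a, b)) + (A1 $$ (a, b) + \<i> * A2 $$ (a, b))" by simp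
    also have "\<dots> = (\<Sum>j<N. (e j + cnj (e j)) * (cnj (Z $$ (j, a)) * Z $$ (j, b)))"
      unfolding ZEZ[OF that] ZEZ'[OF that] by (simp add: sum.distrib distrib_right)
    also have "\<dots> = 2 * (\<Sum>j<N. of_real (Re (e j)) * (cnj (Z $$ (j, a)) * Z $$ (j, b)))"
      unfolding sum_distrib_left complex_add_cnj by (intro sum.cong refl) simp
    finally show ?thesis by simp
  qed
  have A2: "A2 $$ (a, b) = (\<Sum>j<N. of_real (- Im (e j)) * (cnj (Z $$ (j, a)) * Z $$ (j, b)))" if "a < s" "b < s" for a b
  proof -
    have "2 * \<i> * A2 $$ (a, b) = (A1 $$ (a, b) + \<i> * A2 $$ (a, b)) - (A1 $$ (a, b) - \<i> * A2 $$ (a, b))" by simp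
    also have "\<dots> = (\<Sum>j<N. (cnj (e j) - e j) * (cnj (Z $$ (j, a)) * Z $$ (j, b)))"
      unfolding ZEZ[OF that] ZEZ'[OF that] by (simp add: sum_subtractf left_diff_distrib)
    also have "\<dots> = 2 * \<i> * (\<Sum>j<N. of_real (- Im (e j)) * (cnj (Z $$ (j, a)) * Z $$ (j, b)))"
      unfolding sum_distrib_left by (intro sum.cong refl) (simp add: complex_eq_iff)
    finally show ?thesis by simp
  qed
  define Q where "Q j = mat s s (\<lambda>(a, b). cnj (Z $$ (j, a)) * Z $$ (j, b))" for j
  define c where "c j = (1 :: real, Re (e j), - Im (e j))" for j
  have "A = sum3 s N (\<lambda>j. tensor_point (Q j) (c j))"
    unfolding eq sum3_def c_def using Adim ZZ A1 A2 by (auto simp: Q_def intro!: eq_matI)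
  moreover have "1 \<le> N" using s by (simp add: N_def)
  moreover have "c j \<in> lorentz_cone \<and> psd s (Q j)" if "j < N" for j
    using e[OF that] psd_rank_one[of s "\<lambda>a. Z $$ (j, a)"] cmod_power2[of "e j"]
    by (auto simp: lorentz_cone_def c_def Q_def)
  ultimately show "A \<in> smallest_sys lorentz_cone s" unfolding smallest_sys_def by blast
qed

lemma sesq_entry_bound:
  assumes "\<And>i j. i < s \<Longrightarrow> j < s \<Longrightarrow> cmod (X $$ (i, j)) \<le> e" "0 \<le> e"
  shows "cmod (sesq s X f g) \<le> e * real s / 2 * ((\<Sum>i<s. (cmod (f i))\<^sup>2) + (\<Sum>i<s. (cmod (g i))\<^sup>2))"
proof -
  define a b where "a = (\<Sum>i<s. cmod (f i))" and "b = (\<Sum>i<s. cmod (g i))"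
  have "cmod (sesq s X f g) \<le> (\<Sum>i<s. \<Sum>j<s. e * (cmod (g i) * cmod (f j)))"
    unfolding sesq_def
  proof (intro sum_norm_le)
    fix i j assume "i \<in> {..<s}" "j \<in> {..<s}"
    then show "cmod (X $$ (i, j) * f j * cnj (g i)) \<le> e * (cmod (g i) * cmod (f j))"
      using mult_right_mono[OF assms(1)[of i j], of "cmod (g i) * cmod (f j)"] by (simp add: norm_mult ac_simps)
  qed
  also have "\<dots> = e * (b * a)"
    unfolding a_def b_def sum_product by (simp add: sum_distrib_left)
  also have "\<dots> \<le> e * ((a\<^sup>2 + b\<^sup>2) / 2)"
    using assms(2) sum_squares_bound[of a b] by (intro mult_left_mono) (auto simp: ac_simps)
  also have "\<dots> \<le> e * ((real s * (\<Sum>i<s. (cmod (f i))\<^sup>2) + real s * (\<Sum>i<s. (cmod (g i))\<^sup>2)) / 2)"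
    using sum_squared_le_sum_of_squares[of "\<lambda>i. cmod (f i)" "{..<s}"] sum_squared_le_sum_of_squares[of "\<lambda>i. cmod (g i)" "{..<s}"]
    unfolding a_def b_def by (intro mult_left_mono divide_right_mono add_mono assms(2)) (auto simp: mult.commute)
  finally show ?thesis by (simp add: algebra_simps)
qed

text \<open>Perturbing all entries of this triple by at most \<open>e\<close> changes the form by at most \<open>3 e s\<close> times the
  squared norm.\<close>
lemma interior_spectrahedron_2:
  assumes s: "1 \<le> s"
  shows "(1\<^sub>m s, 0\<^sub>m s s, 0\<^sub>m s s) \<in> (top3 s) interior_of (spectrahedron 2 (shift3 2 2) s)"
proof -
  define e where "e = 1 / (3 * real s)"
  have e0: "e > 0" using s by (simp add: e_def)
  have es: "3 * e * real s = 1" using s by (simp add: e_def)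
  let ?I = "(1\<^sub>m s, 0\<^sub>m s s, 0\<^sub>m s s)"
  have I: "?I \<in> Her3 s" by (auto simp: Her3_def Her_iff)
  have "B \<in> spectrahedron 2 (shift3 2 2) s" if B: "B \<in> Her3 s" and d: "dist3 s ?I B < e" for B
  proof -
    obtain B0 B1 B2 where eq: "B = (B0, B1, B2)" by (cases B)
    have BC: "B0 \<in> carrier_mat s s" "B1 \<in> carrier_mat s s" "B2 \<in> carrier_mat s s"
      using B by (auto simp: eq Her3_def)
    have ent: "cmod ((B0 - 1\<^sub>m s) $$ (i, j)) \<le> e" "cmod (B1 $$ (i, j)) \<le> e" "cmod (B2 $$ (i, j)) \<le> e" if "i < s" "j < s" for i j
    proof -
      have d': "dist (entry3 ?I (i, j)) (entry3 B (i, j)) \<le> e" using dist_entry3_le[OF that, of ?I B] d by linarith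
      have "cmod ((B0 - 1\<^sub>m s) $$ (i, j)) = dist (1\<^sub>m s $$ (i, j)) (B0 $$ (i, j))"
        using that BC by (simp add: dist_norm norm_minus_commute)
      also have "\<dots> \<le> e" using dist_fst_le[of "entry3 ?I (i, j)" "entry3 B (i, j)"] d' by (simp add: eq del: index_one_mat)
      finally show "cmod ((B0 - 1\<^sub>m s) $$ (i, j)) \<le> e" .
      have "cmod (B1 $$ (i, j)) = dist (0\<^sub>m s s $$ (i, j)) (B1 $$ (i, j))" using that by simp
      also have "\<dots> \<le> e" using dist_fst_le[of "snd (entry3 ?I (i, j))" "snd (entry3 B (i, j))"]
          dist_snd_le[of "entry3 ?I (i, j)" "entry3 B (i, j)"] d' by (simp add: eq del: index_zero_mat)
      finally show "cmod (B1 $$ (i, j)) \<le> e" .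
      have "cmod (B2 $$ (i, j)) = dist (0\<^sub>m s s $$ (i, j)) (B2 $$ (i, j))" using that by simp
      also have "\<dots> \<le> e" using dist_snd_le[of "snd (entry3 ?I (i, j))" "snd (entry3 B (i, j))"]
          dist_snd_le[of "entry3 ?I (i, j)" "entry3 B (i, j)"] d' by (simp add: eq del: index_zero_mat)
      finally show "cmod (B2 $$ (i, j)) \<le> e" .
    qed
    have "0 \<le> Re (sesq s B0 f f) + Re (sesq s B0 g g) + 2 * Re (twist s B g f)" for f g
    proof -
      define n where "n h = (\<Sum>i<s. (cmod (h i))\<^sup>2)" for h :: "nat \<Rightarrow> complex"
      have n0: "0 \<le> n h" for h unfolding n_def by (intro sum_nonneg) simp
      have q: "n h * (1 - e * real s) \<le> Re (sesq s B0 h h)" for h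
      proof -
        have D: "B0 - 1\<^sub>m s \<in> carrier_mat s s" by (rule minus_carrier_mat) simp
        have e: "1\<^sub>m s + (B0 - 1\<^sub>m s) = B0" using BC by (intro eq_matI) auto
        have "sesq s B0 h h = sesq s (1\<^sub>m s) h h + sesq s (B0 - 1\<^sub>m s) h h"
          using sesq_add[OF one_carrier_mat D, of h h] unfolding e .
        moreover have "sesq s (1\<^sub>m s) h h = of_real (n h)"
          unfolding sesq_one n_def of_real_sum complex_norm_square ..
        moreover have "cmod (sesq s (B0 - 1\<^sub>m s) h h) \<le> e * real s / 2 * (n h + n h)"
          unfolding n_def by (rule sesq_entry_bound) (use ent e0 in auto)
        moreover have "- cmod (sesq s (B0 - 1\<^sub>m s) h h) \<le> Re (sesq s (B0 - 1\<^sub>m s) h h)"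
          using abs_Re_le_cmod[of "sesq s (B0 - 1\<^sub>m s) h h"] by linarith
        ultimately show ?thesis by (simp add: algebra_simps)
      qed
      have "cmod (twist s B g f) \<le> cmod (sesq s B1 g f) + cmod (sesq s B2 g f)"
        unfolding twist_def eq using norm_triangle_ineq4[of "sesq s B1 g f" "\<i> * sesq s B2 g f"] by (simp add: norm_mult)
      also have "\<dots> \<le> e * real s / 2 * (n g + n f) + e * real s / 2 * (n g + n f)"
        unfolding n_def by (intro add_mono sesq_entry_bound) (use ent e0 in auto)
      finally have "cmod (twist s B g f) \<le> e * real s * (n g + n f)" by (simp add: algebra_simps)
      moreover have "- cmod (twist s B g f) \<le> Re (twist s B g f)" using abs_Re_le_cmod[of "twist s B g f"] by linarith
      moreover note q[of f] q[of g]
      moreover have "3 * e * real s * (n f + n g) = n f + n g" unfolding es by simp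
      ultimately show ?thesis by (simp add: algebra_simps)
    qed
    then show ?thesis using B by (simp add: spectrahedron_2_shift3_iff eq)
  qed
  then show ?thesis
    using I e0 cone_system_spectrahedron[OF shift3_Her3[of 2 2]] s
    by (subst interior_top3_iff) (auto simp: cone_system_def)
qed

text \<open>Interior points come for free at all levels, since the system contains the smallest system over
  the circular cone; the second bound confines level one to a cone without lines.\<close>
lemma op_system_over_lorentz_cone:
  assumes C: "cone_system C" and L: "lorentz_cone \<subseteq> level_one C"
    and k: "0 < k" "\<And>a. a \<in> level_one C \<Longrightarrow> k * cmod (planar a) \<le> fst a"
  shows "op_system C"
proof (rule op_systemI[OF C])
  fix s :: nat assume s: "1 \<le> s"
  have "spectrahedron 2 (shift3 2 2) s \<subseteq> C s"
    using spectrahedron_2_subset_smallest_sys[OF s] smallest_sys_subset[OF C s L] by blast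
  then show "(top3 s) interior_of (C s) \<noteq> {}"
    using interior_spectrahedron_2[OF s] interior_of_mono by blast
next
  fix a b assume ab: "\<And>t. a + t *\<^sub>R b \<in> level_one C"
  have b: "k * cmod (planar a + of_real t * planar b) \<le> fst a + t * fst b" for t
    using k(2)[OF ab[of t]] planar_diff_scale[of a "- t" b] by simp
  have nn: "0 \<le> fst a + t * fst b" for t using b[of t] k(1) by (meson norm_ge_zero mult_nonneg_nonneg less_imp_le order_trans)
  have b0: "fst b = 0"
  proof (rule ccontr)
    assume "fst b \<noteq> 0"
    then show False using nn[of "- (fst a + 1) / fst b"] by simp
  qed
  have "planar b = 0"
  proof (rule ccontr)
    assume nz: "planar b \<noteq> 0"
    define t where "t = (fst a / k + cmod (planar a) + 1) / cmod (planar b)"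
    have t0: "0 \<le> t" unfolding t_def using nn[of 0] k(1) by simp
    have "cmod (of_real t * planar b) \<le> cmod (planar a + of_real t * planar b) + cmod (planar a)"
      using norm_triangle_ineq4[of "planar a + of_real t * planar b" "planar a"] by simp
    moreover have "cmod (planar a + of_real t * planar b) \<le> fst a / k"
      using b[of t] b0 k(1) by (simp add: field_simps)
    moreover have "cmod (of_real t * planar b) = fst a / k + cmod (planar a) + 1"
      using nz t0 by (simp add: norm_mult) (simp add: t_def)
    ultimately show False by simp
  qed
  then show "b = 0" using b0 by (cases b) (simp add: planar_def zero_prod_def complex_eq_iff)
qed

lemma largest_sys_op_system: "op_system (largest_sys lorentz_cone)"
  by (rule op_system_over_lorentz_cone[where k = 1])
    (auto simp: cone_system_largest_sys level_one_largest_sys lorentz_cone_iff)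

section \<open>Free spectrahedra of scaled shifts\<close>

definition shift_gen :: "nat \<Rightarrow> mat3" where
  "shift_gen n = shift3 (Suc n) (1 / shift_radius n)"

lemma shift_gen_Her3: "shift_gen n \<in> Her3 (Suc n)"
  by (simp add: shift_gen_def shift3_Her3)

lemma level_one_shift_gen:
  "1 \<le> n \<Longrightarrow> level_one (spectrahedron (Suc n) (shift_gen n)) = lorentz_cone"
  unfolding shift_gen_def using shift_radius_pos[of n]
  by (subst level_one_shift3) (auto simp: lorentz_cone_iff)

lemma in_interior_lorentz_cone: "(1, 0, 0) \<in> interior lorentz_cone"
proof -
  let ?U = "{a :: real \<times> real \<times> real. 0 < fst a} \<inter> {a. (fst (snd a))\<^sup>2 + (snd (snd a))\<^sup>2 < (fst a)\<^sup>2}"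
  have "open ?U" by (intro open_Int open_Collect_less continuous_intros)
  moreover have "?U \<subseteq> lorentz_cone" by (auto simp: lorentz_cone_def)
  ultimately show ?thesis by (intro interiorI[of ?U]) auto
qed

lemma free_spectrahedron_shift_gen:
  assumes n: "1 \<le> n"
  shows "free_spectrahedron (spectrahedron (Suc n) (shift_gen n))"
proof -
  note L = level_one_shift_gen[OF n]
  have "op_system (spectrahedron (Suc n) (shift_gen n))"
    by (rule op_system_over_lorentz_cone[where k = 1])
      (auto simp: L lorentz_cone_iff intro!: cone_system_spectrahedron shift_gen_Her3)
  moreover obtain M0 M1 M2 where M: "shift_gen n = (M0, M1, M2)" by (cases "shift_gen n")
  moreover have "M0 = 1\<^sub>m (Suc n)" "M1 \<in> carrier_mat (Suc n) (Suc n)" "M2 \<in> carrier_mat (Suc n) (Suc n)"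
    using M by (auto simp: shift_gen_def shift3_def)
  then have "complex_of_real 1 \<cdot>\<^sub>m M0 + complex_of_real 0 \<cdot>\<^sub>m M1 + complex_of_real 0 \<cdot>\<^sub>m M2 = 1\<^sub>m (Suc n)"
    by (intro eq_matI) auto
  ultimately show ?thesis
    unfolding free_spectrahedron_def L
    using in_interior_lorentz_cone shift_gen_Her3[of n]
    by (intro conjI exI[of _ "Suc n"] exI[of _ M0] exI[of _ M1] exI[of _ M2] bexI[of _ "(1, 0, 0)"]) auto
qed

text \<open>Multiplying \<open>A\<^sub>0\<close> by \<open>c\<^sub>n\<close> moves an interior point only slightly when \<open>n\<close> is large, so the result is still
  in the largest system and satisfies the condition of the unscaled shift.  Dividing by \<open>c\<^sub>n\<close> gives
  the condition of the scaled shift for \<open>A\<close> itself.\<close>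
lemma interior_largest_sys_subset:
  assumes A: "A \<in> (top3 s) interior_of (largest_sys lorentz_cone s)"
  obtains n where "1 \<le> n" "A \<in> spectrahedron (Suc n) (shift_gen n) s"
proof -
  have "largest_sys lorentz_cone s \<subseteq> Her3 s" by (auto simp: largest_sys_iff)
  then obtain e where AH: "A \<in> Her3 s" and e: "e > 0"
    and ball: "\<And>B. B \<in> Her3 s \<Longrightarrow> dist3 s A B < e \<Longrightarrow> B \<in> largest_sys lorentz_cone s"
    using A by (auto simp: interior_top3_iff)
  obtain A0 A1 A2 where eq: "A = (A0, A1, A2)" by (cases A)
  have H: "A0 \<in> Her s" using AH by (simp add: eq Her3_def)
  define N where "N = L2_set (\<lambda>ij. cmod (A0 $$ ij)) ({..<s} \<times> {..<s})"
  define B where "B c = (complex_of_real c \<cdot>\<^sub>m A0, A1, A2)" for c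
  have dist: "dist3 s A (B c) = \<bar>1 - c\<bar> * N" for c
  proof -
    have "dist3 s A (B c) = L2_set (\<lambda>ij. \<bar>1 - c\<bar> * cmod (A0 $$ ij)) ({..<s} \<times> {..<s})"
      unfolding dist3_def
    proof (rule L2_set_cong[OF refl])
      fix ij assume "ij \<in> {..<s} \<times> {..<s}"
      then have "(complex_of_real c \<cdot>\<^sub>m A0) $$ ij = of_real c * A0 $$ ij"
        using H by (cases ij) auto
      then have "dist (entry3 A ij) (entry3 (B c) ij) = cmod (A0 $$ ij - of_real c * A0 $$ ij)"
        by (cases ij) (simp add: eq B_def dist_prod_def dist_norm)
      also have "A0 $$ ij - of_real c * A0 $$ ij = of_real (1 - c) * A0 $$ ij" by (simp add: algebra_simps)
      finally show "dist (entry3 A ij) (entry3 (B c) ij) = \<bar>1 - c\<bar> * cmod (A0 $$ ij)" by (simp only: norm_mult norm_of_real)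
    qed
    then show ?thesis by (simp add: N_def L2_set_right_distrib)
  qed
  have "(\<lambda>n. \<bar>1 - shift_radius n\<bar> * N) \<longlonglongrightarrow> \<bar>1 - 1\<bar> * N"
    by (intro tendsto_intros shift_radius_tendsto)
  then have "\<forall>\<^sub>F n in sequentially. \<bar>1 - shift_radius n\<bar> * N < e" using e by (intro order_tendstoD) auto
  then obtain n0 where "\<forall>n\<ge>n0. \<bar>1 - shift_radius n\<bar> * N < e" unfolding eventually_sequentially by blast
  then have small: "\<bar>1 - shift_radius (Suc n0)\<bar> * N < e" by simp
  define n where "n = Suc n0"
  define c where "c = shift_radius n"
  have c: "0 < c" using shift_radius_pos[of n] by (simp add: c_def n_def)
  have "B c \<in> largest_sys lorentz_cone s"
  proof (rule ball)
    show "B c \<in> Her3 s" using AH by (auto simp: eq B_def Her3_def Her_smult)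
    show "dist3 s A (B c) < e" using small by (simp add: dist c_def n_def)
  qed
  note * = largest_sys_Toeplitz_positive[OF this]
  have "0 \<le> Re (\<Sum>k<Suc n. sesq s A0 (w k) (w k)) + 1 / c * Re (\<Sum>k<n. twist s A (w (Suc k)) (w k))" for w
  proof -
    have "twist s (B c) = twist s A" by (intro ext) (simp add: twist_def eq B_def)
    moreover have "sesq s (fst (B c)) f g = of_real c * sesq s A0 f g" for f g
      using H by (simp add: B_def sesq_smult)
    ultimately have "0 \<le> Re (\<Sum>k<Suc n. of_real c * sesq s A0 (w k) (w k)) + Re (\<Sum>k<n. twist s A (w (Suc k)) (w k))"
      using *[where n = n and w = w] by simp
    also have "(\<Sum>k<Suc n. of_real c * sesq s A0 (w k) (w k)) = of_real c * (\<Sum>k<Suc n. sesq s A0 (w k) (w k))"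
      by (simp only: sum_distrib_left)
    finally have "0 \<le> 1 / c * (c * Re (\<Sum>k<Suc n. sesq s A0 (w k) (w k)) + Re (\<Sum>k<n. twist s A (w (Suc k)) (w k)))"
      using c by (intro mult_nonneg_nonneg) (simp_all del: sum.lessThan_Suc)
    then show ?thesis using c by (simp add: field_simps del: sum.lessThan_Suc)
  qed
  then have "A \<in> spectrahedron (Suc n) (shift_gen n) s"
    using AH unfolding shift_gen_def spectrahedron_shift3_iff by (simp add: eq c_def del: sum.lessThan_Suc)
  then show ?thesis using that[of n] by (simp add: n_def)
qed

section \<open>Free numerical ranges of scaled shifts\<close>

lemma shift_gen_forms:
  "sesq (Suc n) (fst (shift_gen n)) f f = of_real (\<Sum>k<Suc n. (cmod (f k))\<^sup>2)"
  "twist (Suc n) (shift_gen n) f g = of_real (1 / shift_radius n) * (\<Sum>k<n. f k * cnj (g (Suc k)))"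
proof -
  show "sesq (Suc n) (fst (shift_gen n)) f f = of_real (\<Sum>k<Suc n. (cmod (f k))\<^sup>2)"
    unfolding shift_gen_def shift3_def fst_conv sesq_one of_real_sum complex_norm_square ..
  show "twist (Suc n) (shift_gen n) f g = of_real (1 / shift_radius n) * (\<Sum>k<n. f k * cnj (g (Suc k)))"
    unfolding shift_gen_def by (rule twist_shift3)
qed

lemma shift_gen_in_largest_sys:
  assumes n: "1 \<le> n"
  shows "shift_gen n \<in> largest_sys lorentz_cone (Suc n)"
  unfolding largest_sys_iff
proof (intro conjI allI shift_gen_Her3)
  fix f
  have "(\<Sum>k<n. f k * cnj (f (Suc k))) = cnj (\<Sum>k<n. f (Suc k) * cnj (f k))" by (simp add: mult.commute)
  then have "cmod (\<Sum>k<n. f k * cnj (f (Suc k))) \<le> shift_radius n * (\<Sum>k<Suc n. (cmod (f k))\<^sup>2)"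
    using shift_norm_bound[where x = f and n = n] by (simp only: complex_mod_cnj)
  then show "cmod (twist (Suc n) (shift_gen n) f f) \<le> Re (sesq (Suc n) (fst (shift_gen n)) f f)"
    unfolding shift_gen_forms norm_mult using shift_radius_pos[OF n] by (simp add: norm_divide field_simps del: sum.lessThan_Suc)
qed

text \<open>Scaling back by \<open>c\<^sub>n\<close> turns the scaled shift into the shift, which is a contraction.\<close>
lemma shift_gen_in_spectrahedron_2:
  assumes n: "1 \<le> n"
  shows "shift_gen n \<in> spectrahedron 2 (shift3 2 (2 * shift_radius n)) (Suc n)"
  unfolding spectrahedron_2_shift3_iff
proof (intro conjI allI shift_gen_Her3)
  fix f g
  define c where "c = shift_radius n"
  have c: "0 < c" using shift_radius_pos[OF n] by (simp add: c_def)
  have "cmod (\<Sum>k<n. g k * cnj (f (Suc k))) \<le> (\<Sum>k<n. ((cmod (g k))\<^sup>2 + (cmod (f (Suc k)))\<^sup>2) / 2)"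
  proof (rule sum_norm_le)
    fix k
    show "cmod (g k * cnj (f (Suc k))) \<le> ((cmod (g k))\<^sup>2 + (cmod (f (Suc k)))\<^sup>2) / 2"
      using sum_squares_bound[of "cmod (g k)" "cmod (f (Suc k))"] by (simp add: norm_mult)
  qed
  also have "\<dots> = ((\<Sum>k<n. (cmod (g k))\<^sup>2) + (\<Sum>k<n. (cmod (f (Suc k)))\<^sup>2)) / 2"
    by (simp add: sum.distrib sum_divide_distrib add_divide_distrib)
  also have "\<dots> \<le> ((\<Sum>k<Suc n. (cmod (g k))\<^sup>2) + (\<Sum>k<Suc n. (cmod (f k))\<^sup>2)) / 2"
    using sum.lessThan_Suc_shift[of "\<lambda>k. (cmod (f k))\<^sup>2" n] by simp
  finally have b: "cmod (\<Sum>k<n. g k * cnj (f (Suc k))) \<le> ((\<Sum>k<Suc n. (cmod (g k))\<^sup>2) + (\<Sum>k<Suc n. (cmod (f k))\<^sup>2)) / 2" .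
  have "2 * c * Re (twist (Suc n) (shift_gen n) g f) = 2 * Re (\<Sum>k<n. g k * cnj (f (Suc k)))"
    unfolding shift_gen_forms c_def[symmetric] using c by simp
  moreover have "- cmod (\<Sum>k<n. g k * cnj (f (Suc k))) \<le> Re (\<Sum>k<n. g k * cnj (f (Suc k)))"
    using abs_Re_le_cmod[of "\<Sum>k<n. g k * cnj (f (Suc k))"] by linarith
  ultimately show "0 \<le> Re (sesq (Suc n) (fst (shift_gen n)) f f) + Re (sesq (Suc n) (fst (shift_gen n)) g g)
      + 2 * shift_radius n * Re (twist (Suc n) (shift_gen n) g f)"
    unfolding shift_gen_forms(1) c_def[symmetric] Re_complex_of_real using b by (simp del: sum.lessThan_Suc)
qed

text \<open>The condition that \<open>c\<^sub>n X\<close> be a contraction defines an operator system containing \<open>shift_gen n\<close>, and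
  therefore bounds the numerical range generated by \<open>shift_gen n\<close> from above.  As \<open>n\<close> grows these bounds
  shrink to the smallest system.\<close>
lemma op_system_spectrahedron_2:
  assumes n: "1 \<le> n"
  shows "op_system (spectrahedron 2 (shift3 2 (2 * shift_radius n)))"
proof (rule op_system_over_lorentz_cone)
  have c: "0 < shift_radius n" using shift_radius_pos[OF n] .
  show "cone_system (spectrahedron 2 (shift3 2 (2 * shift_radius n)))"
    by (intro cone_system_spectrahedron shift3_Her3)
  have L: "level_one (spectrahedron 2 (shift3 2 (2 * shift_radius n))) = {a. shift_radius n * cmod (planar a) \<le> fst a}"
    using level_one_shift3[of "2 * shift_radius n" 1] c unfolding shift_radius_1 unfolding numeral_2_eq_2 One_nat_def by simp
  show "lorentz_cone \<subseteq> level_one (spectrahedron 2 (shift3 2 (2 * shift_radius n)))"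
  proof
    fix a assume "a \<in> lorentz_cone"
    then have "cmod (planar a) \<le> fst a" by (simp add: lorentz_cone_iff)
    moreover have "shift_radius n * cmod (planar a) \<le> 1 * cmod (planar a)"
      by (intro mult_right_mono shift_radius_le_1) simp
    ultimately show "a \<in> level_one (spectrahedron 2 (shift3 2 (2 * shift_radius n)))" unfolding L by simp
  qed
  show "0 < shift_radius n" by (rule c)
  show "shift_radius n * cmod (planar a) \<le> fst a" if "a \<in> level_one (spectrahedron 2 (shift3 2 (2 * shift_radius n)))" for a
    using that unfolding L by simp
qed

text \<open>Defining the generated system as an intersection makes minimality and closedness immediate.  The
  largest system over the circular cone takes part in the intersection and keeps level one from
  being too large.\<close>
definition shift_range :: "nat \<Rightarrow> nat \<Rightarrow> mat3 set" where
  "shift_range n s = (\<Inter>C \<in> {C. op_system C \<and> shift_gen n \<in> C (Suc n)}. C s)"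

lemma level_one_combine:
  assumes C: "cone_system C" and "a \<in> level_one C" "b \<in> level_one C" "0 \<le> x" "0 \<le> y"
  shows "x *\<^sub>R a + y *\<^sub>R b \<in> level_one C"
proof -
  have "add3 (scale3 x (point3 a)) (scale3 y (point3 b)) = point3 (x *\<^sub>R a + y *\<^sub>R b)"
    by (auto simp: point3_def intro!: eq_matI)
  then show ?thesis
    using cone_system_combine[OF C, of 1 "point3 a" "point3 b" x y] assms by (simp add: level_one_iff)
qed

text \<open>The rotated eigenvectors compress \<open>shift_gen n\<close> to the points of the circle \<open>(1, cos \<phi>, sin \<phi>)\<close> up to a
  positive factor, and every point of the cone is a combination of two opposite ones.\<close>
lemma lorentz_cone_subset_level_one:
  assumes C: "cone_system C" and n: "1 \<le> n" and M: "shift_gen n \<in> C (Suc n)"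
  shows "lorentz_cone \<subseteq> level_one C"
proof
  have circle: "(1, Re z, Im z) \<in> level_one C" if z: "cmod z = 1" for z
  proof -
    define x where "x = (\<lambda>k. of_real (shift_eigvec n (Suc k)) * z ^ k)"
    define S where "S = (\<Sum>k<Suc n. (cmod (x k))\<^sup>2)"
    have T: "(\<Sum>k<n. x (Suc k) * cnj (x k)) = z * of_real (shift_radius n * S)" and S: "0 < S"
      unfolding x_def S_def by (rule shift_norm_attained[OF z])+
    have "(\<Sum>k<n. x k * cnj (x (Suc k))) = cnj (\<Sum>k<n. x (Suc k) * cnj (x k))" by (simp add: mult.commute)
    then have tw: "twist (Suc n) (shift_gen n) x x = cnj z * of_real S"
      unfolding shift_gen_forms T using shift_radius_pos[OF n] by simp
    define q where "q = quad3 (Suc n) (shift_gen n) x"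
    have "q \<in> level_one C" unfolding q_def by (rule cone_system_quad3[OF C _ M]) simp
    moreover have "fst q = S" unfolding q_def quad3_def fst_conv shift_gen_forms S_def by simp
    moreover have "planar q = cnj z * of_real S" unfolding q_def planar_quad3[OF shift_gen_Her3] tw ..
    then have "fst (snd q) = S * Re z" "snd (snd q) = S * Im z" by (auto simp: planar_def complex_eq_iff)
    ultimately have "(S, S * Re z, S * Im z) \<in> level_one C" by (metis prod.collapse)
    from level_one_combine[OF C this this, of "1 / S" 0] S show ?thesis by simp
  qed
  fix a assume a: "a \<in> lorentz_cone"
  define r where "r = cmod (planar a)"
  have r: "0 \<le> r" "r \<le> fst a" using a by (auto simp: r_def lorentz_cone_iff)
  obtain z where z: "cmod z = 1" "z * planar a = of_real r" unfolding r_def using unit_aligned by blast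
  have "planar a = cnj z * z * planar a" using z(1) by (metis complex_norm_square mult.commute mult_1 of_real_1 one_power2)
  then have p: "planar a = cnj z * of_real r" using z(2) by (simp add: mult.assoc)
  have "((fst a + r) / 2) *\<^sub>R (1, Re z, Im z) + ((fst a - r) / 2) *\<^sub>R (1, Re (- z), Im (- z)) \<in> level_one C"
    using r z(1) by (intro level_one_combine[OF C] circle) auto
  moreover have "((fst a + r) / 2) *\<^sub>R (1, Re z, Im z) + ((fst a - r) / 2) *\<^sub>R (1, Re (- z), Im (- z)) = a"
    using p by (cases a) (auto simp: planar_def complex_eq_iff field_simps)
  ultimately show "a \<in> level_one C" by simp
qed

lemma shift_range:
  assumes n: "1 \<le> n"
  shows "free_numerical_range (shift_range n)" "level_one (shift_range n) = lorentz_cone"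
proof -
  let ?F = "{C. op_system C \<and> shift_gen n \<in> C (Suc n)}"
  have lrg: "largest_sys lorentz_cone \<in> ?F"
    using largest_sys_op_system shift_gen_in_largest_sys[OF n] by simp
  have C: "cone_system (shift_range n)"
    unfolding shift_range_def[abs_def]
    by (rule cone_system_Inter) (use lrg op_system_imp_cone_system in blast)+
  have M: "shift_gen n \<in> shift_range n (Suc n)" by (simp add: shift_range_def)
  have sub: "level_one (shift_range n) \<subseteq> lorentz_cone"
  proof
    fix a assume "a \<in> level_one (shift_range n)"
    moreover have "shift_range n 1 \<subseteq> largest_sys lorentz_cone 1"
      unfolding shift_range_def using lrg by (rule INT_lower)
    ultimately have "a \<in> level_one (largest_sys lorentz_cone)" unfolding level_one_iff by (rule rev_subsetD)
    then show "a \<in> lorentz_cone" by (simp only: level_one_largest_sys)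
  qed
  show L: "level_one (shift_range n) = lorentz_cone"
    using sub lorentz_cone_subset_level_one[OF C n M] by blast
  have op: "op_system (shift_range n)"
    by (rule op_system_over_lorentz_cone[OF C, where k = 1]) (auto simp: L lorentz_cone_iff)
  have "sys_contained (shift_range n) C'" if "op_system C'" "shift_gen n \<in> C' (Suc n)" for C'
    unfolding sys_contained_def shift_range_def using that by blast
  then show "free_numerical_range (shift_range n)"
    unfolding free_numerical_range_def using op M
    by (intro conjI exI[of _ "{(Suc n, shift_gen n)}"]) auto
qed

lemma smallest_sys_eq_Inter_numerical_ranges:
  assumes s: "1 \<le> s"
  shows "smallest_sys lorentz_cone s = \<Inter>{C s | C. free_numerical_range C \<and> level_one C = lorentz_cone}"
proof
  show "smallest_sys lorentz_cone s \<subseteq> \<Inter>{C s | C. free_numerical_range C \<and> level_one C = lorentz_cone}"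
  proof (rule Inter_greatest, clarify)
    fix A C assume "A \<in> smallest_sys lorentz_cone s" "free_numerical_range C" "level_one C = lorentz_cone"
    then show "A \<in> C s"
      using smallest_sys_subset[of C s] op_system_imp_cone_system s by (auto simp: free_numerical_range_def)
  qed
next
  show "\<Inter>{C s | C. free_numerical_range C \<and> level_one C = lorentz_cone} \<subseteq> smallest_sys lorentz_cone s"
  proof
    fix A assume A: "A \<in> \<Inter>{C s | C. free_numerical_range C \<and> level_one C = lorentz_cone}"
    have mem: "A \<in> spectrahedron 2 (shift3 2 (2 * shift_radius (Suc n))) s" for n
    proof -
      have "A \<in> shift_range (Suc n) s" using A shift_range[of "Suc n"] by auto
      then show ?thesis unfolding shift_range_def
        using op_system_spectrahedron_2[of "Suc n"] shift_gen_in_spectrahedron_2[of "Suc n"] by auto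
    qed
    have "0 \<le> Re (sesq s (fst A) f f) + Re (sesq s (fst A) g g) + 2 * 1 * Re (twist s A g f)" for f g
    proof (rule tendsto_lowerbound)
      show "(\<lambda>n. Re (sesq s (fst A) f f) + Re (sesq s (fst A) g g) + 2 * shift_radius (Suc n) * Re (twist s A g f))
        \<longlonglongrightarrow> Re (sesq s (fst A) f f) + Re (sesq s (fst A) g g) + 2 * 1 * Re (twist s A g f)"
        by (intro tendsto_intros LIMSEQ_Suc[OF shift_radius_tendsto])
      show "\<forall>\<^sub>F n in sequentially. 0 \<le> Re (sesq s (fst A) f f) + Re (sesq s (fst A) g g) + 2 * shift_radius (Suc n) * Re (twist s A g f)"
        using mem by (simp add: spectrahedron_2_shift3_iff)
    qed simp
    then have "A \<in> spectrahedron 2 (shift3 2 2) s"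
      using mem by (simp add: spectrahedron_2_shift3_iff)
    then show "A \<in> smallest_sys lorentz_cone s"
      using spectrahedron_2_subset_smallest_sys[OF s] by blast
  qed
qed

section \<open>A point outside all free spectrahedra\<close>

text \<open>A Gram factor \<open>Y\<close> of a positive definite \<open>H\<close> has trivial kernel, hence an inverse \<open>N\<close>, and
  \<open>\<parallel>f\<parallel> = \<parallel>N Y f\<parallel>\<close> is bounded by a multiple of \<open>\<parallel>Y f\<parallel>\<close>.\<close>
lemma positive_definite_coercive:
  assumes P: "psd r H" and nz: "\<And>v. v \<in> carrier_vec r \<Longrightarrow> v \<noteq> 0\<^sub>v r \<Longrightarrow> Re (sesq r H (($) v) (($) v)) \<noteq> 0"
  obtains e where "0 < e" "\<And>f. e * (\<Sum>i<r. (cmod (f i))\<^sup>2) \<le> Re (sesq r H f f)"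
proof -
  obtain w where w: "\<And>i j. i < r \<Longrightarrow> j < r \<Longrightarrow> H $$ (i, j) = (\<Sum>k<r. w k i * cnj (w k j))"
    using psd_rank_one_decomposition[OF P] by blast
  define Y where "Y = mat r r (\<lambda>(k, j). cnj (w k j))"
  have YC: "Y \<in> carrier_mat r r" by (simp add: Y_def)
  have Yf: "(Y *\<^sub>v vec r f) $ k = (\<Sum>j<r. cnj (w k j) * f j)" if "k < r" for f k
    using that by (subst mult_mat_vec_conv_sum[of _ _ r]) (auto simp: Y_def)
  have q: "Re (sesq r H f f) = (\<Sum>k<r. (cmod ((Y *\<^sub>v vec r f) $ k))\<^sup>2)" for f
  proof -
    have "sesq r H f f = (\<Sum>i<r. \<Sum>j<r. \<Sum>k<r. (cnj (w k j) * f j) * cnj (cnj (w k i) * f i))"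
      unfolding sesq_def by (intro sum.cong refl) (simp add: w sum_distrib_left sum_distrib_right ac_simps)
    also have "\<dots> = (\<Sum>i<r. \<Sum>k<r. \<Sum>j<r. (cnj (w k j) * f j) * cnj (cnj (w k i) * f i))"
      by (intro sum.cong[OF refl] sum.swap)
    also have "\<dots> = (\<Sum>k<r. \<Sum>i<r. \<Sum>j<r. (cnj (w k j) * f j) * cnj (cnj (w k i) * f i))"
      by (rule sum.swap)
    also have "\<dots> = (\<Sum>k<r. (\<Sum>j<r. cnj (w k j) * f j) * cnj (\<Sum>i<r. cnj (w k i) * f i))"
      unfolding cnj_sum sum_product by (intro sum.cong[OF refl] sum.swap)
    also have "\<dots> = of_real (\<Sum>k<r. (cmod ((Y *\<^sub>v vec r f) $ k))\<^sup>2)"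
      unfolding of_real_sum complex_norm_square by (intro sum.cong refl) (simp add: Yf del: index_mult_mat_vec cnj_sum)
    finally show ?thesis by simp
  qed
  have "det Y \<noteq> 0"
  proof
    assume "det Y = 0"
    then obtain v where v: "v \<in> carrier_vec r" "v \<noteq> 0\<^sub>v r" "Y *\<^sub>v v = 0\<^sub>v r"
      using det_0_iff_vec_prod_zero_field[OF YC] by blast
    have "vec r (($) v) = v" using v(1) by (intro eq_vecI) auto
    then have "Re (sesq r H (($) v) (($) v)) = 0" unfolding q using v(3) by simp
    then show False using nz[OF v(1,2)] by simp
  qed
  then obtain N where N: "N \<in> carrier_mat r r" "N * Y = 1\<^sub>m r"
    using det_non_zero_imp_unit[OF YC, of "()"] by (auto simp: Units_def ring_mat_def)
  define K where "K = (\<Sum>i<r. \<Sum>k<r. (cmod (N $$ (i, k)))\<^sup>2)"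
  have K0: "0 \<le> K" unfolding K_def by (intro sum_nonneg) simp
  have main: "(\<Sum>i<r. (cmod (f i))\<^sup>2) \<le> K * Re (sesq r H f f)" for f
  proof -
    define y where "y k = (Y *\<^sub>v vec r f) $ k" for k
    have "f i = (\<Sum>k<r. N $$ (i, k) * y k)" if "i < r" for i
    proof -
      have "vec r f = N *\<^sub>v (Y *\<^sub>v vec r f)"
        using assoc_mult_mat_vec[OF N(1) YC, of "vec r f"] N(2) by simp
      then have "f i = (N *\<^sub>v (Y *\<^sub>v vec r f)) $ i" using that by (metis index_vec)
      also have "\<dots> = (\<Sum>k<r. N $$ (i, k) * y k)"
        unfolding y_def using that N(1) YC by (intro mult_mat_vec_conv_sum) auto
      finally show ?thesis .
    qed
    then have "(\<Sum>i<r. (cmod (f i))\<^sup>2) = (\<Sum>i<r. (cmod (\<Sum>k<r. N $$ (i, k) * y k))\<^sup>2)" by simp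
    also have "\<dots> \<le> (\<Sum>i<r. (\<Sum>k<r. (cmod (N $$ (i, k)))\<^sup>2) * (\<Sum>k<r. (cmod (y k))\<^sup>2))"
    proof (rule sum_mono)
      fix i
      have "cmod (\<Sum>k<r. N $$ (i, k) * y k) \<le> (\<Sum>k<r. cmod (N $$ (i, k)) * cmod (y k))"
        by (rule order_trans[OF norm_sum]) (simp add: norm_mult)
      then have "(cmod (\<Sum>k<r. N $$ (i, k) * y k))\<^sup>2 \<le> (\<Sum>k<r. cmod (N $$ (i, k)) * cmod (y k))\<^sup>2"
        by (rule power_mono) simp
      also have "\<dots> \<le> (\<Sum>k<r. (cmod (N $$ (i, k)))\<^sup>2) * (\<Sum>k<r. (cmod (y k))\<^sup>2)"
        by (rule Cauchy_Schwarz_ineq_sum)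
      finally show "(cmod (\<Sum>k<r. N $$ (i, k) * y k))\<^sup>2 \<le> (\<Sum>k<r. (cmod (N $$ (i, k)))\<^sup>2) * (\<Sum>k<r. (cmod (y k))\<^sup>2)" .
    qed
    also have "\<dots> = K * Re (sesq r H f f)" unfolding K_def q y_def by (simp only: sum_distrib_right)
    finally show ?thesis .
  qed
  show ?thesis
  proof (rule that[of "1 / (K + 1)"])
    show "0 < 1 / (K + 1)" using K0 by simp
    fix f
    have "0 \<le> Re (sesq r H f f)" unfolding q by (intro sum_nonneg) simp
    then have "(\<Sum>i<r. (cmod (f i))\<^sup>2) \<le> (K + 1) * Re (sesq r H f f)" using main[of f] by (simp add: distrib_right)
    then show "1 / (K + 1) * (\<Sum>i<r. (cmod (f i))\<^sup>2) \<le> Re (sesq r H f f)"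
      using K0 by (simp add: field_simps)
  qed
qed

lemma interior_lorentz_coneD:
  assumes "u \<in> interior lorentz_cone"
  shows "cmod (planar u) < fst u"
proof -
  obtain e where e: "0 < e" "ball u e \<subseteq> lorentz_cone" using assms by (meson mem_interior)
  define v where "v = u - (e / 2) *\<^sub>R (1, 0, 0)"
  have "dist u v < e" using e(1) by (simp add: v_def dist_norm norm_Pair)
  then have "v \<in> lorentz_cone" using e(2) by auto
  moreover have "fst v = fst u - e / 2" "planar v = planar u" by (auto simp: v_def planar_def)
  ultimately show ?thesis using e(1) by (simp add: lorentz_cone_iff)
qed

definition combination :: "real \<times> real \<times> real \<Rightarrow> mat3 \<Rightarrow> complex mat" where
  "combination a M = complex_of_real (fst a) \<cdot>\<^sub>m fst M + complex_of_real (fst (snd a)) \<cdot>\<^sub>m fst (snd M) +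
     complex_of_real (snd (snd a)) \<cdot>\<^sub>m snd (snd M)"

lemma combination_Her: "M \<in> Her3 r \<Longrightarrow> combination a M \<in> Her r"
  by (auto simp: combination_def Her3_def intro!: Her_add Her_smult)

lemma sesq_combination:
  assumes M: "M \<in> Her3 r"
  shows "Re (sesq r (combination a M) f f) = fst a * Re (sesq r (fst M) f f) + Re (cnj (planar a) * twist r M f f)"
proof -
  obtain M0 M1 M2 where eq: "M = (M0, M1, M2)" and H: "M0 \<in> Her r" "M1 \<in> Her r" "M2 \<in> Her r"
    using M by (cases M) (auto simp: Her3_def)
  have C: "M0 \<in> carrier_mat r r" "M1 \<in> carrier_mat r r" "M2 \<in> carrier_mat r r" using H by auto
  have "sesq r (combination a M) f f = of_real (fst a) * sesq r M0 f f + of_real (fst (snd a)) * sesq r M1 f f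
      + of_real (snd (snd a)) * sesq r M2 f f"
    using C by (simp add: combination_def eq sesq_add sesq_smult)
  moreover have "Im (sesq r M1 f f) = 0" "Im (sesq r M2 f f) = 0"
    using sesq_Her_real[OF H(2), of f] sesq_Her_real[OF H(3), of f] by (metis Im_complex_of_real)+
  ultimately show ?thesis by (simp add: planar_def twist_def eq)
qed

lemma level_one_spectrahedron_iff:
  assumes M: "M \<in> Her3 r"
  shows "a \<in> level_one (spectrahedron r M) \<longleftrightarrow> (\<forall>f. 0 \<le> Re (sesq r (combination a M) f f))"
proof -
  have "a \<in> level_one (spectrahedron r M) \<longleftrightarrow> M \<in> spectrahedron 1 (point3 a) r"
    unfolding level_one_iff by (rule spectrahedron_swap[OF point3_Her3 M])
  also have "\<dots> \<longleftrightarrow> (\<forall>w. 0 \<le> Re (pencil r 1 M (point3 a) w))"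
    using spectrahedron_iff[OF point3_Her3] M by blast
  also have "\<dots> \<longleftrightarrow> (\<forall>w :: nat \<Rightarrow> nat \<Rightarrow> complex. 0 \<le> Re (sesq r (combination a M) (w 0) (w 0)))"
  proof -
    have "Re (pencil r 1 M (point3 a) w) = Re (sesq r (combination a M) (w 0) (w 0))" for w
      using M by (cases M) (simp add: pencil_point3[unfolded One_nat_def] quad3_def combination_def Her3_def sesq_add sesq_smult)
    then show ?thesis by simp
  qed
  also have "\<dots> \<longleftrightarrow> (\<forall>f. 0 \<le> Re (sesq r (combination a M) f f))"
  proof (intro iffI allI)
    fix f assume "\<forall>w :: nat \<Rightarrow> nat \<Rightarrow> complex. 0 \<le> Re (sesq r (combination a M) (w 0) (w 0))"
    from this[rule_format, of "\<lambda>_. f"] show "0 \<le> Re (sesq r (combination a M) f f)" .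
  qed blast
  finally show ?thesis .
qed

text \<open>The pencil of a free spectrahedron over the circular cone, normalized at an interior point \<open>u\<close>.\<close>
context
  fixes r M u
  assumes M: "M \<in> Her3 r" and L: "level_one (spectrahedron r M) = lorentz_cone"
    and u: "u \<in> interior lorentz_cone" and one: "combination u M = 1\<^sub>m r"
begin

lemma lorentz_cone_shift_iff:
  "a - e *\<^sub>R u \<in> lorentz_cone \<longleftrightarrow> (\<forall>f. e * (\<Sum>i<r. (cmod (f i))\<^sup>2) \<le> Re (sesq r (combination a M) f f))"
proof -
  have "(\<Sum>i<r. (cmod (f i))\<^sup>2) = Re (sesq r (combination u M) f f)" for f
    unfolding one sesq_one complex_norm_square[symmetric] by simp
  then have "Re (sesq r (combination (a - e *\<^sub>R u) M) f f) =
      Re (sesq r (combination a M) f f) - e * (\<Sum>i<r. (cmod (f i))\<^sup>2)" for f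
    by (simp only: sesq_combination[OF M] planar_diff_scale) (simp add: algebra_simps)
  then show ?thesis unfolding L[symmetric] level_one_spectrahedron_iff[OF M] by simp
qed

text \<open>If the pencil were positive definite at the boundary point \<open>a\<close>, it would dominate \<open>e\<close> times the
  identity matrix, its value at \<open>u\<close>, for some \<open>e > 0\<close>, and \<open>a - e u\<close> would still be in the cone; but moving against an interior
  direction leaves the cone at once.\<close>
lemma boundary_kernel_vector:
  assumes z: "cmod z = 1"
  obtains v where "v \<in> carrier_vec r" "v \<noteq> 0\<^sub>v r"
    "Re (sesq r (fst M) (($) v) (($) v)) + Re (z * twist r M (($) v) (($) v)) = 0"
proof -
  define a where "a = (1 :: real, Re z, Im z)"
  have pa: "planar a = cnj z" by (simp add: a_def planar_def complex_eq_iff)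
  have aL: "a \<in> lorentz_cone" using z pa by (simp add: lorentz_cone_iff a_def)
  have form: "Re (sesq r (combination a M) f f) = Re (sesq r (fst M) f f) + Re (z * twist r M f f)" for f
    unfolding sesq_combination[OF M] pa by (simp add: a_def)
  have P: "psd r (combination a M)"
    unfolding psd_iff[OF combination_Her[OF M]] using aL L level_one_spectrahedron_iff[OF M] by blast
  have "\<exists>v. v \<in> carrier_vec r \<and> v \<noteq> 0\<^sub>v r \<and> Re (sesq r (combination a M) (($) v) (($) v)) = 0"
  proof (rule ccontr)
    assume "\<not> ?thesis"
    then obtain e where e: "0 < e" "\<And>f. e * (\<Sum>i<r. (cmod (f i))\<^sup>2) \<le> Re (sesq r (combination a M) f f)"
      using positive_definite_coercive[OF P] by metis
    then have "a - e *\<^sub>R u \<in> lorentz_cone" using lorentz_cone_shift_iff by blast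
    then have "cmod (cnj z - of_real e * planar u) \<le> 1 - e * fst u"
      unfolding lorentz_cone_iff planar_diff_scale pa by (simp add: a_def)
    moreover have "1 - e * cmod (planar u) \<le> cmod (cnj z - of_real e * planar u)"
      using norm_triangle_ineq2[of "cnj z" "of_real e * planar u"] z e(1) by (simp add: norm_mult)
    moreover have "e * cmod (planar u) < e * fst u" using interior_lorentz_coneD[OF u] e(1) by simp
    ultimately show False by linarith
  qed
  then show ?thesis using that form by metis
qed

text \<open>Since \<open>(1, 0, 0) - e u\<close> is in the cone for a small \<open>e > 0\<close>, the matrix \<open>M\<^sub>0\<close> is positive definite.\<close>
lemma leading_coefficient_invertible: "det (fst M) \<noteq> 0"
proof
  have C: "fst M \<in> carrier_mat r r" using M by (cases M) (auto simp: Her3_def)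
  assume "det (fst M) = 0"
  then obtain v where v: "v \<in> carrier_vec r" "v \<noteq> 0\<^sub>v r" "fst M *\<^sub>v v = 0\<^sub>v r"
    using det_0_iff_vec_prod_zero_field[OF C] by blast
  have z: "sesq r (fst M) (($) v) (($) v) = 0"
    using sprod_conv_sesq[OF C v(1) v(1)] v(1,3) by simp
  define a where "a = (1 :: real, 0 :: real, 0 :: real)"
  define e where "e = 1 / (2 * fst u)"
  have u0: "0 < fst u" "cmod (planar u) < fst u" using interior_lorentz_coneD[OF u] norm_ge_zero[of "planar u"] by linarith+
  have "e * cmod (planar u) \<le> e * fst u" using u0 by (simp add: e_def divide_right_mono)
  moreover have "e * fst u = 1 / 2" using u0 by (simp add: e_def)
  moreover have "0 < e" using u0 by (simp add: e_def)
  moreover have "planar a = 0" by (simp add: a_def planar_def complex_eq_iff)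
  ultimately have "a - e *\<^sub>R u \<in> lorentz_cone"
    unfolding lorentz_cone_iff planar_diff_scale by (simp add: norm_mult a_def)
  then have "e * (\<Sum>i<r. (cmod (v $ i))\<^sup>2) \<le> Re (sesq r (combination a M) (($) v) (($) v))"
    using lorentz_cone_shift_iff by blast
  also have "\<dots> = 0" unfolding sesq_combination[OF M] z using \<open>planar a = 0\<close> by simp
  finally have "(\<Sum>i<r. (cmod (v $ i))\<^sup>2) \<le> 0" using \<open>0 < e\<close> by (simp add: mult_le_0_iff)
  moreover have "0 < (\<Sum>i<r. (cmod (v $ i))\<^sup>2)"
  proof -
    obtain i where "i < r" "v $ i \<noteq> 0" using v(1,2) by (metis carrier_vecD eq_vecI index_zero_vec)
    then show ?thesis by (intro sum_pos2[of _ i]) auto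
  qed
  ultimately show False by simp
qed

text \<open>Let \<open>v\<close> be a vector at which the pencil vanishes in the direction \<open>z\<close>.  The block form of \<open>M\<close> is
  nonnegative and vanishes at the pair \<open>(z\<^sup>* v, v)\<close>, so its first variation vanishes there; this says
  \<open>z\<^sup>* M\<^sub>0 v + (M\<^sub>1 - \<i> M\<^sub>2) v = 0\<close>.\<close>
lemma unit_circle_in_spectrum:
  assumes B: "M \<in> spectrahedron 2 (shift3 2 2) r" and N: "N \<in> carrier_mat r r" "N * fst M = 1\<^sub>m r"
    and z: "cmod z = 1"
  shows "eigenvalue (N * (fst (snd M) + (- \<i>) \<cdot>\<^sub>m snd (snd M))) (- cnj z)"
proof -
  obtain M0 M1 M2 where eq: "M = (M0, M1, M2)" and H: "M0 \<in> Her r" "M1 \<in> Her r" "M2 \<in> Her r"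
    using M by (cases M) (auto simp: Her3_def)
  have C: "M0 \<in> carrier_mat r r" "M1 \<in> carrier_mat r r" "M2 \<in> carrier_mat r r" using H by auto
  define X where "X = M1 + (- \<i>) \<cdot>\<^sub>m M2"
  have XC: "X \<in> carrier_mat r r" using C by (auto simp: X_def)
  have tw: "twist r M f g = sesq r X f g" for f g
    using C by (simp add: twist_def eq X_def sesq_add sesq_smult)
  obtain v where v: "v \<in> carrier_vec r" "v \<noteq> 0\<^sub>v r"
    and v0: "Re (sesq r M0 (($) v) (($) v)) + Re (z * twist r M (($) v) (($) v)) = 0"
    using boundary_kernel_vector[OF z] unfolding eq by auto
  define g where "g = ($) v"
  define f where "f = (\<lambda>i. cnj z * g i)"
  have zz: "z * cnj z = 1" using z by (simp add: complex_norm_square[symmetric])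
  have ff: "sesq r M0 f f = sesq r M0 g g"
    unfolding f_def sesq_scale_left sesq_scale_right using zz by (simp add: mult.assoc[symmetric] mult.commute)
  have blk: "0 \<le> Re (sesq r M0 f' f') + Re (sesq r M0 g g) + 2 * Re (twist r M g f')" for f'
    using B unfolding spectrahedron_2_shift3_iff eq by simp
  have twf: "twist r M g f = z * twist r M g g"
    unfolding tw f_def sesq_scale_right by simp
  have orth: "sesq r M0 f h + twist r M g h = 0" for h
  proof -
    define y where "y = sesq r M0 f h + twist r M g h"
    define m where "m = Re (sesq r M0 h h)"
    have quad: "0 \<le> e\<^sup>2 * (cmod y)\<^sup>2 * m - 2 * e * (cmod y)\<^sup>2" for e :: real
    proof -
      \<comment> \<open>vary the first block in the direction of steepest descent\<close>
      define d where "d = - of_real e * y"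
      have "0 \<le> Re (sesq r M0 (\<lambda>i. f i + d * h i) (\<lambda>i. f i + d * h i)) + Re (sesq r M0 g g)
          + 2 * Re (twist r M g (\<lambda>i. f i + d * h i))" by (rule blk)
      also have "sesq r M0 (\<lambda>i. f i + d * h i) (\<lambda>i. f i + d * h i) =
          sesq r M0 f f + (cnj d * sesq r M0 f h + cnj (cnj d * sesq r M0 f h)) + d * cnj d * sesq r M0 h h"
        unfolding sesq_add_left sesq_add_right sesq_scale_left sesq_scale_right sesq_Her_swap[OF H(1), of h f]
        by (simp add: algebra_simps)
      also have "twist r M g (\<lambda>i. f i + d * h i) = twist r M g f + cnj d * twist r M g h"
        unfolding tw sesq_add_right sesq_scale_right ..
      also have "d * cnj d = of_real (e\<^sup>2 * (cmod y)\<^sup>2)"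
        unfolding of_real_mult complex_norm_square d_def by (simp add: power2_eq_square)
      finally have "0 \<le> Re (sesq r M0 f f) + Re (sesq r M0 g g) + 2 * Re (twist r M g f)
          + 2 * Re (cnj d * y) + e\<^sup>2 * (cmod y)\<^sup>2 * m"
        by (simp add: y_def m_def algebra_simps)
      moreover have "Re (sesq r M0 f f) + Re (sesq r M0 g g) + 2 * Re (twist r M g f) = 0"
        using v0 unfolding ff twf g_def[symmetric] by simp
      moreover have "cnj d * y = of_real (- e * (cmod y)\<^sup>2)"
        unfolding of_real_mult complex_norm_square d_def by simp
      ultimately show ?thesis by simp
    qed
    define K where "K = \<bar>m\<bar> + 1"
    have K: "0 < K" "m < 2 * K" by (auto simp: K_def)
    have "0 \<le> K\<^sup>2 * ((1 / K)\<^sup>2 * (cmod y)\<^sup>2 * m - 2 * (1 / K) * (cmod y)\<^sup>2)"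
      by (rule mult_nonneg_nonneg[OF _ quad]) simp
    also have "\<dots> = (cmod y)\<^sup>2 * (m - 2 * K)"
      using K(1) by (simp add: power2_eq_square algebra_simps)
    finally have "(cmod y)\<^sup>2 \<le> 0" using K(2) by (simp add: zero_le_mult_iff)
    then show ?thesis by (simp add: y_def)
  qed
  have "X *\<^sub>v v = (- cnj z) \<cdot>\<^sub>v (M0 *\<^sub>v v)"
  proof (rule eq_vecI)
    fix i assume "i < dim_vec ((- cnj z) \<cdot>\<^sub>v (M0 *\<^sub>v v))"
    then have i: "i < r" using C by simp
    have ent: "sesq r Y g (\<lambda>k. if k = i then 1 else 0) = (Y *\<^sub>v v) $ i" if Y: "Y \<in> carrier_mat r r" for Y
    proof -
      have "sesq r Y g (\<lambda>k. if k = i then 1 else 0) = (\<Sum>i'<r. if i' = i then \<Sum>j<r. Y $$ (i, j) * g j else 0)"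
        unfolding sesq_def by (intro sum.cong refl) auto
      also have "\<dots> = (\<Sum>j<r. Y $$ (i, j) * v $ j)" using i by (simp add: g_def)
      also have "\<dots> = (Y *\<^sub>v v) $ i" using Y v(1) i by (intro mult_mat_vec_conv_sum[symmetric]) auto
      finally show ?thesis .
    qed
    have "cnj z * (M0 *\<^sub>v v) $ i + (X *\<^sub>v v) $ i = 0"
      using orth[of "\<lambda>k. if k = i then 1 else 0"] unfolding f_def sesq_scale_left tw ent[OF C(1)] ent[OF XC] .
    then show "(X *\<^sub>v v) $ i = ((- cnj z) \<cdot>\<^sub>v (M0 *\<^sub>v v)) $ i"
      using i C by (simp add: eq_neg_iff_add_eq_0 add.commute del: index_mult_mat_vec)
  qed (use C XC in auto)
  then have "(N * X) *\<^sub>v v = N *\<^sub>v ((- cnj z) \<cdot>\<^sub>v (M0 *\<^sub>v v))"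
    using assoc_mult_mat_vec[OF N(1) XC v(1)] by simp
  also have "\<dots> = (- cnj z) \<cdot>\<^sub>v (N *\<^sub>v (M0 *\<^sub>v v))"
    using C v(1) by (intro mult_mat_vec[OF N(1)]) auto
  also have "N *\<^sub>v (M0 *\<^sub>v v) = v"
    using assoc_mult_mat_vec[OF N(1) C(1) v(1)] N(2) v(1) by (simp add: eq)
  finally have "eigenvector (N * X) v (- cnj z)"
    using v N(1) XC by (simp add: eigenvector_def)
  then show ?thesis unfolding eigenvalue_def X_def eq by auto
qed

end

lemma infinite_unit_circle: "infinite {z :: complex. cmod z = 1}"
proof
  assume fin: "finite {z :: complex. cmod z = 1}"
  define n where "n = Suc (card {z :: complex. cmod z = 1})"
  have "{z :: complex. z ^ n = 1} \<subseteq> {z. cmod z = 1}"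
  proof safe
    fix z :: complex assume "z ^ n = 1"
    then have "cmod z ^ n = 1" by (metis norm_one norm_power)
    then show "cmod z = 1" using power_eq_imp_eq_base[of "cmod z" n 1] by (simp add: n_def)
  qed
  then have "card {z :: complex. z ^ n = 1} \<le> card {z :: complex. cmod z = 1}" by (rule card_mono[OF fin])
  moreover have "card {z :: complex. z ^ n = 1} = n" by (rule card_roots_unity_eq) (simp add: n_def)
  ultimately show False by (simp add: n_def)
qed

text \<open>By duality the defining triple of \<open>C\<close> would satisfy the contraction condition, and all points of the
  unit circle would be eigenvalues of one matrix.\<close>
lemma not_in_free_spectrahedron:
  assumes C: "free_spectrahedron C" and L: "level_one C = lorentz_cone"
  shows "shift3 2 2 \<notin> C 2"
proof
  assume mem: "shift3 2 2 \<in> C 2"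
  obtain r M0 M1 M2 u0 u1 u2 where M: "(M0, M1, M2) \<in> Her3 r"
    and Cs: "\<And>s. 1 \<le> s \<Longrightarrow> C s = spectrahedron r (M0, M1, M2) s"
    and u: "(u0, u1, u2) \<in> interior (level_one C)"
    and one: "complex_of_real u0 \<cdot>\<^sub>m M0 + complex_of_real u1 \<cdot>\<^sub>m M1 + complex_of_real u2 \<cdot>\<^sub>m M2 = 1\<^sub>m r"
    using C unfolding free_spectrahedron_def by fast
  let ?M = "(M0, M1, M2)"
  have L': "level_one (spectrahedron r ?M) = lorentz_cone"
    using L unfolding level_one_def Cs[OF order_refl] .
  have u': "(u0, u1, u2) \<in> interior lorentz_cone" using u L by simp
  have one': "combination (u0, u1, u2) ?M = 1\<^sub>m r" using one by (simp add: combination_def)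
  have MC: "M0 \<in> carrier_mat r r" "M1 \<in> carrier_mat r r" "M2 \<in> carrier_mat r r" using M by (auto simp: Her3_def)
  have B: "?M \<in> spectrahedron 2 (shift3 2 2) r"
    using mem unfolding Cs[OF one_le_numeral] spectrahedron_swap[OF shift3_Her3 M] .
  have "det M0 \<noteq> 0" using leading_coefficient_invertible[OF M L' u' one'] by simp
  then obtain N where N: "N \<in> carrier_mat r r" "N * M0 = 1\<^sub>m r"
    using det_non_zero_imp_unit[OF MC(1), of "()"] by (auto simp: Units_def ring_mat_def)
  define T where "T = N * (M1 + (- \<i>) \<cdot>\<^sub>m M2)"
  have TC: "T \<in> carrier_mat r r" using N MC by (auto simp: T_def)
  have "{z. cmod z = 1} \<subseteq> spectrum T"
  proof safe
    fix z assume z: "cmod z = 1"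
    have "eigenvalue T (- cnj (- cnj z))"
      unfolding T_def using unit_circle_in_spectrum[OF M L' u' one' B N(1), of "- cnj z"] N(2) z by simp
    then show "z \<in> spectrum T" by (simp add: spectrum_def)
  qed
  then show False
    using card_finite_spectrum(1)[OF TC] infinite_unit_circle finite_subset by blast
qed

lemma shift_gen_1: "shift_gen 1 = shift3 2 2"
  unfolding shift_gen_def shift_radius_1 by (simp add: numeral_2_eq_2)

section \<open>Absence of a finite cofinal family\<close>

text \<open>The scaled \<open>2 \<times> 2\<close> triples \<open>shift3 2 (2 c\<^sub>n)\<close> lie in the spectrahedra of the scaled shifts and tend to
  \<open>shift3 2 2\<close>.  By the pigeonhole principle one member of a finite family would contain infinitely many
  of them, and with them the limit.\<close>
lemma no_finite_cofinal_family:
  assumes F: "finite F" and over: "\<And>C. C \<in> F \<Longrightarrow> free_spectrahedron C \<and> level_one C = lorentz_cone"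
    and cof: "\<And>C. free_spectrahedron C \<Longrightarrow> level_one C = lorentz_cone \<Longrightarrow> \<exists>C'\<in>F. sys_contained C C'"
  shows False
proof -
  define S where "S n = spectrahedron (Suc (Suc n)) (shift_gen (Suc n))" for n
  have "\<exists>C'\<in>F. sys_contained (S n) C'" for n
    unfolding S_def by (intro cof free_spectrahedron_shift_gen level_one_shift_gen) auto
  then obtain c where c: "\<And>n. c n \<in> F" "\<And>n. sys_contained (S n) (c n)" by metis
  have "range c \<subseteq> F" using c(1) by blast
  then have "finite (range c)" using F finite_subset by blast
  then obtain n0 where inf: "infinite {n. c n = c n0}"
    using pigeonhole_infinite[of UNIV c] by auto
  define C where "C = c n0"
  obtain \<phi> :: "nat \<Rightarrow> nat" where phi: "strict_mono \<phi>" "\<And>k. \<phi> k \<in> {n. c n = c n0}"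
    using infinite_enumerate[OF inf] by auto
  define X where "X k = shift3 2 (2 * shift_radius (Suc (\<phi> k)))" for k
  have XC: "X k \<in> C 2" for k
  proof -
    have "X k \<in> S (\<phi> k) 2"
      unfolding S_def X_def using shift_gen_in_spectrahedron_2[of "Suc (\<phi> k)"]
      by (subst spectrahedron_swap[OF shift3_Her3 shift_gen_Her3]) simp
    moreover have "S (\<phi> k) 2 \<subseteq> C 2" using c(2)[of "\<phi> k"] phi(2)[of k] by (simp add: C_def sys_contained_def)
    ultimately show ?thesis by blast
  qed
  have free: "free_spectrahedron C" "level_one C = lorentz_cone" using over c(1)[of n0] by (auto simp: C_def)
  then obtain r M where M: "M \<in> Her3 r" and C2: "C 2 = spectrahedron r M 2"
    unfolding free_spectrahedron_def by (metis one_le_numeral)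
  have lim: "(\<lambda>k. shift_radius (Suc (\<phi> k))) \<longlonglongrightarrow> 1"
    using LIMSEQ_subseq_LIMSEQ[OF LIMSEQ_Suc[OF shift_radius_tendsto] phi(1)] by (simp add: o_def)
  have ent: "(\<lambda>k. entry3 (X k) (i, j)) \<longlonglongrightarrow> entry3 (shift3 2 2) (i, j)" if "i < 2" "j < 2" for i j
  proof -
    have l: "(\<lambda>k. complex_of_real (2 * shift_radius (Suc (\<phi> k)))) \<longlonglongrightarrow> of_real 2"
      using tendsto_of_real[OF tendsto_mult[OF tendsto_const lim], of 2] unfolding mult_1_right .
    have e: "entry3 (shift3 2 t) (i, j) = (1\<^sub>m 2 $$ (i, j), (if j = Suc i \<or> i = Suc j then 1 / 2 else 0) * of_real t,
        (if j = Suc i then - \<i> / 2 else if i = Suc j then \<i> / 2 else 0) * of_real t)" for t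
      using that by (simp add: shift3_def)
    show ?thesis
      unfolding X_def e by (intro tendsto_Pair tendsto_mult tendsto_const l)
  qed
  have "0 \<le> Re (pencil 2 r (shift3 2 2) M w)" for w
  proof (rule tendsto_lowerbound)
    show "(\<lambda>k. Re (pencil 2 r (X k) M w)) \<longlonglongrightarrow> Re (pencil 2 r (shift3 2 2) M w)"
      by (intro tendsto_Re tendsto_pencil ent)
    show "\<forall>\<^sub>F k in sequentially. 0 \<le> Re (pencil 2 r (X k) M w)"
      using XC unfolding C2 spectrahedron_iff[OF M] by simp
  qed simp
  then have "shift3 2 2 \<in> C 2" unfolding C2 spectrahedron_iff[OF M] using shift3_Her3 by blast
  then show False using not_in_free_spectrahedron[OF free] by blast
qed

section \<open>The spectrahedra and numerical ranges over the circular cone\<close>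

theorem theorem3p8:
  fixes D :: "(real \<times> real \<times> real) set"
  assumes D: "D = {(a0, a1, a2). 0 \<le> a0 \<and> a1\<^sup>2 + a2\<^sup>2 \<le> a0\<^sup>2}"
  shows
    "(\<forall>s \<ge> 1. (top3 s) interior_of (largest_sys D s)
        \<subseteq> \<Union>{C s | C. free_spectrahedron C \<and> level_one C = D})
     \<and> (\<forall>s \<ge> 1. smallest_sys D s
        = \<Inter>{C s | C. free_numerical_range C \<and> level_one C = D})
     \<and> (\<exists>s \<ge> 1. \<exists>A \<in> largest_sys D s.
        \<forall>C. free_spectrahedron C \<and> level_one C = D \<longrightarrow> A \<notin> C s)
     \<and> \<not> (\<exists>F. finite F \<and> (\<forall>C \<in> F. free_spectrahedron C \<and> level_one C = D) \<and>
        (\<forall>C. free_spectrahedron C \<and> level_one C = D \<longrightarrow> (\<exists>C' \<in> F. sys_contained C C')))"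
proof -
  have DL: "D = lorentz_cone" by (simp add: D lorentz_cone_def)
  show ?thesis unfolding DL
  proof (intro conjI allI impI)
    fix s :: nat assume s: "1 \<le> s"
    show "(top3 s) interior_of (largest_sys lorentz_cone s)
        \<subseteq> \<Union>{C s | C. free_spectrahedron C \<and> level_one C = lorentz_cone}"
    proof
      fix A assume "A \<in> (top3 s) interior_of (largest_sys lorentz_cone s)"
      then obtain n where "1 \<le> n" "A \<in> spectrahedron (Suc n) (shift_gen n) s"
        by (rule interior_largest_sys_subset)
      then show "A \<in> \<Union>{C s | C. free_spectrahedron C \<and> level_one C = lorentz_cone}"
        using free_spectrahedron_shift_gen level_one_shift_gen by blast
    qed
    show "smallest_sys lorentz_cone s = \<Inter>{C s | C. free_numerical_range C \<and> level_one C = lorentz_cone}"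
      by (rule smallest_sys_eq_Inter_numerical_ranges[OF s])
  next
    have "shift3 2 2 \<in> largest_sys lorentz_cone 2"
      using shift_gen_in_largest_sys[of 1] unfolding shift_gen_1 by (simp add: numeral_2_eq_2)
    then show "\<exists>s \<ge> 1. \<exists>A \<in> largest_sys lorentz_cone s.
        \<forall>C. free_spectrahedron C \<and> level_one C = lorentz_cone \<longrightarrow> A \<notin> C s"
      using not_in_free_spectrahedron by (intro exI[of _ 2]) auto
  next
    show "\<not> (\<exists>F. finite F \<and> (\<forall>C \<in> F. free_spectrahedron C \<and> level_one C = lorentz_cone) \<and>
        (\<forall>C. free_spectrahedron C \<and> level_one C = lorentz_cone \<longrightarrow> (\<exists>C' \<in> F. sys_contained C C')))"
      by (intro notI, elim exE conjE, rule no_finite_cofinal_family) auto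
  qed
qed

end
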